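(* Let $p$ be an odd prime and let $\Gamma=(V,E)$ be a semisymmetric graph of order $2p^3$ with bipartition $V=W\cup U$ (so $|W|=|U|=p^3$), and let $A=\mathrm{Aut}(\Gamma)$. Suppose that $A$ acts unfaithfully on $W$, and let $A_{(W)}$ be the kernel of this action. Let $\mathcal{W}=W$, let $\mathcal{U}$ be the set of orbits of $A_{(W)}$ on $U$, and let $\Sigma=\Gamma_{A_{(W)}}$ be the quotient graph of $\Gamma$ relative to the partition of $V$ into the orbits of $A_{(W)}$ (whose vertex set is identified with $\mathcal{W}\cup\mathcal{U}$, each vertex $w\in W$ being its own orbit). Then: (1) every orbit of $A_{(W)}$ on $U$ has length $p$, $A_{(W)}\cong (S_p)^{p^2}$, and $\Gamma$ is expanded from $\Sigma$; (2) $A/A_{(W)}$ acts faithfully on $\mathcal{U}$ and hence on $\mathcal{W}\cup\mathcal{U}$, and $A/A_{(W)}\cong \mathrm{Aut}(\Sigma)$; (3) $A$ acts faithfully on $U$, and there are no two distinct vertices in $W$ having the same neighborhood in $\Gamma$.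
   Context: All graphs are finite, simple and undirected. A graph is semisymmetric if it is regular and edge-transitive but not vertex-transitive; such a graph is bipartite with two biparts of equal size, each preserved setwise by the subgroup of automorphisms preserving both parts, which is transitive on each part. For a partition $\mathcal{P}$ of the vertex set, the quotient graph $\Gamma_{\mathcal P}$ has vertex set $\mathcal P$, two parts $V_1,V_2$ being adjacent iff some $v_1\in V_1$ is adjacent in $\Gamma$ to some $v_2\in V_2$; when $\mathcal P$ is the set of orbits of a subgroup $N\le\mathrm{Aut}(\Gamma)$ this is written $\Gamma_N$. Expanded graph: let $\Sigma$ be a connected bipartite graph with bipartition $\mathcal W\cup\mathcal U$, $|\mathcal W|=p^3$, $|\mathcal U|=p^2$, which is edge-transitive and whose automorphism group preserving both parts is transitive on each part, with edge set $\mathcal E$. The graph expanded from $\Sigma$ is the bipartite graph with parts $\mathcal W$ and $\mathcal U\times\mathbb Z_p$ and edge set $\{\{\mathbf w,(\mathbf u,i)\}: \{\mathbf w,\mathbf u\}\in\mathcal E,\ i\in\mathbb Z_p\}$. "$\Gamma$ is expanded from $\Sigma$" means $\Gamma$ is isomorphic to this graph, via an isomorphism that is the identity on $W=\mathcal W$ and maps each orbit $\mathbf u\in\mathcal U$ onto $\{\mathbf u\}\times\mathbb Z_p$. *)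

theory Defs
  imports "HOL-Algebra.Algebra" "HOL-Computational_Algebra.Primes"
begin

section \<open>Finite simple graphs\<close>

record 'a sgraph =
  verts :: "'a set"
  edges :: "'a set set"

definition simple_graph :: "'a sgraph \<Rightarrow> bool" where
  "simple_graph \<Gamma> \<longleftrightarrow> finite (verts \<Gamma>) \<and> edges \<Gamma> \<subseteq> {e. e \<subseteq> verts \<Gamma> \<and> card e = 2}"

definition nbhd :: "'a sgraph \<Rightarrow> 'a \<Rightarrow> 'a set" where
  "nbhd \<Gamma> v = {u \<in> verts \<Gamma>. {v, u} \<in> edges \<Gamma>}"

definition regular_graph :: "'a sgraph \<Rightarrow> bool" where
  "regular_graph \<Gamma> \<longleftrightarrow> (\<exists>d. \<forall>v\<in>verts \<Gamma>. card (nbhd \<Gamma> v) = d)"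

definition connected_graph :: "'a sgraph \<Rightarrow> bool" where
  "connected_graph \<Gamma> \<longleftrightarrow>
     (\<forall>x\<in>verts \<Gamma>. \<forall>y\<in>verts \<Gamma>. (x, y) \<in> {(a, b). {a, b} \<in> edges \<Gamma>}\<^sup>*)"

definition bipartition :: "'a sgraph \<Rightarrow> 'a set \<Rightarrow> 'a set \<Rightarrow> bool" where
  "bipartition \<Gamma> W U \<longleftrightarrow> W \<union> U = verts \<Gamma> \<and> W \<inter> U = {} \<and>
     (\<forall>e\<in>edges \<Gamma>. \<exists>w\<in>W. \<exists>u\<in>U. e = {w, u})"

definition graph_iso :: "'a sgraph \<Rightarrow> 'b sgraph \<Rightarrow> ('a \<Rightarrow> 'b) \<Rightarrow> bool" where
  "graph_iso \<Gamma> \<Delta> f \<longleftrightarrow> bij_betw f (verts \<Gamma>) (verts \<Delta>) \<and>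
     (\<forall>x\<in>verts \<Gamma>. \<forall>y\<in>verts \<Gamma>. {x, y} \<in> edges \<Gamma> \<longleftrightarrow> {f x, f y} \<in> edges \<Delta>)"

section \<open>Automorphism groups and their actions\<close>

definition aut_group :: "'a sgraph \<Rightarrow> ('a \<Rightarrow> 'a) monoid" where
  "aut_group \<Gamma> = (BijGroup (verts \<Gamma>))\<lparr>carrier := {g \<in> Bij (verts \<Gamma>). graph_iso \<Gamma> \<Gamma> g}\<rparr>"

definition vertex_transitive :: "'a sgraph \<Rightarrow> bool" where
  "vertex_transitive \<Gamma> \<longleftrightarrow>
     (\<forall>x\<in>verts \<Gamma>. \<forall>y\<in>verts \<Gamma>. \<exists>g\<in>carrier (aut_group \<Gamma>). g x = y)"

definition edge_transitive :: "'a sgraph \<Rightarrow> bool" where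
  "edge_transitive \<Gamma> \<longleftrightarrow>
     (\<forall>e\<in>edges \<Gamma>. \<forall>f\<in>edges \<Gamma>. \<exists>g\<in>carrier (aut_group \<Gamma>). g ` e = f)"

definition semisymmetric :: "'a sgraph \<Rightarrow> bool" where
  "semisymmetric \<Gamma> \<longleftrightarrow> simple_graph \<Gamma> \<and> regular_graph \<Gamma> \<and> edge_transitive \<Gamma> \<and>
     \<not> vertex_transitive \<Gamma>"

text \<open>The permutation induced on a subset \<open>S\<close> of the vertex set; \<open>BijGroup S\<close>, the target of a
  \<^locale>\<open>group_action\<close> on \<open>S\<close>, consists of functions that are extensional on \<open>S\<close>.\<close>

definition act_on :: "'a set \<Rightarrow> ('a \<Rightarrow> 'a) \<Rightarrow> ('a \<Rightarrow> 'a)" where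
  "act_on S g = restrict g S"

text \<open>The kernel of the action of a permutation group \<open>A\<close> on \<open>S\<close>, i.e. the pointwise stabilizer
  of \<open>S\<close> in \<open>A\<close>.\<close>

definition action_kernel :: "('a \<Rightarrow> 'a) monoid \<Rightarrow> 'a set \<Rightarrow> ('a \<Rightarrow> 'a) set" where
  "action_kernel A S = kernel A (BijGroup S) (act_on S)"

text \<open>The action of a quotient \<open>A Mod K\<close> on a set \<open>P\<close> of \<open>K\<close>-orbits: the coset of \<open>g\<close> sends
  \<open>B\<close> to \<open>g ` B\<close>. All members of the coset have the same image of \<open>B\<close>, so the union below
  is just this image.\<close>

definition coset_act :: "'a set set \<Rightarrow> ('a \<Rightarrow> 'a) set \<Rightarrow> ('a set \<Rightarrow> 'a set)" where
  "coset_act P C = (\<lambda>B\<in>P. \<Union>g\<in>C. g ` B)"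

section \<open>Quotient graphs and expanded graphs\<close>

definition quotient_graph :: "'a sgraph \<Rightarrow> 'a set set \<Rightarrow> 'a set sgraph" where
  "quotient_graph \<Gamma> P = \<lparr>verts = P,
     edges = {{B, C} | B C. B \<in> P \<and> C \<in> P \<and> B \<noteq> C \<and> (\<exists>x\<in>B. \<exists>y\<in>C. {x, y} \<in> edges \<Gamma>)}\<rparr>"

text \<open>The conditions on the bipartite graphs \<open>\<Sigma>\<close> that can be expanded.\<close>

definition expandable :: "nat \<Rightarrow> 'b sgraph \<Rightarrow> 'b set \<Rightarrow> 'b set \<Rightarrow> bool" where
  "expandable p \<Sigma> W U \<longleftrightarrow> simple_graph \<Sigma> \<and> connected_graph \<Sigma> \<and> bipartition \<Sigma> W U \<and>
     card W = p ^ 3 \<and> card U = p ^ 2 \<and> edge_transitive \<Sigma> \<and>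
     (\<forall>x\<in>W. \<forall>y\<in>W. \<exists>g\<in>carrier (aut_group \<Sigma>). g ` W = W \<and> g ` U = U \<and> g x = y) \<and>
     (\<forall>x\<in>U. \<forall>y\<in>U. \<exists>g\<in>carrier (aut_group \<Sigma>). g ` W = W \<and> g ` U = U \<and> g x = y)"

text \<open>The set \<open>{0..<p}\<close> of residues plays the role of \<open>\<int>\<close> modulo \<open>p\<close>, which only serves as an
  index set here.\<close>

definition expanded_graph :: "nat \<Rightarrow> 'b sgraph \<Rightarrow> 'b set \<Rightarrow> 'b set \<Rightarrow> ('b + 'b \<times> nat) sgraph" where
  "expanded_graph p \<Sigma> W U = \<lparr>verts = Inl ` W \<union> Inr ` (U \<times> {0..<p}),
     edges = {{Inl w, Inr (u, i)} | w u i. w \<in> W \<and> u \<in> U \<and> {w, u} \<in> edges \<Sigma> \<and> i \<in> {0..<p}}\<rparr>"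

text \<open>\<open>\<Gamma>\<close>, with bipart \<open>W\<close>, is expanded from a graph \<open>\<Sigma>\<close> whose vertices are sets of vertices of
  \<open>\<Gamma>\<close>, with biparts \<open>\<W>\<close>, consisting of the singletons \<open>{w}\<close> for \<open>w \<in> W\<close>, and \<open>\<U>\<close>. The condition
  \<open>f w = Inl {w}\<close> says that \<open>f\<close> is the identity on \<open>W\<close> when \<open>w\<close> is identified with \<open>{w}\<close>.\<close>

definition expanded_from ::
  "nat \<Rightarrow> 'a sgraph \<Rightarrow> 'a set \<Rightarrow> 'a set sgraph \<Rightarrow> 'a set set \<Rightarrow> 'a set set \<Rightarrow> bool" where
  "expanded_from p \<Gamma> W \<Sigma> \<W> \<U> \<longleftrightarrow> expandable p \<Sigma> \<W> \<U> \<and>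
     (\<exists>f. graph_iso \<Gamma> (expanded_graph p \<Sigma> \<W> \<U>) f \<and>
        (\<forall>w\<in>W. f w = Inl {w}) \<and> (\<forall>B\<in>\<U>. f ` B = Inr ` ({B} \<times> {0..<p})))"

end

theory Submission
  imports Defs
begin

text \<open>Call two vertices twins if they have the same neighborhood. An element of \<open>A\<close> fixing \<open>W\<close>
  pointwise moves vertices only within their twin classes in \<open>U\<close>, so the kernel is the full product
  of the symmetric groups on these classes. By transitivity all twin classes in \<open>U\<close> have a common
  size \<open>p\<^sup>a\<close> with \<open>a \<ge> 1\<close>, those in \<open>W\<close> a common size \<open>p\<^sup>b\<close>. The point is to show \<open>a = 1\<close> and \<open>b = 0\<close>.

  If not, the reduced graph on the twin classes has both parts of size at most \<open>p\<^sup>2\<close>, or one of size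
  at most \<open>p\<close>. A Sylow \<open>p\<close>-subgroup \<open>P\<close> of the group induced on it is transitive and, the
  reduced graph having no twins, faithful on each part. If the center of \<open>P\<close> is transitive on one
  of the parts then \<open>P\<close> is abelian; otherwise the center together with any \<open>t\<close> that moves both
  center orbits through two chosen base points generates an abelian transitive group, and such a \<open>t\<close>
  exists because \<open>P\<close> is not the union of two proper subgroups. An abelian group
  that is regular on both parts yields a part-swapping duality by inversion, which lifts to an
  automorphism of the whole graph exchanging \<open>W\<close> and \<open>U\<close>, a contradiction. The same argument on a
  connected component of a disconnected graph would give parts of sizes \<open>p\<^sup>c\<close> and \<open>p\<^sup>c\<close>\<open>/p\<close> in
  bijection, so the graph is connected.\<close>

section \<open>Transitive actions of \<open>p\<close>-groups\<close>

text \<open>The bounds on the parts rest on one estimate. In a nontrivial \<open>p\<close>-group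
  acting faithfully and transitively, a nontrivial central element fixes no point, so a center orbit
  has at least \<open>p\<close> points, and a subgroup orbit strictly containing it has at least
  \<open>p ^ 2\<close>. In a part with at most \<open>p ^ 2\<close> points this is everything; in a
  part with at most \<open>p\<close> points the center orbit already is. What escapes is exactly
  \<open>a = 1\<close>, \<open>b = 0\<close>, where the reduced parts have \<open>p ^ 3\<close> and
  \<open>p ^ 2\<close> points.

  The duality lives on twin classes. It lifts to vertices because a bijection between the classes of
  the two parts, together with \<open>card W = card U\<close>, makes all classes equally large; the
  lift then contradicts that \<open>A\<close> acts on \<open>W\<close>.

  The reduced graph is encoded as a hypergraph whose points are the classes in \<open>W\<close> and
  whose edges are sets of points. Absence of twins among the edges is then set extensionality, and
  among the points it is the separation hypothesis \<open>sep\<close>.\<close>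

definition centralizer :: "('a, 'b) monoid_scheme \<Rightarrow> 'a set \<Rightarrow> 'a set" where
  "centralizer G S = {g \<in> carrier G. \<forall>s\<in>S. g \<otimes>\<^bsub>G\<^esub> s = s \<otimes>\<^bsub>G\<^esub> g}"

text \<open>Stated for an arbitrary set so that it covers the center, the centralizer of one element
  \<open>t\<close> and the double centralizer of \<open>t\<close>, all of which occur in
  \<open>abelian_transitive_subgroup\<close>.\<close>

lemma (in group) subgroup_centralizer:
  assumes "S \<subseteq> carrier G"
  shows "subgroup (centralizer G S) G"
proof (rule subgroupI)
  show "centralizer G S \<subseteq> carrier G" by (auto simp: centralizer_def)
  have "\<one> \<in> centralizer G S" using assms by (auto simp: centralizer_def)
  then show "centralizer G S \<noteq> {}" by blast
next
  fix g assume g: "g \<in> centralizer G S"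
  have "inv g \<otimes> s = s \<otimes> inv g" if s: "s \<in> S" for s
  proof -
    have c: "g \<in> carrier G" "s \<in> carrier G" and e: "g \<otimes> s = s \<otimes> g"
      using g s assms by (auto simp: centralizer_def)
    have "inv g \<otimes> s = inv g \<otimes> (s \<otimes> g) \<otimes> inv g"
      using c by (simp add: m_assoc)
    also have "\<dots> = s \<otimes> inv g"
      using c by (simp add: e[symmetric] m_assoc[symmetric])
    finally show ?thesis .
  qed
  then show "inv g \<in> centralizer G S"
    using g by (auto simp: centralizer_def)
next
  fix g h assume gh: "g \<in> centralizer G S" "h \<in> centralizer G S"
  have "g \<otimes> h \<otimes> s = s \<otimes> (g \<otimes> h)" if s: "s \<in> S" for s
  proof -
    have c: "g \<in> carrier G" "h \<in> carrier G" "s \<in> carrier G"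
      and e: "g \<otimes> s = s \<otimes> g" "h \<otimes> s = s \<otimes> h"
      using gh s assms by (auto simp: centralizer_def)
    have "g \<otimes> h \<otimes> s = g \<otimes> (s \<otimes> h)"
      using c e by (simp add: m_assoc)
    also have "\<dots> = s \<otimes> g \<otimes> h"
      using c by (simp add: e(1)[symmetric] m_assoc)
    also have "\<dots> = s \<otimes> (g \<otimes> h)"
      using c by (simp add: m_assoc)
    finally show ?thesis .
  qed
  then show "g \<otimes> h \<in> centralizer G S"
    using gh by (auto simp: centralizer_def)
qed

text \<open>If \<open>G\<close> were the union, an element \<open>a\<close> outside \<open>H\<close>
  would lie in \<open>K\<close> and an element \<open>b\<close> outside \<open>K\<close> would lie
  in \<open>H\<close>; then \<open>a \<otimes> b\<close> belongs to neither. Later \<open>H\<close>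
  and \<open>K\<close> are the stabilizers of two blocks, and one element moving both is
  needed.\<close>

lemma (in group) two_proper_subgroups_cover:
  assumes "subgroup H G" "subgroup K G" "H \<noteq> carrier G" "K \<noteq> carrier G"
  shows "\<exists>g\<in>carrier G. g \<notin> H \<and> g \<notin> K"
proof (rule ccontr)
  assume "\<not> ?thesis"
  then have cov: "\<And>g. g \<in> carrier G \<Longrightarrow> g \<in> H \<or> g \<in> K" by blast
  interpret H: subgroup H G by fact
  interpret K: subgroup K G by fact
  obtain a b where ab: "a \<in> carrier G" "a \<notin> H" "b \<in> carrier G" "b \<notin> K"
    using assms(3,4) H.subset K.subset by blast
  then have k: "a \<in> K" "b \<in> H" using cov by auto
  show False
  proof (cases "a \<otimes> b \<in> H")
    case True
    then have "a \<otimes> b \<otimes> inv b \<in> H" using k by blast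
    then show False using ab by (simp add: m_assoc)
  next
    case False
    then have "inv a \<otimes> (a \<otimes> b) \<in> K" using cov ab k by blast
    then show False using ab by (simp add: m_assoc[symmetric])
  qed
qed

lemma (in group_action) one_act [simp]: "x \<in> E \<Longrightarrow> \<phi> \<one> x = x"
  using id_eq_one by (metis restrict_apply')

lemma (in group_action) card_orbit_prime_power:
  assumes "Factorial_Ring.prime p" "order G = p ^ a" "x \<in> E"
  obtains k where "card (orbit G \<phi> x) = p ^ k"
proof -
  have "card (orbit G \<phi> x) dvd p ^ a"
    using orbit_stabilizer_theorem[OF assms(3)] assms(2) by (metis dvd_triv_left)
  then show ?thesis
    using that divides_primepow_nat[OF assms(1)] by blast
qed

text \<open>Class equation: conjugacy classes have \<open>p\<close>-power size, and a class of size
  1 consists of a central element. With trivial center every class except \<open>{\<one>}\<close>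
  has size divisible by \<open>p\<close>, so the order would be 1 modulo \<open>p\<close>.\<close>

lemma (in group) p_group_center_nontrivial:
  assumes p: "Factorial_Ring.prime p" and o: "order G = p ^ a" and a: "a \<noteq> 0"
  shows "\<exists>z\<in>centralizer G (carrier G). z \<noteq> \<one>"
proof (rule ccontr)
  assume no: "\<not> ?thesis"
  define \<phi> where "\<phi> = (\<lambda>g. (\<lambda>h \<in> carrier G. g \<otimes> h \<otimes> (inv g)))"
  interpret conj: group_action G "carrier G" \<phi>
    using action_by_conjugation unfolding \<phi>_def .
  let ?O = "orbits G (carrier G) \<phi>"
  have fin: "finite (carrier G)"
    using o p by (metis order_gt_0_iff_finite prime_gt_0_nat zero_less_power)
  have one: "orbit G \<phi> \<one> = {\<one>}"
    using conj.orbit_refl[of \<one>] by (auto simp: orbit_def \<phi>_def)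
  have finO: "finite ?O" using fin by (auto simp: orbits_def)
  have div: "p dvd card B" if B: "B \<in> ?O - {{\<one>}}" for B
  proof -
    obtain x where x: "x \<in> carrier G" "B = orbit G \<phi> x"
      using B by (auto simp: orbits_def)
    have xB: "x \<in> B" using x conj.orbit_refl by simp
    obtain k where k: "card B = p ^ k"
      using conj.card_orbit_prime_power[OF p o x(1)] x by metis
    have "k \<noteq> 0"
    proof
      assume "k = 0"
      then obtain y where "B = {y}" using k card_1_singletonE by auto
      then have B': "B = {x}" using xB by simp
      have "x \<otimes> g = g \<otimes> x" if g: "g \<in> carrier G" for g
      proof -
        have "\<phi> g x \<in> B" using x g by (auto simp: orbit_def)
        then have "g \<otimes> x \<otimes> inv g = x" using B' x by (simp add: \<phi>_def)
        then show ?thesis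
          using g x(1) by (metis inv_solve_right m_closed)
      qed
      then have "x \<in> centralizer G (carrier G)" using x by (simp add: centralizer_def)
      then have "x = \<one>" using no by blast
      then show False using B B' by simp
    qed
    then show ?thesis using k by simp
  qed
  have "{\<one>} \<in> ?O" using one by (auto simp: orbits_def)
  then have "(\<Sum>B\<in>?O. card B) = 1 + (\<Sum>B\<in>?O - {{\<one>}}. card B)"
    using finO by (subst sum.remove) auto
  moreover have "(\<Sum>B\<in>?O. card B) = card (carrier G)"
    using conj.disjoint_sum[OF fin, of "\<lambda>_. 1::nat"] by simp
  moreover have "p dvd (\<Sum>B\<in>?O - {{\<one>}}. card B)"
    using div by (rule dvd_sum)
  moreover have "p dvd card (carrier G)"
    using o a by (simp add: order_def)
  ultimately have "p dvd 1" by (metis dvd_add_left_iff)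
  then show False using p not_prime_unit by blast
qed

lemma (in transitive_action) orbit_eq: "x \<in> E \<Longrightarrow> orbit G \<phi> x = E"
  using unique_orbit element_image unfolding orbit_def by blast

lemma (in group_action) transitive_actionI:
  assumes "x \<in> E" "orbit G \<phi> x = E"
  shows "transitive_action G E \<phi>"
proof (unfold_locales)
  fix y z assume yz: "y \<in> E" "z \<in> E"
  then have "x \<in> orbit G \<phi> y" using orbit_sym assms by metis
  then have "z \<in> orbit G \<phi> y"
    using orbit_trans[of y x z] yz assms by blast
  then show "\<exists>g\<in>carrier G. \<phi> g y = z" by (auto simp: orbit_def)
qed

lemma (in group_action) orbit_subset: "x \<in> E \<Longrightarrow> orbit G \<phi> x \<subseteq> E"
  using element_image by (auto simp: orbit_def)

text \<open>Orbit-stabilizer for \<open>G\<close> and for \<open>P\<close> at the same point,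
  compared by \<open>p\<close>-parts: the cofactor \<open>m\<close> is prime to \<open>p\<close>, so
  the \<open>P\<close>-orbit must absorb the whole factor \<open>p ^ n\<close>.\<close>

lemma (in transitive_action) sylow_transitive:
  assumes p: "Factorial_Ring.prime p" and o: "order G = p ^ a * m" and m: "\<not> p dvd m"
    and P: "subgroup P G" "card P = p ^ a" and E: "card E = p ^ n"
  shows "transitive_action (G\<lparr>carrier := P\<rparr>) E \<phi>"
proof -
  interpret P: group_action "G\<lparr>carrier := P\<rparr>" E \<phi>
    by (rule induced_action[OF P(1)])
  have p0: "p > 0" using p by (simp add: prime_gt_0_nat)
  have finE: "finite E" using E p0 by (metis card.infinite less_numeral_extra(3) zero_less_power)
  obtain x where x: "x \<in> E" using E p0
    by (metis all_not_in_conv card.empty less_numeral_extra(3) zero_less_power)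
  let ?S = "stabilizer G \<phi> x" and ?T = "stabilizer (G\<lparr>carrier := P\<rparr>) \<phi> x"
  have GS: "p ^ n * card ?S = p ^ a * m"
    using orbit_stabilizer_theorem[OF x] orbit_eq[OF x] E o by simp
  have oP: "order (G\<lparr>carrier := P\<rparr>) = p ^ a" using P by (simp add: order_def)
  have PT: "card (orbit (G\<lparr>carrier := P\<rparr>) \<phi> x) * card ?T = p ^ a"
    using P.orbit_stabilizer_theorem[OF x] oP by simp
  interpret G: group G using group_hom group_hom.axioms(1) by auto
  have "subgroup ?T (G\<lparr>carrier := P\<rparr>)" by (rule P.stabilizer_subgroup[OF x])
  then have "subgroup ?T G"
    using G.incl_subgroup P(1) by blast
  moreover have TS: "?T \<subseteq> ?S"
    using subgroup.subset[OF P(1)] by (auto simp: stabilizer_def)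
  ultimately have "subgroup ?T (G\<lparr>carrier := ?S\<rparr>)"
    using G.subgroup_incl stabilizer_subgroup[OF x] by blast
  moreover have "group (G\<lparr>carrier := ?S\<rparr>)"
    using G.subgroup_imp_group stabilizer_subgroup[OF x] by blast
  ultimately have "card ?T dvd card ?S"
    using group.lagrange[of "G\<lparr>carrier := ?S\<rparr>" ?T]
    by (simp add: order_def) (metis dvd_triv_right)
  moreover obtain k where k: "card (orbit (G\<lparr>carrier := P\<rparr>) \<phi> x) = p ^ k"
    using P.card_orbit_prime_power[OF p oP x] by metis
  \<comment> \<open>\<open>c\<close> is the index of \<open>?T\<close> in \<open>?S\<close>.
    Cancelling \<open>card ?T\<close> from the two orbit equations leaves
    \<open>p ^ n * c = p ^ k * m\<close>.\<close>
  ultimately obtain c where c: "card ?S = card ?T * c" by blast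
  have "p ^ n * (card ?T * c) = p ^ k * card ?T * m"
    using GS PT k c by simp
  moreover have "card ?T \<noteq> 0" using PT p0 by (metis mult_0_right less_numeral_extra(3) zero_less_power)
  ultimately have eq: "p ^ n * c = p ^ k * m" by simp
  have "n \<le> k"
  proof (rule ccontr)
    assume "\<not> n \<le> k"
    then have "p ^ n = p ^ k * p ^ (n - k)" by (simp add: power_add[symmetric])
    then have "p ^ (n - k) * c = m" using eq p0 by simp
    moreover have "p dvd p ^ (n - k)" using \<open>\<not> n \<le> k\<close> by simp
    ultimately show False using m by (metis dvd_mult2)
  qed
  then have "card E \<le> card (orbit (G\<lparr>carrier := P\<rparr>) \<phi> x)"
    using E k p0 by (simp add: power_increasing)
  then have "orbit (G\<lparr>carrier := P\<rparr>) \<phi> x = E"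
    using card_seteq[OF finE P.orbit_subset[OF x]] by blast
  then show ?thesis by (rule P.transitive_actionI[OF x])
qed

section \<open>Faithful transitive actions and orbits of the center\<close>

locale faithful_transitive_action = faithful_action + transitive_action
begin

sublocale G: group G
  using group_hom group_hom.axioms(1) by auto

lemma eq_oneI:
  assumes "g \<in> carrier G" "\<And>x. x \<in> E \<Longrightarrow> \<phi> g x = x"
  shows "g = \<one>"
proof (rule inj_onD[OF faithful])
  show "\<phi> g = \<phi> \<one>"
  proof (rule extensionalityI[of _ E])
    show "\<phi> g \<in> extensional E" "\<phi> \<one> \<in> extensional E"
      using bij_prop0 assms(1) by (auto simp: Bij_def)
  qed (use assms in auto)
qed (use assms in auto)

text \<open>Every point has the form \<open>\<phi> s x\<close>, and \<open>g\<close> fixes it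
  because \<open>g\<close> passes through \<open>s\<close> and fixes \<open>x\<close>. The set
  \<open>S\<close> only has to reach every point from \<open>x\<close>; it is taken to be the whole
  group in one use and the center in another.\<close>

lemma commuting_semiregular:
  assumes S: "S \<subseteq> carrier G" "\<And>y. y \<in> E \<Longrightarrow> \<exists>s\<in>S. \<phi> s x = y"
    and g: "g \<in> carrier G" "\<And>s. s \<in> S \<Longrightarrow> g \<otimes> s = s \<otimes> g"
    and x: "x \<in> E" "\<phi> g x = x"
  shows "g = \<one>"
proof (rule eq_oneI[OF g(1)])
  fix y assume "y \<in> E"
  then obtain s where s: "s \<in> S" "\<phi> s x = y" using S by blast
  have "\<phi> g y = \<phi> (g \<otimes> s) x" using s S x g by (subst composition_rule) auto
  also have "\<dots> = \<phi> (s \<otimes> g) x" using g s by simp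
  also have "\<dots> = \<phi> s (\<phi> g x)" using s S x g by (intro composition_rule) auto
  finally show "\<phi> g y = y" using x s by simp
qed

abbreviation "Z \<equiv> centralizer G (carrier G)"

lemma center_semiregular:
  assumes "z \<in> Z" "x \<in> E" "\<phi> z x = x"
  shows "z = \<one>"
  by (rule commuting_semiregular[of "carrier G" x])
    (use assms unique_orbit in \<open>auto simp: centralizer_def\<close>)

text \<open>Given \<open>g\<close>, some central \<open>z\<close> agrees with it at
  \<open>x\<close>. Then \<open>inv z \<otimes> g\<close> fixes \<open>x\<close> and commutes with
  the transitive set \<open>Z\<close>, so it is trivial and \<open>g = z\<close>.\<close>

lemma abelian_if_center_transitive:
  assumes x: "x \<in> E" and tr: "orbit (G\<lparr>carrier := Z\<rparr>) \<phi> x = E"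
  shows "carrier G \<subseteq> Z"
proof
  fix g assume g: "g \<in> carrier G"
  have Z: "subgroup Z G" by (rule G.subgroup_centralizer) simp
  have Zc: "Z \<subseteq> carrier G" by (rule subgroup.subset[OF Z])
  have "\<phi> g x \<in> E" using element_image g x by blast
  then obtain z where z: "z \<in> Z" "\<phi> z x = \<phi> g x"
    using tr by (auto simp: orbit_def)
  have zc: "z \<in> carrier G" using z Zc by blast
  have "inv z \<otimes> g = \<one>"
  proof (rule commuting_semiregular[of Z x])
    show "\<exists>s\<in>Z. \<phi> s x = y" if "y \<in> E" for y
      using that tr by (auto simp: orbit_def)
    show "\<phi> (inv z \<otimes> g) x = x"
      using g x z zc composition_rule[of x "inv z" g] orbit_sym_aux[of z x "\<phi> g x"] by simp
    show "inv z \<otimes> g \<otimes> s = s \<otimes> (inv z \<otimes> g)" if "s \<in> Z" for s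
      using that g zc by (auto simp: centralizer_def)
  qed (use g zc Zc x in auto)
  then have "g = z"
    using g zc by (metis G.inv_equality G.inv_inv G.inv_closed)
  then show "g \<in> Z" using z by simp
qed

text \<open>A nontrivial \<open>p\<close>-group has a nontrivial central element, which by
  semiregularity moves \<open>x\<close>. So the orbit is not a single point, and
  \<open>k \<noteq> 0\<close> says that it has at least \<open>p\<close> elements.\<close>

lemma center_orbit_card:
  assumes p: "Factorial_Ring.prime p" and o: "order G = p ^ a" "a \<noteq> 0" and x: "x \<in> E"
  obtains k where "k \<noteq> 0" "card (orbit (G\<lparr>carrier := Z\<rparr>) \<phi> x) = p ^ k"
proof -
  have Z: "subgroup Z G" by (rule G.subgroup_centralizer) simp
  interpret Z: group_action "G\<lparr>carrier := Z\<rparr>" E \<phi> by (rule induced_action[OF Z])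
  have "card Z dvd p ^ a"
    using G.lagrange[OF Z] o(1) by (metis dvd_triv_right)
  then obtain b where "order (G\<lparr>carrier := Z\<rparr>) = p ^ b"
    using divides_primepow_nat[OF p] by (auto simp: order_def)
  then obtain k where k: "card (orbit (G\<lparr>carrier := Z\<rparr>) \<phi> x) = p ^ k"
    using Z.card_orbit_prime_power[OF p _ x] by metis
  obtain z where z: "z \<in> Z" "z \<noteq> \<one>"
    using G.p_group_center_nontrivial[OF p o] by blast
  have "k \<noteq> 0"
  proof
    assume "k = 0"
    then obtain y where "orbit (G\<lparr>carrier := Z\<rparr>) \<phi> x = {y}" using k card_1_singletonE by auto
    moreover have "x \<in> orbit (G\<lparr>carrier := Z\<rparr>) \<phi> x" using Z.orbit_refl x by blast
    moreover have "\<phi> z x \<in> orbit (G\<lparr>carrier := Z\<rparr>) \<phi> x" using z by (auto simp: orbit_def)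
    ultimately have "\<phi> z x = x" by simp
    then show False using center_semiregular z x by blast
  qed
  then show ?thesis using k that by blast
qed

text \<open>Orbits of a normal subgroup are blocks of imprimitivity, and \<open>M\<close> is the
  setwise stabilizer of the block containing \<open>x\<close>. It is proper because \<open>G\<close>
  is transitive while the block is not all of \<open>E\<close>.\<close>

lemma center_block_subgroup:
  assumes x: "x \<in> E" and nt: "orbit (G\<lparr>carrier := Z\<rparr>) \<phi> x \<noteq> E"
  defines "M \<equiv> {g \<in> carrier G. \<phi> g x \<in> orbit (G\<lparr>carrier := Z\<rparr>) \<phi> x}"
  shows "subgroup M G" "M \<noteq> carrier G"
proof -
  have Z: "subgroup Z G" by (rule G.subgroup_centralizer) simp
  interpret Z: group_action "G\<lparr>carrier := Z\<rparr>" E \<phi> by (rule induced_action[OF Z])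
  have Zc: "\<And>z. z \<in> Z \<Longrightarrow> z \<in> carrier G" using subgroup.subset[OF Z] by blast
  have M: "g \<in> M \<longleftrightarrow> g \<in> carrier G \<and> (\<exists>z\<in>Z. \<phi> g x = \<phi> z x)" for g
    by (auto simp: M_def orbit_def)
  show "subgroup M G"
  proof (rule G.subgroupI)
    show "M \<subseteq> carrier G" by (auto simp: M_def)
    have "\<one> \<in> Z" by (rule subgroup.one_closed[OF Z])
    then have "\<one> \<in> M" using M by blast
    then show "M \<noteq> {}" by blast
  next
    fix g assume "g \<in> M"
    then obtain z where g: "g \<in> carrier G" and z: "z \<in> Z" "\<phi> g x = \<phi> z x" using M by blast
    \<comment> \<open>If \<open>g\<close> acts on \<open>x\<close> like the central
      \<open>z\<close>, its inverse acts on \<open>x\<close> like \<open>inv z\<close>: by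
      commutation \<open>g\<close> takes \<open>\<phi> (inv z) x\<close> to
      \<open>x\<close>.\<close>
    have "\<phi> (inv z) x = \<phi> (inv g) x"
    proof -
      have "\<phi> g (\<phi> (inv z) x) = \<phi> (g \<otimes> inv z) x"
        using g z Zc x by (subst composition_rule) auto
      also have "g \<otimes> inv z = inv z \<otimes> g"
        using subgroup.m_inv_closed[OF Z z(1)] g by (auto simp: centralizer_def)
      also have "\<phi> (inv z \<otimes> g) x = \<phi> (inv z) (\<phi> z x)"
        using g z Zc x by (subst composition_rule) auto
      also have "\<dots> = x" using orbit_sym_aux z Zc x by blast
      finally have "\<phi> g (\<phi> (inv z) x) = x" .
      moreover have "\<phi> (inv z) x \<in> E" using element_image z Zc x by blast
      ultimately show ?thesis using orbit_sym_aux[OF g, of "\<phi> (inv z) x" x] by simp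
    qed
    then have "\<phi> (inv g) x = \<phi> (inv z) x" by simp
    then show "inv g \<in> M" using M g subgroup.m_inv_closed[OF Z z(1)] by blast
  next
    fix g h assume "g \<in> M" "h \<in> M"
    then obtain z y where g: "g \<in> carrier G" "h \<in> carrier G"
      and z: "z \<in> Z" "\<phi> g x = \<phi> z x" "y \<in> Z" "\<phi> h x = \<phi> y x" using M by blast
    have "\<phi> (g \<otimes> h) x = \<phi> (g \<otimes> y) x"
      using g z Zc x by (simp add: composition_rule)
    also have "g \<otimes> y = y \<otimes> g" using z g by (auto simp: centralizer_def)
    also have "\<phi> (y \<otimes> g) x = \<phi> (y \<otimes> z) x"
      using g z Zc x by (simp add: composition_rule)
    finally show "g \<otimes> h \<in> M" using M g z subgroup.m_closed[OF Z] by blast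
  qed
  show "M \<noteq> carrier G"
  proof
    assume "M = carrier G"
    then have "E \<subseteq> orbit (G\<lparr>carrier := Z\<rparr>) \<phi> x"
      using unique_orbit[OF x] by (force simp: M_def)
    then show False using nt Z.orbit_subset[OF x] by blast
  qed
qed

text \<open>The source of the bound \<open>m \<le> 2\<close>: the \<open>H\<close>-orbit of
  \<open>x\<close> contains the center orbit, which has at least \<open>p\<close> points, and also
  the point \<open>\<phi> t x\<close> outside it. An orbit of \<open>p\<close>-power size larger
  than \<open>p\<close> has at least \<open>p ^ 2\<close> points.\<close>

lemma transitive_if_leaves_center_block:
  assumes p: "Factorial_Ring.prime p" and o: "order G = p ^ a" "a \<noteq> 0" and x: "x \<in> E"
    and E: "card E = p ^ m" "m \<le> 2"
    and H: "subgroup H G" "Z \<subseteq> H" "t \<in> H" "\<phi> t x \<notin> orbit (G\<lparr>carrier := Z\<rparr>) \<phi> x"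
  shows "transitive_action (G\<lparr>carrier := H\<rparr>) E \<phi>"
proof -
  interpret H: group_action "G\<lparr>carrier := H\<rparr>" E \<phi> by (rule induced_action[OF H(1)])
  let ?o = "orbit (G\<lparr>carrier := H\<rparr>) \<phi> x" and ?z = "orbit (G\<lparr>carrier := Z\<rparr>) \<phi> x"
  have p1: "p > 1" using p by (rule prime_gt_1_nat)
  have finE: "finite E" using E p1 by (metis card.infinite not_one_less_zero power_not_zero)
  have fo: "finite ?o" using H.orbit_subset[OF x] finE finite_subset by blast
  obtain k where k: "k \<noteq> 0" "card ?z = p ^ k" using center_orbit_card[OF p o x] by metis
  have "card H dvd p ^ a"
    using G.lagrange[OF H(1)] o(1) by (metis dvd_triv_right)
  then obtain b where "order (G\<lparr>carrier := H\<rparr>) = p ^ b"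
    using divides_primepow_nat[OF p] by (auto simp: order_def)
  then obtain l where l: "card ?o = p ^ l"
    using H.card_orbit_prime_power[OF p _ x] by metis
  have "?z \<subset> ?o" using H by (auto simp: orbit_def)
  then have "p ^ k < p ^ l" using psubset_card_mono[OF fo] k(2) l by metis
  then have "k < l" using p1 by simp
  then have "m \<le> l" using k E by linarith
  then have "card E \<le> card ?o" using l E p1 by (simp add: power_increasing)
  then have "?o = E" using card_seteq[OF finE H.orbit_subset[OF x]] by blast
  then show ?thesis by (rule H.transitive_actionI[OF x])
qed

end

lemma card_prime_power_pos:
  assumes "Factorial_Ring.prime p" "card E = p ^ n"
  shows "finite E" "E \<noteq> {}"
proof -
  have "card E > 0" using assms by (simp add: prime_gt_0_nat)
  then show "finite E" "E \<noteq> {}" by (auto simp: card_gt_0_iff)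
qed

text \<open>For abelian \<open>P\<close> all of \<open>P\<close> will do. Otherwise the center is
  transitive on neither set, which excludes \<open>n \<le> 1\<close> and leaves at most
  \<open>p ^ 2\<close> points on both sides. One and the same \<open>t\<close> must leave the center
  orbits in \<open>S\<close> and in \<open>T\<close>, since a single \<open>H\<close> has to be
  transitive on both.\<close>

lemma abelian_transitive_subgroup:
  fixes P (structure)
  assumes X: "faithful_transitive_action P S \<phi>" and Y: "faithful_transitive_action P T \<psi>"
    and p: "Factorial_Ring.prime p" and o: "order P = p ^ a"
    and cX: "card S = p ^ m" and cY: "card T = p ^ n"
    and mn: "m \<le> 2 \<and> n \<le> 2 \<or> n \<le> 1"
  obtains H where "subgroup H P" "\<And>g h. g \<in> H \<Longrightarrow> h \<in> H \<Longrightarrow> g \<otimes> h = h \<otimes> g"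
    "transitive_action (P\<lparr>carrier := H\<rparr>) S \<phi>" "transitive_action (P\<lparr>carrier := H\<rparr>) T \<psi>"
proof -
  interpret X: faithful_transitive_action P S \<phi> by (rule X)
  interpret Y: faithful_transitive_action P T \<psi> by (rule Y)
  let ?Z = "centralizer P (carrier P)"
  have finX: "finite S" and finY: "finite T"
    using card_prime_power_pos[OF p] cX cY by auto
  obtain x y where x: "x \<in> S" and y: "y \<in> T"
    using card_prime_power_pos[OF p cX] card_prime_power_pos[OF p cY] by blast
  have p1: "p > 1" using p by (rule prime_gt_1_nat)
  show ?thesis
  proof (cases "carrier P \<subseteq> ?Z")
    case True
    show ?thesis
    proof (rule that)
      show "subgroup (carrier P) P" by (rule X.G.subgroup_self)
      show "g \<otimes> h = h \<otimes> g" if "g \<in> carrier P" "h \<in> carrier P" for g h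
        using True that by (auto simp: centralizer_def)
    qed (simp_all add: X.transitive_action_axioms Y.transitive_action_axioms)
  next
    case False
    have a: "a \<noteq> 0"
    proof
      assume "a = 0"
      then obtain e where "carrier P = {e}" using o card_1_singletonE by (auto simp: order_def)
      then show False using False by (auto simp: centralizer_def)
    qed
    have nX: "orbit (P\<lparr>carrier := ?Z\<rparr>) \<phi> x \<noteq> S"
      using X.abelian_if_center_transitive[OF x] False by blast
    have nY: "orbit (P\<lparr>carrier := ?Z\<rparr>) \<psi> y \<noteq> T"
      using Y.abelian_if_center_transitive[OF y] False by blast
    have Z: "subgroup ?Z P" by (rule X.G.subgroup_centralizer) simp
    \<comment> \<open>A center orbit on \<open>T\<close> has at least \<open>p\<close> points, so
      for \<open>n \<le> 1\<close> it would be all of \<open>T\<close>.\<close>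
    have "\<not> n \<le> 1"
    proof
      assume n: "n \<le> 1"
      obtain k where k: "k \<noteq> 0" "card (orbit (P\<lparr>carrier := ?Z\<rparr>) \<psi> y) = p ^ k"
        using Y.center_orbit_card[OF p o a y] by metis
      have "card T \<le> card (orbit (P\<lparr>carrier := ?Z\<rparr>) \<psi> y)"
        using k n cY p1 by (simp add: power_increasing)
      then show False
        using card_seteq[OF finY] group_action.orbit_subset[OF Y.induced_action[OF Z] y] nY by blast
    qed
    then have m2: "m \<le> 2" and n2: "n \<le> 2" using mn by auto
    obtain t where t: "t \<in> carrier P" "\<phi> t x \<notin> orbit (P\<lparr>carrier := ?Z\<rparr>) \<phi> x"
      "\<psi> t y \<notin> orbit (P\<lparr>carrier := ?Z\<rparr>) \<psi> y"
      using X.G.two_proper_subgroups_cover[OF X.center_block_subgroup(1)[OF x nX]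
        Y.center_block_subgroup(1)[OF y nY] X.center_block_subgroup(2)[OF x nX]
        Y.center_block_subgroup(2)[OF y nY]] by blast
    \<comment> \<open>The double centralizer of \<open>t\<close> is abelian and contains \<open>t\<close> and the center.\<close>
    define C where "C = centralizer P {t}"
    define H where "H = centralizer P C"
    have CP: "C \<subseteq> carrier P" by (auto simp: C_def centralizer_def)
    have H: "subgroup H P" unfolding H_def by (rule X.G.subgroup_centralizer[OF CP])
    have tH: "t \<in> H" using t by (auto simp: H_def C_def centralizer_def)
    have ZH: "?Z \<subseteq> H" using CP by (auto simp: H_def centralizer_def)
    \<comment> \<open>As \<open>t\<close> itself lies in \<open>C\<close>, whatever commutes with
      all of \<open>C\<close> commutes with \<open>t\<close>. So \<open>H\<close> sits inside the
      set that it centralizes, and any two of its elements commute.\<close>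
    have tC: "t \<in> C" using t by (auto simp: C_def centralizer_def)
    have HC: "H \<subseteq> C" using tC by (auto simp: H_def C_def centralizer_def)
    show ?thesis
    proof (rule that[OF H])
      show "g \<otimes> h = h \<otimes> g" if "g \<in> H" "h \<in> H" for g h
        using that HC by (auto simp: H_def centralizer_def)
      show "transitive_action (P\<lparr>carrier := H\<rparr>) S \<phi>"
        by (rule X.transitive_if_leaves_center_block[OF p o a x cX m2 H ZH tH t(2)])
      show "transitive_action (P\<lparr>carrier := H\<rparr>) T \<psi>"
        by (rule Y.transitive_if_leaves_center_block[OF p o a y cY n2 H ZH tH t(3)])
    qed
  qed
qed

section \<open>Self-dual hypergraphs\<close>

lemma carrier_BijGroup [simp]: "carrier (BijGroup S) = Bij S"
  by (simp add: BijGroup_def)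

lemma mult_BijGroup: "f \<in> Bij S \<Longrightarrow> g \<in> Bij S \<Longrightarrow> f \<otimes>\<^bsub>BijGroup S\<^esub> g = compose S f g"
  by (simp add: BijGroup_def)

text \<open>Fix a base point \<open>x0\<close> and a base edge \<open>B0\<close>. Then \<open>\<sigma> x = h ` B0\<close> for the \<open>h\<close> with \<open>h x = x0\<close>, and
  \<open>\<tau> B = h x0\<close> for the \<open>h\<close> with \<open>h ` B = B0\<close>; commutativity makes this an isomorphism onto the dual.\<close>

lemma hypergraph_self_dual:
  fixes S :: "'b set" and F :: "'b set set" and H :: "('b \<Rightarrow> 'b) set"
  assumes F: "F \<subseteq> Pow S" and ne: "S \<noteq> {}" "F \<noteq> {}"
    and bij: "\<And>h. h \<in> H \<Longrightarrow> bij_betw h S S"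
    and inv: "\<And>h. h \<in> H \<Longrightarrow> (\<lambda>B. h ` B) ` F = F"
    and comm: "\<And>g h x. g \<in> H \<Longrightarrow> h \<in> H \<Longrightarrow> x \<in> S \<Longrightarrow> g (h x) = h (g x)"
    and tS: "\<And>x y. x \<in> S \<Longrightarrow> y \<in> S \<Longrightarrow> \<exists>h\<in>H. h x = y"
    and tF: "\<And>B C. B \<in> F \<Longrightarrow> C \<in> F \<Longrightarrow> \<exists>h\<in>H. h ` B = C"
    and sep: "\<And>x y. x \<in> S \<Longrightarrow> y \<in> S \<Longrightarrow> \<forall>B\<in>F. x \<in> B \<longleftrightarrow> y \<in> B \<Longrightarrow> x = y"
  obtains \<sigma> \<tau> where "bij_betw \<sigma> S F" "bij_betw \<tau> F S"
    "\<And>x B. x \<in> S \<Longrightarrow> B \<in> F \<Longrightarrow> x \<in> B \<longleftrightarrow> \<tau> B \<in> \<sigma> x"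
proof -
  obtain x0 B0 where x0: "x0 \<in> S" and B0: "B0 \<in> F" using ne by blast
  have mem: "h x \<in> S" if "h \<in> H" "x \<in> S" for h x
    using bij[OF that(1)] that(2) by (auto simp: bij_betw_def)
  have inj: "x = y" if "h \<in> H" "x \<in> S" "y \<in> S" "h x = h y" for h x y
    using bij[OF that(1)] that(2-4) by (auto simp: bij_betw_def inj_on_def)
  have sub: "B \<subseteq> S" if "B \<in> F" for B using F that by blast
  have memF: "h ` B \<in> F" if "h \<in> H" "B \<in> F" for h B using inv[OF that(1)] that(2) by blast
  have mem_im: "h x \<in> h ` B \<longleftrightarrow> x \<in> B" if "h \<in> H" "x \<in> S" "B \<in> F" for h x B
    using inj_on_image_mem_iff[OF bij_betw_imp_inj_on[OF bij[OF that(1)]] that(2)] that(3) F by blast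
  have commF: "g ` h ` B = h ` g ` B" if "g \<in> H" "h \<in> H" "B \<in> F" for g h B
    using comm[OF that(1,2)] sub[OF that(3)] by (force simp: image_image)
  \<comment> \<open>Semiregularity on points: with \<open>l\<close> taking \<open>y\<close> to
    \<open>x\<close>, commutation carries the equality from \<open>y\<close> to
    \<open>x\<close>.\<close>
  have eq1: "h x = k x" if hk: "h \<in> H" "k \<in> H" and y: "y \<in> S" "h y = k y" and x: "x \<in> S" for h k x y
  proof -
    obtain l where l: "l \<in> H" "l y = x" using tS y x by blast
    then show ?thesis using comm hk y by metis
  qed
  \<comment> \<open>The analogue for edges, ending in an equality of points: agreement on one edge
    spreads to all edges, after which \<open>h x\<close> and \<open>k x\<close> lie in the same
    edges and \<open>sep\<close> applies.\<close>
  have eq2: "h x = k x"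
    if hk: "h \<in> H" "k \<in> H" and B: "B \<in> F" "h ` B = k ` B" and x: "x \<in> S" for h k x B
  proof (rule sep)
    have eq: "h ` C = k ` C" if C: "C \<in> F" for C
    proof -
      obtain l where l: "l \<in> H" "l ` B = C" using tF B C by blast
      then show ?thesis using commF hk B by metis
    qed
    show "\<forall>C\<in>F. h x \<in> C \<longleftrightarrow> k x \<in> C"
    proof
      fix C assume "C \<in> F"
      then obtain D where D: "D \<in> F" "C = h ` D" using inv[OF hk(1)] by blast
      then have "h x \<in> C \<longleftrightarrow> x \<in> D" using mem_im hk x by blast
      moreover have "k x \<in> C \<longleftrightarrow> x \<in> D" using mem_im[OF hk(2) x D(1)] eq D by simp
      ultimately show "h x \<in> C \<longleftrightarrow> k x \<in> C" by simp
    qed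
  qed (use mem hk x in auto)
  have "\<forall>x\<in>S. \<exists>h\<in>H. h x = x0" using tS x0 by blast
  then obtain \<eta> where \<eta>: "\<And>x. x \<in> S \<Longrightarrow> \<eta> x \<in> H" "\<And>x. x \<in> S \<Longrightarrow> \<eta> x x = x0" by metis
  have "\<forall>B\<in>F. \<exists>h\<in>H. h ` B = B0" using tF B0 by blast
  then obtain \<kappa> where \<kappa>: "\<And>B. B \<in> F \<Longrightarrow> \<kappa> B \<in> H" "\<And>B. B \<in> F \<Longrightarrow> \<kappa> B ` B = B0" by metis
  define \<sigma> where "\<sigma> x = \<eta> x ` B0" for x
  define \<tau> where "\<tau> B = \<kappa> B x0" for B
  show ?thesis
  proof (rule that)
    show "bij_betw \<sigma> S F"
    proof (rule bij_betwI')
      fix x y assume xy: "x \<in> S" "y \<in> S"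
      show "\<sigma> x = \<sigma> y \<longleftrightarrow> x = y"
      proof
        assume "\<sigma> x = \<sigma> y"
        then have "\<eta> x x = \<eta> y x" using eq2[of "\<eta> x" "\<eta> y" B0 x] \<eta> B0 xy by (simp add: \<sigma>_def)
        then show "x = y" using \<eta> xy inj[of "\<eta> y" x y] by metis
      qed simp
    next
      fix x assume "x \<in> S"
      then show "\<sigma> x \<in> F" using memF \<eta> B0 by (simp add: \<sigma>_def)
    next
      fix B assume "B \<in> F"
      \<comment> \<open>The preimage of \<open>B\<close> under \<open>\<sigma>\<close> is the point
        that \<open>h\<close> sends to \<open>x0\<close>: there \<open>h\<close> agrees with
        \<open>\<eta> x\<close>, hence everywhere by \<open>eq1\<close>.\<close>
      then obtain h where h: "h \<in> H" "h ` B0 = B" using tF B0 by blast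
      then obtain x where x: "x \<in> S" "h x = x0" using bij[OF h(1)] x0 by (metis bij_betw_def imageE)
      have "\<eta> x y = h y" if "y \<in> S" for y
        using eq1[of "\<eta> x" h x y] \<eta> h x that by simp
      then have "\<sigma> x = B" using sub[OF B0] h(2) by (force simp: \<sigma>_def)
      then show "\<exists>x\<in>S. B = \<sigma> x" using x by blast
    qed
    show "bij_betw \<tau> F S"
    proof (rule bij_betwI')
      fix B C assume BC: "B \<in> F" "C \<in> F"
      show "\<tau> B = \<tau> C \<longleftrightarrow> B = C"
      proof
        assume "\<tau> B = \<tau> C"
        then have e: "\<kappa> B x = \<kappa> C x" if "x \<in> S" for x
          using eq1[of "\<kappa> B" "\<kappa> C" x0 x] \<kappa> x0 BC that by (simp add: \<tau>_def)
        have "\<kappa> C ` B = \<kappa> C ` C" using e \<kappa> BC sub[OF BC(1)] by (metis image_cong subsetD)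
        then show "B = C" using mem_im \<kappa>(1)[OF BC(2)] sub BC by blast
      qed simp
    next
      fix B assume "B \<in> F"
      then show "\<tau> B \<in> S" using mem \<kappa> x0 by (simp add: \<tau>_def)
    next
      fix x assume x: "x \<in> S"
      then obtain h where h: "h \<in> H" "h x0 = x" using tS x0 by blast
      obtain B where B: "B \<in> F" "h ` B = B0" using inv[OF h(1)] B0 by (metis imageE)
      have "\<kappa> B x0 = h x0" using eq2[of "\<kappa> B" h B x0] \<kappa> h B x0 by simp
      then show "\<exists>B\<in>F. x = \<tau> B" using B h by (auto simp: \<tau>_def)
    qed
    show "x \<in> B \<longleftrightarrow> \<tau> B \<in> \<sigma> x" if x: "x \<in> S" and B: "B \<in> F" for x B
    proof -
      \<comment> \<open>Apply \<open>\<eta> x\<close>, which turns \<open>x\<close> into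
        \<open>x0\<close>, and then \<open>\<kappa> B\<close>. As the two commute,
        \<open>\<kappa> B\<close> may act on \<open>B\<close> first and produce
        \<open>B0\<close>.\<close>
      have "x \<in> B \<longleftrightarrow> \<eta> x x \<in> \<eta> x ` B" using mem_im \<eta> x B by blast
      also have "\<dots> \<longleftrightarrow> \<kappa> B x0 \<in> \<kappa> B ` \<eta> x ` B"
        using mem_im[OF \<kappa>(1)[OF B] x0 memF[OF \<eta>(1)[OF x] B]] \<eta>(2)[OF x] by simp
      also have "\<kappa> B ` \<eta> x ` B = \<sigma> x" using commF[OF \<kappa>(1)[OF B] \<eta>(1)[OF x] B] \<kappa> B by (simp add: \<sigma>_def)
      finally show ?thesis by (simp add: \<tau>_def)
    qed
  qed
qed

text \<open>Replaces the commuting maps of \<open>hypergraph_self_dual\<close> by an arbitrary group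
  transitive on points and on edges. Both numbers are powers of \<open>p\<close>, so a Sylow
  \<open>p\<close>-subgroup is still transitive on both, and
  \<open>abelian_transitive_subgroup\<close> finds \<open>H\<close> inside it.\<close>

lemma prime_power_hypergraph_self_dual:
  fixes S :: "'b set" and F :: "'b set set" and G :: "('b \<Rightarrow> 'b) set"
  assumes p: "Factorial_Ring.prime p" and cS: "card S = p ^ m" and cF: "card F = p ^ n"
    and mn: "m \<le> 2 \<and> n \<le> 2 \<or> n \<le> 1"
    and G: "subgroup G (BijGroup S)"
    and F: "F \<subseteq> Pow S" and inv: "\<And>g B. g \<in> G \<Longrightarrow> B \<in> F \<Longrightarrow> g ` B \<in> F"
    and tS: "\<And>x y. x \<in> S \<Longrightarrow> y \<in> S \<Longrightarrow> \<exists>g\<in>G. g x = y"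
    and tF: "\<And>B C. B \<in> F \<Longrightarrow> C \<in> F \<Longrightarrow> \<exists>g\<in>G. g ` B = C"
    and sep: "\<And>x y. x \<in> S \<Longrightarrow> y \<in> S \<Longrightarrow> \<forall>B\<in>F. x \<in> B \<longleftrightarrow> y \<in> B \<Longrightarrow> x = y"
  obtains \<sigma> \<tau> where "bij_betw \<sigma> S F" "bij_betw \<tau> F S"
    "\<And>x B. x \<in> S \<Longrightarrow> B \<in> F \<Longrightarrow> x \<in> B \<longleftrightarrow> \<tau> B \<in> \<sigma> x"
proof -
  let ?B = "BijGroup S"
  let ?G = "?B\<lparr>carrier := G\<rparr>"
  let ?\<psi> = "\<lambda>g. \<lambda>B\<in>F. g ` B"
  have finS: "finite S" "S \<noteq> {}" and finF: "finite F" "F \<noteq> {}"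
    using card_prime_power_pos[OF p] cS cF by auto
  interpret B: group ?B by (rule group_BijGroup)
  have GB: "g \<in> Bij S" if "g \<in> G" for g
    using subgroup.subset[OF G] that by auto
  have bij: "bij_betw g S S" if "g \<in> G" for g using GB[OF that] by (simp add: Bij_def)
  have injF: "inj_on (\<lambda>B. g ` B) F" if g: "g \<in> G" for g
    using inj_on_image_Pow[OF bij_betw_imp_inj_on[OF bij[OF g]]] F inj_on_subset by blast
  have imF: "(\<lambda>B. g ` B) ` F = F" if g: "g \<in> G" for g
    using injF[OF g] inv[OF g] finF(1) by (intro endo_inj_surj) auto
  have \<psi>B: "?\<psi> g \<in> Bij F" if g: "g \<in> G" for g
    using imF[OF g] injF[OF g] by (simp add: Bij_def bij_betw_def)
  interpret G: group ?G by (rule B.subgroup_imp_group[OF G])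
  interpret S: transitive_action ?G S "\<lambda>g. g"
  proof unfold_locales
    show "(\<lambda>g. g) \<in> hom ?G ?B"
      using GB by (auto simp: hom_def)
  qed (use tS in auto)
  have comp: "g \<otimes>\<^bsub>?B\<^esub> h = compose S g h" if "g \<in> G" "h \<in> G" for g h
    using that GB by (simp add: mult_BijGroup)
  have comp_im: "(g \<otimes>\<^bsub>?B\<^esub> h) ` B = g ` h ` B" if "g \<in> G" "h \<in> G" "B \<in> F" for g h B
    using comp[OF that(1,2)] F that(3) by (force simp: compose_def image_iff)
  interpret BF: group "BijGroup F" by (rule group_BijGroup)
  interpret F: transitive_action ?G F ?\<psi>
  proof unfold_locales
    show "?\<psi> \<in> hom ?G (BijGroup F)"
    proof (rule homI)
      show "?\<psi> g \<in> carrier (BijGroup F)" if "g \<in> carrier ?G" for g using \<psi>B that by simp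
      show "?\<psi> (g \<otimes>\<^bsub>?G\<^esub> h) = ?\<psi> g \<otimes>\<^bsub>BijGroup F\<^esub> ?\<psi> h"
        if "g \<in> carrier ?G" "h \<in> carrier ?G" for g h
        using that \<psi>B comp_im inv by (auto simp: mult_BijGroup compose_def restrict_def fun_eq_iff)
    qed
    show "\<exists>g\<in>carrier ?G. ?\<psi> g B = C" if "B \<in> F" "C \<in> F" for B C
      using tF[OF that] that by auto
  qed
  \<comment> \<open>Faithfulness on edges. Every edge is an image under \<open>g\<close>, so if
    \<open>g\<close> and \<open>h\<close> agree on edges, then \<open>g x\<close> and
    \<open>h x\<close> lie in the same edges.\<close>
  have sepG: "g = h" if gh: "g \<in> G" "h \<in> G" and e: "\<And>B. B \<in> F \<Longrightarrow> g ` B = h ` B" for g h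
  proof (rule extensionalityI[of _ S])
    show "g x = h x" if x: "x \<in> S" for x
    proof (rule sep)
      have m: "k x \<in> k ` B \<longleftrightarrow> x \<in> B" if "k \<in> G" "B \<in> F" for k B
        using inj_on_image_mem_iff[OF bij_betw_imp_inj_on[OF bij[OF that(1)]] x] that(2) F by blast
      show "\<forall>B\<in>F. g x \<in> B \<longleftrightarrow> h x \<in> B"
      proof
        fix B assume "B \<in> F"
        then obtain C where C: "C \<in> F" "B = g ` C" using imF[OF gh(1)] by blast
        then show "g x \<in> B \<longleftrightarrow> h x \<in> B" using m gh e by metis
      qed
      show "g x \<in> S" "h x \<in> S" using bij gh x by (auto simp: bij_betw_def)
    qed
  qed (use GB gh in \<open>auto simp: Bij_def\<close>)
  have finG: "finite G"
  proof (rule finite_subset)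
    show "G \<subseteq> S \<rightarrow>\<^sub>E S" using GB by (force simp: Bij_def bij_betw_def PiE_def)
  qed (use finS in \<open>simp add: finite_PiE\<close>)
  have "G \<noteq> {}" using G.one_closed by auto
  then have c0: "card G \<noteq> 0" using finG by simp
  \<comment> \<open>The full power of \<open>p\<close> is split off, because
    \<open>sylow_transitive\<close> needs a cofactor prime to \<open>p\<close>.\<close>
  obtain a c where ac: "card G = p ^ a * c" "\<not> p dvd c"
  proof -
    have "\<not> is_unit p" using p not_prime_unit by blast
    then show ?thesis using multiplicity_decompose'[of "card G" p] c0 that by metis
  qed
  have oG: "order ?G = p ^ a * c" using ac by (simp add: order_def)
  obtain P where P: "subgroup P ?G" "card P = p ^ a"
    using sylow_thm[OF p G.is_group oG] finG by auto
  let ?P = "?G\<lparr>carrier := P\<rparr>"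
  have PG: "P \<subseteq> G" using subgroup.subset[OF P(1)] by simp
  interpret PS: transitive_action ?P S "\<lambda>g. g" by (rule S.sylow_transitive[OF p oG ac(2) P cS])
  interpret PF: transitive_action ?P F ?\<psi> by (rule F.sylow_transitive[OF p oG ac(2) P cF])
  have fS: "faithful_transitive_action ?P S (\<lambda>g. g)"
    by unfold_locales auto
  have fF: "faithful_transitive_action ?P F ?\<psi>"
  proof unfold_locales
    show "inj_on ?\<psi> (carrier ?P)"
    proof (rule inj_onI)
      fix g h assume gh: "g \<in> carrier ?P" "h \<in> carrier ?P" and e: "?\<psi> g = ?\<psi> h"
      have "g ` B = h ` B" if "B \<in> F" for B using fun_cong[OF e, of B] that by simp
      moreover have "g \<in> G" "h \<in> G" using gh PG by auto
      ultimately show "g = h" using sepG by blast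
    qed
  qed
  obtain H where H: "subgroup H ?P"
    and comm: "\<And>g h. g \<in> H \<Longrightarrow> h \<in> H \<Longrightarrow> g \<otimes>\<^bsub>?P\<^esub> h = h \<otimes>\<^bsub>?P\<^esub> g"
    and HS: "transitive_action (?P\<lparr>carrier := H\<rparr>) S (\<lambda>g. g)"
    and HF: "transitive_action (?P\<lparr>carrier := H\<rparr>) F ?\<psi>"
    using abelian_transitive_subgroup[OF fS fF p _ cS cF mn, of a] P by (auto simp: order_def)
  have HG: "h \<in> G" if "h \<in> H" for h using subgroup.subset[OF H] PG that by auto
  show ?thesis
  proof (rule hypergraph_self_dual[OF F finS(2) finF(2), of H])
    show "g (h x) = h (g x)" if "g \<in> H" "h \<in> H" "x \<in> S" for g h x
      using fun_cong[OF comm[OF that(1,2)], of x] that comp HG by (simp add: compose_def)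
    show "\<exists>h\<in>H. h x = y" if "x \<in> S" "y \<in> S" for x y
      using transitive_action.unique_orbit[OF HS that] by simp
    show "\<exists>h\<in>H. h ` B = C" if "B \<in> F" "C \<in> F" for B C
      using transitive_action.unique_orbit[OF HF that] that by simp
  qed (use bij imF HG sep that in auto)
qed

section \<open>Automorphisms of bipartite graphs\<close>

lemma card_equal_fibres:
  assumes "finite S" "\<And>i. i \<in> f ` S \<Longrightarrow> card {x \<in> S. f x = i} = k"
  shows "card S = k * card (f ` S)"
proof -
  have "card S = (\<Sum>i\<in>f ` S. card {x \<in> S. f x = i})"
    using sum.image_gen[OF assms(1), of "\<lambda>_. 1::nat" f] by simp
  then show ?thesis using assms(2) by simp
qed

lemma finite_inj_on_endo_bij:
  assumes "finite P" "inj_on f P" "\<And>x. x \<in> P \<Longrightarrow> f x \<in> P"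
  shows "bij_betw f P P"
  using assms endo_inj_surj[of P f] by (auto simp: bij_betw_def)

lemma fst_fibre: "b \<in> P \<Longrightarrow> {y \<in> P \<times> Q. fst y = b} = {b} \<times> Q"
  by auto

text \<open>Choose a bijection between each pair of corresponding fibres and glue. This lifts
  dualities and automorphisms from twin classes to vertices, and it also numbers the members of each
  class.\<close>

lemma fibrewise_bijection:
  assumes "finite S" "finite T" "bij_betw \<sigma> (f ` S) (h ` T)"
    and c: "\<And>x. x \<in> S \<Longrightarrow> card {y \<in> S. f y = f x} = card {y \<in> T. h y = \<sigma> (f x)}"
  obtains \<theta> where "bij_betw \<theta> S T" "\<And>x. x \<in> S \<Longrightarrow> h (\<theta> x) = \<sigma> (f x)"
proof -
  have "\<forall>i\<in>f ` S. \<exists>b. bij_betw b {y \<in> S. f y = i} {y \<in> T. h y = \<sigma> i}"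
    using assms by (auto intro!: finite_same_card_bij)
  then have "\<exists>b. \<forall>i\<in>f ` S. bij_betw (b i) {y \<in> S. f y = i} {y \<in> T. h y = \<sigma> i}"
    by (rule bchoice)
  then obtain b where b: "\<And>x. x \<in> S \<Longrightarrow> bij_betw (b (f x)) {y \<in> S. f y = f x} {y \<in> T. h y = \<sigma> (f x)}"
    by blast
  define \<theta> where "\<theta> x = b (f x) x" for x
  have \<theta>: "\<theta> x \<in> T" "h (\<theta> x) = \<sigma> (f x)" if "x \<in> S" for x
    using b[OF that] that by (auto simp: \<theta>_def bij_betw_def)
  show ?thesis
  proof (rule that)
    show "bij_betw \<theta> S T"
    proof (rule bij_betwI')
      fix x y assume xy: "x \<in> S" "y \<in> S"
      show "\<theta> x = \<theta> y \<longleftrightarrow> x = y"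
      proof
        assume e: "\<theta> x = \<theta> y"
        then have "\<sigma> (f x) = \<sigma> (f y)" using \<theta> xy by metis
        then have "f x = f y" using assms(3) xy by (auto simp: bij_betw_def inj_on_def)
        then show "x = y" using e b[OF xy(1)] xy by (auto simp: \<theta>_def bij_betw_def inj_on_def)
      qed simp
    next
      fix y assume y: "y \<in> T"
      then have "h y \<in> \<sigma> ` f ` S" using bij_betw_imp_surj_on[OF assms(3)] by simp
      then obtain x where x: "x \<in> S" "\<sigma> (f x) = h y" by force
      then obtain x' where "x' \<in> S" "f x' = f x" "b (f x) x' = y"
        using b[OF x(1)] y unfolding bij_betw_def by (smt (verit) imageE mem_Collect_eq)
      then show "\<exists>x\<in>S. y = \<theta> x" by (metis \<theta>_def)
    qed (use \<theta> in auto)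
  qed (use \<theta> in auto)
qed

section \<open>Automorphism groups and vertex neighborhoods\<close>

lemma aut_group_iff:
  "g \<in> carrier (aut_group \<Gamma>) \<longleftrightarrow> g \<in> extensional (verts \<Gamma>) \<and> graph_iso \<Gamma> \<Gamma> g"
  by (auto simp: aut_group_def Bij_def graph_iso_def)

text \<open>Members of \<open>aut_group\<close> are \<open>undefined\<close> off the vertex set, so
  a map defined by cases has to be restricted before it becomes an element of the group.\<close>

lemma restrict_aut:
  assumes "graph_iso \<Gamma> \<Gamma> f"
  shows "restrict f (verts \<Gamma>) \<in> carrier (aut_group \<Gamma>)"
  using assms by (auto simp: aut_group_iff graph_iso_def cong: bij_betw_cong)

lemma graph_iso_compose:
  "graph_iso \<Gamma> \<Delta> f \<Longrightarrow> graph_iso \<Delta> \<Theta> g \<Longrightarrow> graph_iso \<Gamma> \<Theta> (compose (verts \<Gamma>) g f)"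
  using bij_betw_compose[of f "verts \<Gamma>" "verts \<Delta>" g "verts \<Theta>"]
  by (auto simp: graph_iso_def compose_eq bij_betw_apply)

lemma graph_iso_inv:
  assumes "graph_iso \<Gamma> \<Delta> f"
  shows "graph_iso \<Delta> \<Gamma> (inv_into (verts \<Gamma>) f)"
proof -
  have b: "bij_betw f (verts \<Gamma>) (verts \<Delta>)" using assms by (simp add: graph_iso_def)
  have "{x, y} \<in> edges \<Delta> \<longleftrightarrow> {inv_into (verts \<Gamma>) f x, inv_into (verts \<Gamma>) f y} \<in> edges \<Gamma>"
    if "x \<in> verts \<Delta>" "y \<in> verts \<Delta>" for x y
  proof -
    have "f (inv_into (verts \<Gamma>) f z) = z" "inv_into (verts \<Gamma>) f z \<in> verts \<Gamma>" if "z \<in> verts \<Delta>" for z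
      using b that by (auto simp: bij_betw_def f_inv_into_f inv_into_into)
    then show ?thesis using assms that by (auto simp: graph_iso_def)
  qed
  then show ?thesis using bij_betw_inv_into[OF b] by (simp add: graph_iso_def)
qed

lemma subgroup_aut: "subgroup (carrier (aut_group \<Gamma>)) (BijGroup (verts \<Gamma>))"
proof -
  interpret B: group "BijGroup (verts \<Gamma>)" by (rule group_BijGroup)
  have car: "g \<in> carrier (aut_group \<Gamma>) \<longleftrightarrow> g \<in> Bij (verts \<Gamma>) \<and> graph_iso \<Gamma> \<Gamma> g" for g
    by (auto simp: aut_group_def)
  show ?thesis
  proof (rule B.subgroupI)
    have "graph_iso \<Gamma> \<Gamma> (\<lambda>x. x)" by (auto simp: graph_iso_def bij_betw_def)
    then show "carrier (aut_group \<Gamma>) \<noteq> {}" using restrict_aut by blast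
  next
    fix f g assume fg: "f \<in> carrier (aut_group \<Gamma>)" "g \<in> carrier (aut_group \<Gamma>)"
    then show "f \<otimes>\<^bsub>BijGroup (verts \<Gamma>)\<^esub> g \<in> carrier (aut_group \<Gamma>)"
      using graph_iso_compose[of \<Gamma> \<Gamma> g \<Gamma> f] by (simp add: car mult_BijGroup compose_Bij)
  next
    fix f assume f: "f \<in> carrier (aut_group \<Gamma>)"
    then show "inv\<^bsub>BijGroup (verts \<Gamma>)\<^esub> f \<in> carrier (aut_group \<Gamma>)"
      using restrict_aut[OF graph_iso_inv[of \<Gamma> \<Gamma> f]] by (simp add: car inv_BijGroup)
  qed (auto simp: car)
qed

lemma aut_group_eq: "aut_group \<Gamma> = BijGroup (verts \<Gamma>)\<lparr>carrier := carrier (aut_group \<Gamma>)\<rparr>"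
  by (simp add: aut_group_def)

lemma group_aut: "group (aut_group \<Gamma>)"
  by (metis aut_group_eq group_BijGroup group.subgroup_imp_group subgroup_aut)

lemma mult_aut:
  "f \<in> carrier (aut_group \<Gamma>) \<Longrightarrow> g \<in> carrier (aut_group \<Gamma>) \<Longrightarrow>
    f \<otimes>\<^bsub>aut_group \<Gamma>\<^esub> g = compose (verts \<Gamma>) f g"
  by (simp add: aut_group_def mult_BijGroup)

lemma aut_mult_image:
  assumes "g \<in> carrier (aut_group \<Gamma>)" "h \<in> carrier (aut_group \<Gamma>)" "B \<subseteq> verts \<Gamma>"
  shows "(g \<otimes>\<^bsub>aut_group \<Gamma>\<^esub> h) ` B = g ` h ` B"
  unfolding mult_aut[OF assms(1,2)] image_image
  using assms(3) by (intro image_cong) (auto simp: compose_def)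

lemma one_aut: "\<one>\<^bsub>aut_group \<Gamma>\<^esub> = (\<lambda>x\<in>verts \<Gamma>. x)"
  by (simp add: aut_group_def BijGroup_def)

lemma aut_bij: "g \<in> carrier (aut_group \<Gamma>) \<Longrightarrow> bij_betw g (verts \<Gamma>) (verts \<Gamma>)"
  by (simp add: aut_group_iff graph_iso_def)

lemma aut_mem: "g \<in> carrier (aut_group \<Gamma>) \<Longrightarrow> v \<in> verts \<Gamma> \<Longrightarrow> g v \<in> verts \<Gamma>"
  using aut_bij bij_betw_apply by metis

lemma aut_eq_iff:
  "g \<in> carrier (aut_group \<Gamma>) \<Longrightarrow> x \<in> verts \<Gamma> \<Longrightarrow> y \<in> verts \<Gamma> \<Longrightarrow> g x = g y \<longleftrightarrow> x = y"
  using aut_bij[of g \<Gamma>] by (auto simp: bij_betw_def inj_on_def)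

lemma aut_edge:
  "g \<in> carrier (aut_group \<Gamma>) \<Longrightarrow> x \<in> verts \<Gamma> \<Longrightarrow> y \<in> verts \<Gamma> \<Longrightarrow>
    {g x, g y} \<in> edges \<Gamma> \<longleftrightarrow> {x, y} \<in> edges \<Gamma>"
  by (auto simp: aut_group_iff graph_iso_def)

lemma aut_eqI:
  assumes "f \<in> carrier (aut_group \<Gamma>)" "g \<in> carrier (aut_group \<Gamma>)" "\<And>v. v \<in> verts \<Gamma> \<Longrightarrow> f v = g v"
  shows "f = g"
  using assms by (intro extensionalityI[of f "verts \<Gamma>" g]) (auto simp: aut_group_iff)

lemma aut_inv:
  assumes "g \<in> carrier (aut_group \<Gamma>)" "v \<in> verts \<Gamma>"
  shows "(inv\<^bsub>aut_group \<Gamma>\<^esub> g) (g v) = v" "g ((inv\<^bsub>aut_group \<Gamma>\<^esub> g) v) = v"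
proof -
  interpret A: group "aut_group \<Gamma>" by (rule group_aut)
  have i: "inv\<^bsub>aut_group \<Gamma>\<^esub> g \<in> carrier (aut_group \<Gamma>)" using assms(1) by (rule A.inv_closed)
  have "compose (verts \<Gamma>) (inv\<^bsub>aut_group \<Gamma>\<^esub> g) g = (\<lambda>x\<in>verts \<Gamma>. x)"
    using A.l_inv[OF assms(1)] unfolding one_aut mult_aut[OF i assms(1)] .
  from fun_cong[OF this, of v] show "(inv\<^bsub>aut_group \<Gamma>\<^esub> g) (g v) = v"
    using assms(2) by (simp add: compose_eq)
  have "compose (verts \<Gamma>) g (inv\<^bsub>aut_group \<Gamma>\<^esub> g) = (\<lambda>x\<in>verts \<Gamma>. x)"
    using A.r_inv[OF assms(1)] unfolding one_aut mult_aut[OF assms(1) i] .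
  from fun_cong[OF this, of v] show "g ((inv\<^bsub>aut_group \<Gamma>\<^esub> g) v) = v"
    using assms(2) by (simp add: compose_eq)
qed

lemma aut_inv_image:
  assumes "g \<in> carrier (aut_group \<Gamma>)" "S \<subseteq> verts \<Gamma>" "g ` S = S"
  shows "(inv\<^bsub>aut_group \<Gamma>\<^esub> g) ` S = S"
proof -
  have "(inv\<^bsub>aut_group \<Gamma>\<^esub> g) ` g ` S = S"
    unfolding image_image using assms(2) aut_inv(1)[OF assms(1)] by (metis (no_types, lifting) image_cong image_ident subsetD)
  then show ?thesis using assms(3) by simp
qed

lemma nbhd_subset: "nbhd \<Gamma> v \<subseteq> verts \<Gamma>"
  by (auto simp: nbhd_def)

lemma nbhd_aut:
  assumes g: "g \<in> carrier (aut_group \<Gamma>)" and v: "v \<in> verts \<Gamma>"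
  shows "nbhd \<Gamma> (g v) = g ` nbhd \<Gamma> v"
proof
  show "g ` nbhd \<Gamma> v \<subseteq> nbhd \<Gamma> (g v)"
    using aut_mem[OF g] aut_edge[OF g v] by (auto simp: nbhd_def)
  show "nbhd \<Gamma> (g v) \<subseteq> g ` nbhd \<Gamma> v"
  proof
    fix y assume y: "y \<in> nbhd \<Gamma> (g v)"
    then obtain x where "x \<in> verts \<Gamma>" "y = g x"
      using aut_bij[OF g] by (auto simp: bij_betw_def nbhd_def)
    then show "y \<in> g ` nbhd \<Gamma> v"
      using y aut_edge[OF g v] by (auto simp: nbhd_def)
  qed
qed

lemma stabilizer_image_subgroup:
  assumes S: "\<And>B. B \<in> \<B> \<Longrightarrow> B \<subseteq> verts \<Gamma>"
  shows "subgroup {g \<in> carrier (aut_group \<Gamma>). \<forall>B\<in>\<B>. g ` B = B} (aut_group \<Gamma>)"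
proof -
  interpret A: group "aut_group \<Gamma>" by (rule group_aut)
  show ?thesis
  proof (rule A.subgroupI)
    have "\<one>\<^bsub>aut_group \<Gamma>\<^esub> ` B = B" if "B \<in> \<B>" for B
      using S[OF that] by (auto simp: one_aut image_iff)
    then show "{g \<in> carrier (aut_group \<Gamma>). \<forall>B\<in>\<B>. g ` B = B} \<noteq> {}" by blast
  next
    fix g h assume "g \<in> {g \<in> carrier (aut_group \<Gamma>). \<forall>B\<in>\<B>. g ` B = B}"
      "h \<in> {g \<in> carrier (aut_group \<Gamma>). \<forall>B\<in>\<B>. g ` B = B}"
    then have gh: "g \<in> carrier (aut_group \<Gamma>)" "h \<in> carrier (aut_group \<Gamma>)"
      "\<And>B. B \<in> \<B> \<Longrightarrow> g ` B = B" "\<And>B. B \<in> \<B> \<Longrightarrow> h ` B = B" by auto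
    have "(g \<otimes>\<^bsub>aut_group \<Gamma>\<^esub> h) ` B = B" if B: "B \<in> \<B>" for B
    proof -
      have "(g \<otimes>\<^bsub>aut_group \<Gamma>\<^esub> h) ` B = g ` h ` B"
        using S[OF B] by (force simp: mult_aut[OF gh(1,2)] compose_def image_iff)
      then show ?thesis using gh B by simp
    qed
    then show "g \<otimes>\<^bsub>aut_group \<Gamma>\<^esub> h \<in> {g \<in> carrier (aut_group \<Gamma>). \<forall>B\<in>\<B>. g ` B = B}"
      using gh by auto
  qed (auto simp: aut_inv_image S)
qed

lemma bipartition_sym:
  assumes "bipartition \<Gamma> W U"
  shows "bipartition \<Gamma> U W"
proof -
  have "\<exists>u\<in>U. \<exists>w\<in>W. e = {u, w}" if e: "e \<in> edges \<Gamma>" for e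
  proof -
    obtain w u where "w \<in> W" "u \<in> U" "e = {w, u}" using assms e by (auto simp: bipartition_def)
    moreover from this have "e = {u, w}" by auto
    ultimately show ?thesis by blast
  qed
  moreover have "U \<union> W = verts \<Gamma>" "U \<inter> W = {}"
    using assms unfolding bipartition_def by (simp_all only: Un_commute Int_commute)
  ultimately show ?thesis unfolding bipartition_def by (intro conjI ballI)
qed

lemma bipartition_no_edge:
  assumes "bipartition \<Gamma> W U" "x \<in> W" "y \<in> W"
  shows "{x, y} \<notin> edges \<Gamma>"
proof
  assume "{x, y} \<in> edges \<Gamma>"
  then obtain w u where "w \<in> W" "u \<in> U" "{x, y} = {w, u}" using assms by (auto simp: bipartition_def)
  then show False using assms by (auto simp: bipartition_def doubleton_eq_iff)
qed

text \<open>Neither graph has edges inside a part, so cross pairs decide. Taking the bipartition of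
  the same graph in reversed order as target gives the automorphism that exchanges the
  parts.\<close>

lemma bipartite_graph_isoI:
  assumes \<Gamma>: "bipartition \<Gamma> W U" and \<Delta>: "bipartition \<Delta> W' U'"
    and f: "bij_betw f W W'" "bij_betw f U U'"
    and e: "\<And>w u. w \<in> W \<Longrightarrow> u \<in> U \<Longrightarrow> {w, u} \<in> edges \<Gamma> \<longleftrightarrow> {f w, f u} \<in> edges \<Delta>"
  shows "graph_iso \<Gamma> \<Delta> f"
proof -
  have d: "verts \<Gamma> = W \<union> U" "W \<inter> U = {}" "verts \<Delta> = W' \<union> U'" "W' \<inter> U' = {}"
    using \<Gamma> \<Delta> by (auto simp: bipartition_def)
  have "{x, y} \<in> edges \<Gamma> \<longleftrightarrow> {f x, f y} \<in> edges \<Delta>" if xy: "x \<in> verts \<Gamma>" "y \<in> verts \<Gamma>" for x y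
  proof -
    consider "x \<in> W" "y \<in> W" | "x \<in> U" "y \<in> U" | "x \<in> W" "y \<in> U" | "x \<in> U" "y \<in> W"
      using xy unfolding d(1) by blast
    then show ?thesis
    proof cases
      case 1
      then show ?thesis using bipartition_no_edge[OF \<Gamma>] bipartition_no_edge[OF \<Delta>] f(1)
        by (metis bij_betw_apply)
    next
      case 2
      then show ?thesis
        using bipartition_no_edge[OF bipartition_sym[OF \<Gamma>]] bipartition_no_edge[OF bipartition_sym[OF \<Delta>]] f(2)
        by (metis bij_betw_apply)
    next
      case 3
      then show ?thesis using e by blast
    next
      case 4
      then show ?thesis using e[of y x] by (simp add: insert_commute)
    qed
  qed
  moreover have "bij_betw f (verts \<Gamma>) (verts \<Delta>)"
    using bij_betw_combine[OF f d(4)] d by simp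
  ultimately show ?thesis by (simp add: graph_iso_def)
qed

lemma in_nbhd_iff: "x \<in> nbhd \<Gamma> v \<longleftrightarrow> x \<in> verts \<Gamma> \<and> {v, x} \<in> edges \<Gamma>"
  by (simp add: nbhd_def)

lemma quotient_edgeI:
  "B \<in> P \<Longrightarrow> C \<in> P \<Longrightarrow> B \<noteq> C \<Longrightarrow> x \<in> B \<Longrightarrow> y \<in> C \<Longrightarrow> {x, y} \<in> edges \<Gamma> \<Longrightarrow>
    {B, C} \<in> edges (quotient_graph \<Gamma> P)"
  by (auto simp: quotient_graph_def)

lemma bipartition_expanded_graph:
  "bipartition (expanded_graph n \<Delta> P Q) (Inl ` P) (Inr ` (Q \<times> {0..<n}))"
  by (fastforce simp: bipartition_def expanded_graph_def)

lemma expanded_edge_iff: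
  "x \<in> P \<Longrightarrow> y \<in> Q \<Longrightarrow> i < n \<Longrightarrow>
    {Inl x, Inr (y, i)} \<in> edges (expanded_graph n \<Delta> P Q) \<longleftrightarrow> {x, y} \<in> edges \<Delta>"
  by (auto simp: expanded_graph_def doubleton_eq_iff)

section \<open>Bipartite graphs: duality of twin classes and double counting\<close>

locale bipartite_graph =
  fixes \<Gamma> :: "'a sgraph" and W U :: "'a set"
  assumes simple: "simple_graph \<Gamma>" and bip: "bipartition \<Gamma> W U"
begin

abbreviation "N \<equiv> nbhd \<Gamma>"
abbreviation "Aut \<equiv> carrier (aut_group \<Gamma>)"

lemma verts_eq: "verts \<Gamma> = W \<union> U" and disjoint: "W \<inter> U = {}"
  using bip by (auto simp: bipartition_def)

lemma finite_parts: "finite W" "finite U"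
  using simple verts_eq by (auto simp: simple_graph_def)

lemma nbhd_W: "w \<in> W \<Longrightarrow> N w \<subseteq> U"
  using bipartition_no_edge[OF bip] verts_eq by (auto simp: nbhd_def)

lemma nbhd_U: "u \<in> U \<Longrightarrow> N u \<subseteq> W"
  using bipartition_no_edge[OF bipartition_sym[OF bip]] verts_eq by (auto simp: nbhd_def)

lemma mem_nbhd: "x \<in> verts \<Gamma> \<Longrightarrow> y \<in> verts \<Gamma> \<Longrightarrow> x \<in> N y \<longleftrightarrow> {x, y} \<in> edges \<Gamma>"
  by (auto simp: nbhd_def insert_commute)

lemma nbhd_sym: "x \<in> verts \<Gamma> \<Longrightarrow> y \<in> verts \<Gamma> \<Longrightarrow> x \<in> N y \<longleftrightarrow> y \<in> N x"
  by (auto simp: nbhd_def insert_commute)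

lemma edgeE:
  assumes "e \<in> edges \<Gamma>"
  obtains w u where "w \<in> W" "u \<in> U" "e = {w, u}"
  using assms bip by (auto simp: bipartition_def)

text \<open>The sets \<open>W0\<close> and \<open>U0\<close>, closed under taking neighbors, can be
  the whole parts or those of one component; both cases are needed. A twin class is represented by
  the common neighborhood of its members, and \<open>\<sigma>\<close>, \<open>\<tau>\<close> are the
  duality read on these neighborhoods.\<close>

lemma twin_class_duality:
  assumes W0: "W0 \<subseteq> W" and U0: "U0 \<subseteq> U"
    and NW: "\<And>w. w \<in> W0 \<Longrightarrow> N w \<subseteq> U0" and NU: "\<And>u. u \<in> U0 \<Longrightarrow> N u \<subseteq> W0"
    and tW: "\<And>x y. x \<in> W0 \<Longrightarrow> y \<in> W0 \<Longrightarrow> \<exists>g\<in>Aut. g ` W0 = W0 \<and> g ` U0 = U0 \<and> g x = y"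
    and tU: "\<And>x y. x \<in> U0 \<Longrightarrow> y \<in> U0 \<Longrightarrow> \<exists>g\<in>Aut. g ` W0 = W0 \<and> g ` U0 = U0 \<and> g x = y"
    and p: "Factorial_Ring.prime p" and cW: "card (N ` W0) = p ^ m" and cU: "card (N ` U0) = p ^ n"
    and mn: "m \<le> 2 \<and> n \<le> 2 \<or> n \<le> 1"
  obtains \<sigma> \<tau> where "bij_betw \<sigma> (N ` W0) (N ` U0)" "bij_betw \<tau> (N ` U0) (N ` W0)"
    "\<And>w u w' u'. w \<in> W0 \<Longrightarrow> u \<in> U0 \<Longrightarrow> w' \<in> W0 \<Longrightarrow> u' \<in> U0 \<Longrightarrow> N w' = \<tau> (N u) \<Longrightarrow>
      N u' = \<sigma> (N w) \<Longrightarrow> w \<in> N u \<longleftrightarrow> w' \<in> N u'"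
proof -
  have V: "v \<in> verts \<Gamma>" if "v \<in> W0 \<or> v \<in> U0" for v using that W0 U0 verts_eq by blast
  define S where "S = N ` W0"
  \<comment> \<open>\<open>\<iota>\<close> rewrites the neighborhood of a vertex of
    \<open>U0\<close> as a set of points of \<open>S\<close>, which turns the reduced graph into a
    hypergraph.\<close>
  define \<iota> where "\<iota> B = N ` B" for B
  define F where "F = \<iota> ` N ` U0"
  \<comment> \<open>An automorphism may carry one component to another, so only those that keep
    \<open>W0\<close> and \<open>U0\<close> are used.\<close>
  define T where "T = {g \<in> Aut. \<forall>B\<in>{W0, U0}. g ` B = B}"
  define \<psi> where "\<psi> g = (\<lambda>C\<in>S. g ` C)" for g :: "'a \<Rightarrow> 'a"
  \<comment> \<open>Twins in \<open>W0\<close> have the same adjacency to \<open>u\<close>, so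
    membership of classes is adjacency of vertices. In particular \<open>N u\<close> can be
    recovered from \<open>\<iota> (N u)\<close>.\<close>
  have mem: "N w \<in> \<iota> (N u) \<longleftrightarrow> w \<in> N u" if wu: "w \<in> W0" "u \<in> U0" for w u
  proof
    assume "N w \<in> \<iota> (N u)"
    then obtain w' where w': "w' \<in> N u" "N w = N w'" by (auto simp: \<iota>_def)
    then have "u \<in> N w" using nbhd_sym[of u w'] V NU[OF wu(2)] wu by blast
    then show "w \<in> N u" using nbhd_sym V wu by blast
  qed (auto simp: \<iota>_def)
  have \<iota>: "bij_betw \<iota> (N ` U0) F"
  proof -
    have "N u \<subseteq> N u'" if "u \<in> U0" "u' \<in> U0" "\<iota> (N u) = \<iota> (N u')" for u u'
      using mem[OF _ that(1)] mem[OF _ that(2)] that NU by blast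
    then have "inj_on \<iota> (N ` U0)" by (auto simp: inj_on_def)
    then show ?thesis by (simp add: F_def bij_betw_def)
  qed
  have T: "subgroup T (aut_group \<Gamma>)"
    unfolding T_def by (rule stabilizer_image_subgroup) (use V in auto)
  have TA: "g \<in> Aut" "g ` W0 = W0" "g ` U0 = U0" if "g \<in> T" for g using that by (auto simp: T_def)
  have \<psi>N: "\<psi> g (N w) = N (g w)" if "g \<in> T" "w \<in> W0" for g w
    using nbhd_aut[OF TA(1)[OF that(1)]] V that by (simp add: \<psi>_def S_def)
  have Tm: "g w \<in> W0" if "g \<in> T" "w \<in> W0" for g w using TA[OF that(1)] that by blast
  have TmU: "g u \<in> U0" if "g \<in> T" "u \<in> U0" for g u using TA[OF that(1)] that by blast
  have \<psi>B: "\<psi> g \<in> Bij S" if g: "g \<in> T" for g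
  proof -
    have "\<psi> g ` S = S"
    proof -
      have "\<psi> g ` S = (\<lambda>w. N (g w)) ` W0" unfolding S_def image_image using \<psi>N g by simp
      also have "\<dots> = N ` g ` W0" by (simp add: image_image)
      finally show ?thesis using TA g by (simp add: S_def)
    qed
    moreover have "inj_on (\<psi> g) S"
    proof (rule inj_onI)
      fix C D assume CD: "C \<in> S" "D \<in> S" "\<psi> g C = \<psi> g D"
      then have "g ` C = g ` D" by (simp add: \<psi>_def)
      moreover have "C \<subseteq> verts \<Gamma>" "D \<subseteq> verts \<Gamma>" using CD nbhd_subset[of \<Gamma>] unfolding S_def by blast+
      ultimately show "C = D"
        using inj_on_image_eq_iff[OF bij_betw_imp_inj_on[OF aut_bij[OF TA(1)[OF g]]]] by blast
    qed
    ultimately show ?thesis by (simp add: Bij_def bij_betw_def \<psi>_def)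
  qed
  interpret A: group "aut_group \<Gamma>" by (rule group_aut)
  interpret B: group "BijGroup S" by (rule group_BijGroup)
  let ?T = "aut_group \<Gamma>\<lparr>carrier := T\<rparr>"
  interpret T: group ?T by (rule A.subgroup_imp_group[OF T])
  interpret h: group_hom ?T "BijGroup S" \<psi>
  proof unfold_locales
    show "\<psi> \<in> hom ?T (BijGroup S)"
    proof (rule homI)
      show "\<psi> g \<in> carrier (BijGroup S)" if "g \<in> carrier ?T" for g using that \<psi>B by simp
      fix g h assume gh: "g \<in> carrier ?T" "h \<in> carrier ?T"
      have "\<psi> (g \<otimes>\<^bsub>aut_group \<Gamma>\<^esub> h) = compose S (\<psi> g) (\<psi> h)"
      proof (rule extensionalityI[of _ S])
        fix C assume C: "C \<in> S"
        then obtain w where w: "w \<in> W0" "C = N w" by (auto simp: S_def)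
        have "g \<otimes>\<^bsub>aut_group \<Gamma>\<^esub> h \<in> T" using subgroup.m_closed[OF T] gh by simp
        then have "\<psi> (g \<otimes>\<^bsub>aut_group \<Gamma>\<^esub> h) C = N ((g \<otimes>\<^bsub>aut_group \<Gamma>\<^esub> h) w)"
          using \<psi>N w by simp
        also have "\<dots> = N (g (h w))" using mult_aut[of g \<Gamma> h] TA(1) gh V w by (simp add: compose_def)
        also have "\<dots> = \<psi> g (\<psi> h C)" using \<psi>N Tm gh w by simp
        finally show "\<psi> (g \<otimes>\<^bsub>aut_group \<Gamma>\<^esub> h) C = compose S (\<psi> g) (\<psi> h) C"
          using C by (simp add: compose_def)
      qed (simp_all add: \<psi>_def compose_def)
      then show "\<psi> (g \<otimes>\<^bsub>?T\<^esub> h) = \<psi> g \<otimes>\<^bsub>BijGroup S\<^esub> \<psi> h"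
        using \<psi>B gh by (simp add: mult_BijGroup)
    qed
  qed
  \<comment> \<open>Elements of \<open>T\<close> that move vertices only inside twin classes act
    trivially on \<open>S\<close>; passing to the image of \<open>T\<close> makes the action
    faithful.\<close>
  have G: "subgroup (\<psi> ` T) (BijGroup S)" using h.img_is_subgroup by simp
  have \<psi>F: "\<psi> g ` \<iota> (N u) = \<iota> (N (g u))" if g: "g \<in> T" and u: "u \<in> U0" for g u
  proof -
    have "\<psi> g ` \<iota> (N u) = (\<lambda>w. N (g w)) ` N u"
      unfolding \<iota>_def image_image using \<psi>N[OF g] NU[OF u] by (intro image_cong) auto
    also have "\<dots> = \<iota> (g ` N u)" by (simp add: \<iota>_def image_image)
    finally show ?thesis using nbhd_aut[OF TA(1)[OF g]] V u by simp
  qed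
  have cF: "card F = p ^ n" using bij_betw_same_card[OF \<iota>] cU by simp
  obtain \<sigma>' \<tau>' where \<sigma>': "bij_betw \<sigma>' S F" and \<tau>': "bij_betw \<tau>' F S"
    and dual: "\<And>x B. x \<in> S \<Longrightarrow> B \<in> F \<Longrightarrow> x \<in> B \<longleftrightarrow> \<tau>' B \<in> \<sigma>' x"
  proof (rule prime_power_hypergraph_self_dual[OF p cW[folded S_def] cF mn G])
    show "F \<subseteq> Pow S" using NU by (auto simp: F_def \<iota>_def S_def)
    show "g ` B \<in> F" if gB: "g \<in> \<psi> ` T" "B \<in> F" for g B
    proof -
      obtain h u where "h \<in> T" "u \<in> U0" "g = \<psi> h" "B = \<iota> (N u)" using gB by (auto simp: F_def)
      then show ?thesis using \<psi>F TmU by (auto simp: F_def)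
    qed
    show "\<exists>g\<in>\<psi> ` T. g x = y" if "x \<in> S" "y \<in> S" for x y
    proof -
      obtain w w' where w: "w \<in> W0" "w' \<in> W0" "x = N w" "y = N w'" using \<open>x \<in> S\<close> \<open>y \<in> S\<close> by (auto simp: S_def)
      then obtain g where "g \<in> T" "g w = w'" using tW[of w w'] by (auto simp: T_def)
      then show ?thesis using \<psi>N w by blast
    qed
    show "\<exists>g\<in>\<psi> ` T. g ` B = C" if "B \<in> F" "C \<in> F" for B C
    proof -
      obtain u u' where u: "u \<in> U0" "u' \<in> U0" "B = \<iota> (N u)" "C = \<iota> (N u')" using \<open>B \<in> F\<close> \<open>C \<in> F\<close> by (auto simp: F_def)
      then obtain g where "g \<in> T" "g u = u'" using tU[of u u'] by (auto simp: T_def)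
      then show ?thesis using \<psi>F u by blast
    qed
    show "x = y" if xy: "x \<in> S" "y \<in> S" and e: "\<forall>B\<in>F. x \<in> B \<longleftrightarrow> y \<in> B" for x y
    proof -
      obtain w w' where w: "w \<in> W0" "w' \<in> W0" "x = N w" "y = N w'" using xy by (auto simp: S_def)
      have "w \<in> N u \<longleftrightarrow> w' \<in> N u" if "u \<in> U0" for u
        using e mem w that by (auto simp: F_def)
      then have "u \<in> N w \<longleftrightarrow> u \<in> N w'" if "u \<in> U0" for u
        using that w nbhd_sym[of u] V by blast
      then show ?thesis using w NW by blast
    qed
  qed (blast intro: that)
  \<comment> \<open>The hypergraph duality relates \<open>S\<close> to \<open>F\<close>; transport
    along \<open>\<iota>\<close> expresses it by neighborhoods of vertices of
    \<open>U0\<close>.\<close>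
  define \<sigma> where "\<sigma> = inv_into (N ` U0) \<iota> \<circ> \<sigma>'"
  define \<tau> where "\<tau> = \<tau>' \<circ> \<iota>"
  show ?thesis
  proof (rule that)
    show b\<sigma>: "bij_betw \<sigma> (N ` W0) (N ` U0)"
      unfolding \<sigma>_def using bij_betw_trans[OF \<sigma>' bij_betw_inv_into[OF \<iota>]] by (simp add: S_def)
    show "bij_betw \<tau> (N ` U0) (N ` W0)"
      unfolding \<tau>_def using bij_betw_trans[OF \<iota> \<tau>'] by (simp add: S_def)
    fix w u w' u' assume w: "w \<in> W0" "u \<in> U0" "w' \<in> W0" "u' \<in> U0" "N w' = \<tau> (N u)" "N u' = \<sigma> (N w)"
    have "\<sigma>' (N w) \<in> F" using \<sigma>' w by (auto simp: S_def bij_betw_def)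
    then have "\<iota> (N u') = \<sigma>' (N w)"
      using w \<iota> by (simp add: \<sigma>_def bij_betw_inv_into_right)
    moreover have "w \<in> N u \<longleftrightarrow> \<tau>' (\<iota> (N u)) \<in> \<sigma>' (N w)"
      using dual[of "N w" "\<iota> (N u)"] mem w by (auto simp: S_def F_def)
    moreover have "w' \<in> N u' \<longleftrightarrow> N w' \<in> \<iota> (N u')"
      using mem[OF w(3,4)] by simp
    ultimately show "w \<in> N u \<longleftrightarrow> w' \<in> N u'"
      using w(5) by (simp add: \<tau>_def)
  qed
qed

text \<open>An automorphism that keeps \<open>S\<close> and takes \<open>x\<close> to
  \<open>y\<close> takes the twin class of \<open>x\<close> in \<open>S\<close> to that of
  \<open>y\<close>, so all these classes have the same size.\<close>

lemma transitive_twin_classes: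
  assumes S: "S \<subseteq> verts \<Gamma>" "finite S"
    and t: "\<And>x y. x \<in> S \<Longrightarrow> y \<in> S \<Longrightarrow> \<exists>g\<in>Aut. g ` S = S \<and> g x = y"
    and x: "x \<in> S"
  shows "card S = card {z \<in> S. N z = N x} * card (N ` S)"
proof (rule card_equal_fibres[OF S(2)])
  fix i assume "i \<in> N ` S"
  then obtain y where y: "y \<in> S" "i = N y" by blast
  obtain g where g: "g \<in> Aut" "g ` S = S" "g x = y" using t x y by blast
  have "g ` {z \<in> S. N z = N x} = {z \<in> S. N z = i}"
  proof -
    have "N (g z) = N y \<longleftrightarrow> N z = N x" if "z \<in> S" for z
      using nbhd_aut[OF g(1)] inj_on_image_eq_iff[OF bij_betw_imp_inj_on[OF aut_bij[OF g(1)]] nbhd_subset nbhd_subset]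
        S(1) that x g(3) by (metis subsetD)
    then have "g ` {z \<in> S. N z = N x} = {z \<in> g ` S. N z = N y}" by blast
    then show ?thesis unfolding g(2) y(2) .
  qed
  moreover have "inj_on g {z \<in> S. N z = N x}"
    using bij_betw_imp_inj_on[OF aut_bij[OF g(1)]] S(1) by (auto intro: inj_on_subset)
  ultimately show "card {z \<in> S. N z = i} = card {z \<in> S. N z = N x}"
    using card_image[of g "{z \<in> S. N z = N x}"] by simp
qed

text \<open>Double counting of the edges between \<open>W0\<close> and \<open>U0\<close>, each
  vertex lying on \<open>d\<close> of them.\<close>

lemma regular_parts:
  assumes W0: "W0 \<subseteq> W" and U0: "U0 \<subseteq> U"
    and NW: "\<And>w. w \<in> W0 \<Longrightarrow> N w \<subseteq> U0" and NU: "\<And>u. u \<in> U0 \<Longrightarrow> N u \<subseteq> W0"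
    and d: "\<And>v. v \<in> verts \<Gamma> \<Longrightarrow> card (N v) = d" "d > 0"
  shows "card W0 = card U0"
proof -
  have f: "finite W0" "finite U0" using W0 U0 finite_parts finite_subset by auto
  have V: "v \<in> verts \<Gamma>" if "v \<in> W0 \<or> v \<in> U0" for v using that W0 U0 verts_eq by blast
  have "card W0 * d = (\<Sum>w\<in>W0. card {u \<in> U0. u \<in> N w})"
  proof -
    have "card {u \<in> U0. u \<in> N w} = d" if "w \<in> W0" for w
    proof -
      have "{u \<in> U0. u \<in> N w} = N w" using NW[OF that] by blast
      then show ?thesis using d V that by simp
    qed
    then show ?thesis by simp
  qed
  also have "\<dots> = (\<Sum>w\<in>W0. \<Sum>u\<in>U0. if u \<in> N w then 1 else 0)"
    using f by (simp add: sum.If_cases Int_def)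
  also have "\<dots> = (\<Sum>u\<in>U0. \<Sum>w\<in>W0. if w \<in> N u then 1 else 0)"
    by (subst sum.swap) (use V nbhd_sym in \<open>auto intro!: sum.cong\<close>)
  also have "\<dots> = (\<Sum>u\<in>U0. card {w \<in> W0. w \<in> N u})"
    using f by (simp add: sum.If_cases Int_def)
  also have "\<dots> = card U0 * d"
  proof -
    have "card {w \<in> W0. w \<in> N u} = d" if "u \<in> U0" for u
    proof -
      have "{w \<in> W0. w \<in> N u} = N u" using NU[OF that] by blast
      then show ?thesis using d V that by simp
    qed
    then show ?thesis by simp
  qed
  finally show ?thesis using d by simp
qed

end

section \<open>Twin classes\<close>

lemma mult_eq_prime_power:
  fixes x y p :: nat
  assumes p: "Factorial_Ring.prime p" and e: "x * y = p ^ k"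
  obtains a b where "x = p ^ a" "y = p ^ b" "a + b = k"
proof -
  obtain a b where ab: "x = p ^ a" "y = p ^ b"
    using divides_primepow_nat[OF p] e by (metis dvd_triv_left dvd_triv_right)
  then have "p ^ (a + b) = p ^ k" using e by (simp add: power_add)
  then have "a + b = k" using prime_gt_1_nat[OF p] by simp
  then show ?thesis using ab that by blast
qed

text \<open>The setting of the theorem after its first consequences: \<open>aut_W\<close> forbids an
  exchange of the parts and is what a lifted duality contradicts, while the unfaithful action on
  \<open>W\<close> appears as a pair of twins in \<open>U\<close>.\<close>

locale twinned_graph = bipartite_graph +
  fixes p d :: nat
  assumes p: "Factorial_Ring.prime p"
    and aut_W: "g \<in> carrier (aut_group \<Gamma>) \<Longrightarrow> g ` W = W"
    and card_W: "card W = p ^ 3" and card_U: "card U = p ^ 3"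
    and trans_W: "x \<in> W \<Longrightarrow> y \<in> W \<Longrightarrow> \<exists>g\<in>carrier (aut_group \<Gamma>). g x = y"
    and trans_U: "x \<in> U \<Longrightarrow> y \<in> U \<Longrightarrow> \<exists>g\<in>carrier (aut_group \<Gamma>). g x = y"
    and edge_trans: "edge_transitive \<Gamma>"
    and degree: "v \<in> verts \<Gamma> \<Longrightarrow> card (nbhd \<Gamma> v) = d" and degree_pos: "d > 0"
    and twins: "\<exists>x\<in>U. \<exists>y\<in>U. x \<noteq> y \<and> nbhd \<Gamma> x = nbhd \<Gamma> y"
begin

lemma aut_U:
  assumes g: "g \<in> Aut"
  shows "g ` U = U"
proof -
  have U: "U = verts \<Gamma> - W" using verts_eq disjoint by blast
  have "g ` (verts \<Gamma> - W) = g ` verts \<Gamma> - g ` W"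
    by (rule inj_on_image_set_diff[OF bij_betw_imp_inj_on[OF aut_bij[OF g]]]) (auto simp: verts_eq)
  then show ?thesis
    using aut_W[OF g] bij_betw_imp_surj_on[OF aut_bij[OF g]] \<open>U = verts \<Gamma> - W\<close> by simp
qed

lemma V_I: "w \<in> W \<Longrightarrow> w \<in> verts \<Gamma>" "u \<in> U \<Longrightarrow> u \<in> verts \<Gamma>"
  using verts_eq by auto

lemma aut_mem_W: "g \<in> Aut \<Longrightarrow> w \<in> W \<Longrightarrow> g w \<in> W"
  and aut_mem_U: "g \<in> Aut \<Longrightarrow> u \<in> U \<Longrightarrow> g u \<in> U"
  using aut_W aut_U by blast+

lemma not_swapped:
  assumes "bij_betw f W U" "bij_betw f U W"
    and e: "\<And>w u. w \<in> W \<Longrightarrow> u \<in> U \<Longrightarrow> w \<in> N u \<longleftrightarrow> f u \<in> N (f w)"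
  shows False
proof -
  have "graph_iso \<Gamma> \<Gamma> f"
  proof (rule bipartite_graph_isoI[OF bip bipartition_sym[OF bip] assms(1,2)])
    fix w u assume wu: "w \<in> W" "u \<in> U"
    have "f w \<in> U" "f u \<in> W" using wu assms(1,2) bij_betw_apply by metis+
    then have "f u \<in> N (f w) \<longleftrightarrow> {f w, f u} \<in> edges \<Gamma>"
      using V_I mem_nbhd by (simp add: insert_commute)
    moreover have "w \<in> N u \<longleftrightarrow> {w, u} \<in> edges \<Gamma>" using V_I wu mem_nbhd by simp
    ultimately show "{w, u} \<in> edges \<Gamma> \<longleftrightarrow> {f w, f u} \<in> edges \<Gamma>" using e wu by simp
  qed
  then have "restrict f (verts \<Gamma>) \<in> Aut" by (rule restrict_aut)
  then have "restrict f (verts \<Gamma>) ` W = W" by (rule aut_W)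
  moreover have "restrict f (verts \<Gamma>) ` W = f ` W" by (rule image_cong) (auto simp: V_I)
  ultimately have "W = U" using assms(1) by (simp add: bij_betw_def)
  then have "W = {}" using disjoint by simp
  then show False using card_W p by (simp add: not_prime_0)
qed

text \<open>Class sizes are \<open>p ^ a\<close> in \<open>U\<close> and \<open>p ^ b\<close> in
  \<open>W\<close>, with \<open>a + n = b + m = 3\<close>. Unless they are \<open>p\<close> and 1,
  the exponents \<open>m\<close> and \<open>n\<close> are small enough for a duality. This forces
  \<open>m = n\<close>, hence \<open>a = b\<close>, so matched classes have equal size and the
  duality lifts to vertices.\<close>

lemma U_classes_and_W_twin_free:
  shows U_class_card: "\<And>u. u \<in> U \<Longrightarrow> card {z \<in> U. N z = N u} = p" and inj_nbhd_W: "inj_on N W"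
proof -
  have tW: "\<exists>g\<in>Aut. g ` W = W \<and> g ` U = U \<and> g x = y" if "x \<in> W" "y \<in> W" for x y
    using trans_W[OF that] aut_W aut_U by blast
  have tU: "\<exists>g\<in>Aut. g ` W = W \<and> g ` U = U \<and> g x = y" if "x \<in> U" "y \<in> U" for x y
    using trans_U[OF that] aut_W aut_U by blast
  have cW: "p ^ 3 = card {z \<in> W. N z = N w} * card (N ` W)" if "w \<in> W" for w
    unfolding card_W[symmetric]
    by (rule transitive_twin_classes[OF _ finite_parts(1) _ that]) (use tW V_I in blast)+
  have cU: "p ^ 3 = card {z \<in> U. N z = N u} * card (N ` U)" if "u \<in> U" for u
    unfolding card_U[symmetric]
    by (rule transitive_twin_classes[OF _ finite_parts(2) _ that]) (use tU V_I in blast)+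
  obtain w0 where w0: "w0 \<in> W" using card_prime_power_pos[OF p card_W] by blast
  obtain u0 u1 where u01: "u0 \<in> U" "u1 \<in> U" "u0 \<noteq> u1" "N u0 = N u1" using twins by blast
  have p1: "p > 1" using p by (rule prime_gt_1_nat)
  obtain b m where b: "card {z \<in> W. N z = N w0} = p ^ b" and m: "card (N ` W) = p ^ m" and bm: "b + m = 3"
    using mult_eq_prime_power[OF p cW[OF w0, symmetric]] by metis
  obtain a n where a: "card {z \<in> U. N z = N u0} = p ^ a" and n: "card (N ` U) = p ^ n" and an: "a + n = 3"
    using mult_eq_prime_power[OF p cU[OF u01(1), symmetric]] by metis
  have fW: "card {z \<in> W. N z = N w} = p ^ b" if "w \<in> W" for w
    using cW[OF that] cW[OF w0] b m p1 by simp
  have fU: "card {z \<in> U. N z = N u} = p ^ a" if "u \<in> U" for u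
    using cU[OF that] cU[OF u01(1)] a n p1 by simp
  have "a \<noteq> 0"
  proof
    assume "a = 0"
    then obtain z where "{z \<in> U. N z = N u0} = {z}" using a card_1_singletonE by auto
    then have "u0 = z" "u1 = z" using u01 by auto
    then show False using u01 by simp
  qed
  have ab: "a = 1 \<and> b = 0"
  proof (rule ccontr)
    assume "\<not> ?thesis"
    \<comment> \<open>Since \<open>a \<ge> 1\<close>, always \<open>n \<le> 2\<close>. Either
      \<open>b \<ge> 1\<close>, which gives \<open>m \<le> 2\<close>, or \<open>b = 0\<close> and
      \<open>a \<ge> 2\<close>, which gives \<open>n \<le> 1\<close>.\<close>
    then have mn: "m \<le> 2 \<and> n \<le> 2 \<or> n \<le> 1" using \<open>a \<noteq> 0\<close> an bm by arith
    obtain \<sigma> \<tau> where \<sigma>: "bij_betw \<sigma> (N ` W) (N ` U)" and \<tau>: "bij_betw \<tau> (N ` U) (N ` W)"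
      and dual: "\<And>w u w' u'. w \<in> W \<Longrightarrow> u \<in> U \<Longrightarrow> w' \<in> W \<Longrightarrow> u' \<in> U \<Longrightarrow> N w' = \<tau> (N u) \<Longrightarrow>
        N u' = \<sigma> (N w) \<Longrightarrow> w \<in> N u \<longleftrightarrow> w' \<in> N u'"
      using twin_class_duality[OF order_refl order_refl nbhd_W nbhd_U tW tU p m n mn] by blast
    have "p ^ m = p ^ n" using bij_betw_same_card[OF \<sigma>] m n by simp
    then have eq: "a = b" using p1 an bm by simp
    obtain \<theta> where \<theta>: "bij_betw \<theta> W U" "\<And>w. w \<in> W \<Longrightarrow> N (\<theta> w) = \<sigma> (N w)"
    proof (rule fibrewise_bijection[OF finite_parts \<sigma>])
      fix w assume w: "w \<in> W"
      then obtain u where "u \<in> U" "\<sigma> (N w) = N u" using \<sigma> by (metis bij_betw_apply imageE imageI)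
      then show "card {y \<in> W. N y = N w} = card {y \<in> U. N y = \<sigma> (N w)}"
        using fW[OF w] fU eq by simp
    qed (blast intro: that)
    obtain \<theta>' where \<theta>': "bij_betw \<theta>' U W" "\<And>u. u \<in> U \<Longrightarrow> N (\<theta>' u) = \<tau> (N u)"
    proof (rule fibrewise_bijection[OF finite_parts(2,1) \<tau>])
      fix u assume u: "u \<in> U"
      then obtain w where "w \<in> W" "\<tau> (N u) = N w" using \<tau> by (metis bij_betw_apply imageE imageI)
      then show "card {y \<in> U. N y = N u} = card {y \<in> W. N y = \<tau> (N u)}"
        using fU[OF u] fW eq by simp
    qed (blast intro: that)
    \<comment> \<open>Adjacency depends only on the twin classes, so the arbitrary choices inside
      matched classes do no harm.\<close>
    define f where "f v = (if v \<in> W then \<theta> v else \<theta>' v)" for v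
    have fU: "f u = \<theta>' u" if "u \<in> U" for u using that disjoint by (auto simp: f_def)
    have fW: "f w = \<theta> w" if "w \<in> W" for w using that by (simp add: f_def)
    show False
    proof (rule not_swapped[of f])
      show "bij_betw f W U" using \<theta>(1) fW by (simp cong: bij_betw_cong)
      show "bij_betw f U W" using \<theta>'(1) fU by (simp cong: bij_betw_cong)
      fix w u assume wu: "w \<in> W" "u \<in> U"
      have "\<theta> w \<in> U" "\<theta>' u \<in> W" using \<theta>(1) \<theta>'(1) wu bij_betw_apply by metis+
      then show "w \<in> N u \<longleftrightarrow> f u \<in> N (f w)"
        using dual[of w u "\<theta>' u" "\<theta> w"] \<theta>(2) \<theta>'(2) wu fU fW by simp
    qed
  qed
  show "\<And>u. u \<in> U \<Longrightarrow> card {z \<in> U. N z = N u} = p" using fU ab by simp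
  show "inj_on N W"
  proof (rule inj_onI)
    fix x y assume xy: "x \<in> W" "y \<in> W" "N x = N y"
    have "card {z \<in> W. N z = N x} = 1" using fW[OF xy(1)] ab by simp
    then obtain z where "{z \<in> W. N z = N x} = {z}" using card_1_singletonE by blast
    then have "x = z" "y = z" using xy by auto
    then show "x = y" by simp
  qed
qed

lemma connected: "connected_graph \<Gamma>"
proof -
  define R where "R = {(a, b). {a, b} \<in> edges \<Gamma>}"
  define C where "C x = {y. (x, y) \<in> R\<^sup>*}" for x
  have edge_V: "a \<in> verts \<Gamma> \<and> b \<in> verts \<Gamma>" if "(a, b) \<in> R" for a b
    using that simple by (auto simp: R_def simple_graph_def)
  have "sym R" by (auto simp: R_def sym_def insert_commute)
  then have symR: "sym (R\<^sup>*)" by (rule sym_rtrancl)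
  have C_eq: "C y = C x" if "y \<in> C x" for x y
    using that symR unfolding C_def by (auto dest: symD intro: rtrancl_trans)
  have C_refl: "x \<in> C x" for x by (simp add: C_def)
  have C_V: "y \<in> verts \<Gamma>" if "x \<in> verts \<Gamma>" "y \<in> C x" for x y
  proof -
    have "(x, y) \<in> R\<^sup>*" using that by (simp add: C_def)
    then show ?thesis by (induction rule: rtrancl_induct) (use that edge_V in auto)
  qed
  have C_img: "g y \<in> C (g x)" if g: "g \<in> Aut" and y: "y \<in> C x" for g x y
  proof -
    have "(x, y) \<in> R\<^sup>*" using y by (simp add: C_def)
    then have "(g x, g y) \<in> R\<^sup>*"
    proof (induction rule: rtrancl_induct)
      case (step a b)
      have "(g a, g b) \<in> R"
        using step(2) edge_V[OF step(2)] aut_edge[OF g] by (auto simp: R_def)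
      then show ?case using step(3) by (rule rtrancl_into_rtrancl[rotated])
    qed simp
    then show ?thesis by (simp add: C_def)
  qed
  have C_aut: "C (g x) = g ` C x" if g: "g \<in> Aut" and x: "x \<in> verts \<Gamma>" for g x
  proof
    show "g ` C x \<subseteq> C (g x)" using C_img[OF g] by blast
    show "C (g x) \<subseteq> g ` C x"
    proof
      fix y assume y: "y \<in> C (g x)"
      let ?h = "inv\<^bsub>aut_group \<Gamma>\<^esub> g"
      have "?h \<in> Aut" using group.inv_closed[OF group_aut g] .
      then have "?h y \<in> C (?h (g x))" using C_img y by blast
      then have "?h y \<in> C x" using aut_inv(1)[OF g x] by simp
      moreover have "y \<in> verts \<Gamma>" using C_V[OF aut_mem[OF g x] y] .
      ultimately show "y \<in> g ` C x" using aut_inv(2)[OF g] by (metis image_eqI)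
    qed
  qed
  have N_C: "N v \<subseteq> C v" for v by (auto simp: nbhd_def C_def R_def)
  have p1: "p > 1" using p by (rule prime_gt_1_nat)
  have main: "C w = verts \<Gamma>" if w: "w \<in> W" for w
  proof -
    define W0 where "W0 = C w \<inter> W"
    define U0 where "U0 = C w \<inter> U"
    have W0: "W0 \<subseteq> W" and U0: "U0 \<subseteq> U" by (auto simp: W0_def U0_def)
    have NW: "N x \<subseteq> U0" if "x \<in> W0" for x
      using that nbhd_W N_C[of x] C_eq[of x w] by (auto simp: W0_def U0_def)
    have NU: "N x \<subseteq> W0" if "x \<in> U0" for x
      using that nbhd_U N_C[of x] C_eq[of x w] by (auto simp: W0_def U0_def)
    \<comment> \<open>An automorphism that takes one vertex of the component into the component maps
      the component onto itself; so transitivity on \<open>W\<close> and \<open>U\<close> passes to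
      \<open>W0\<close> and \<open>U0\<close>.\<close>
    have stab: "g ` W0 = W0 \<and> g ` U0 = U0"
      if g: "g \<in> Aut" "x \<in> C w" "g x \<in> C w" "x \<in> verts \<Gamma>" for g x
    proof -
      have "g ` C w = C w" using C_aut[OF g(1,4)] C_eq[OF g(2)] C_eq[OF g(3)] by simp
      moreover have "C w \<subseteq> verts \<Gamma>" using C_V V_I w by blast
      ultimately show ?thesis
        using inj_on_image_Int[OF bij_betw_imp_inj_on[OF aut_bij[OF g(1)]], of "C w"]
          aut_W[OF g(1)] aut_U[OF g(1)] verts_eq by (simp add: W0_def U0_def)
    qed
    have tW: "\<exists>g\<in>Aut. g ` W0 = W0 \<and> g ` U0 = U0 \<and> g x = y" if xy: "x \<in> W0" "y \<in> W0" for x y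
    proof -
      obtain g where "g \<in> Aut" "g x = y" using trans_W[of x y] xy W0 by blast
      then show ?thesis using stab[of g x] xy V_I by (auto simp: W0_def)
    qed
    have tU: "\<exists>g\<in>Aut. g ` W0 = W0 \<and> g ` U0 = U0 \<and> g x = y" if xy: "x \<in> U0" "y \<in> U0" for x y
    proof -
      obtain g where "g \<in> Aut" "g x = y" using trans_U[of x y] xy U0 by blast
      then show ?thesis using stab[of g x] xy V_I by (auto simp: U0_def)
    qed
    have WU: "card W0 = card U0" by (rule regular_parts[OF W0 U0 NW NU degree degree_pos])
    \<comment> \<open>The components cut \<open>W\<close> into translates of \<open>W0\<close>, so
      \<open>card W0\<close> divides \<open>p ^ 3\<close>.\<close>
    have "card W = card W0 * card ((\<lambda>x. C x \<inter> W) ` W)"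
    proof (rule card_equal_fibres[OF finite_parts(1)])
      fix i assume "i \<in> (\<lambda>x. C x \<inter> W) ` W"
      then obtain x where x: "x \<in> W" "i = C x \<inter> W" by blast
      have i: "{z \<in> W. C z \<inter> W = i} = C x \<inter> W"
        using C_eq C_refl unfolding x(2) by blast
      obtain g where g: "g \<in> Aut" "g w = x" using trans_W w x by blast
      have "g ` (C w \<inter> W) = g ` C w \<inter> g ` W"
        by (rule inj_on_image_Int[OF bij_betw_imp_inj_on[OF aut_bij[OF g(1)]]])
          (use C_V V_I w in auto)
      then have "C x \<inter> W = g ` W0"
        using C_aut[OF g(1) V_I(1)[OF w]] aut_W[OF g(1)] g(2) by (simp add: W0_def)
      moreover have "card (g ` W0) = card W0"
        using bij_betw_imp_inj_on[OF aut_bij[OF g(1)]] W0 V_I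
        by (intro card_image) (auto intro: inj_on_subset)
      ultimately show "card {z \<in> W. C z \<inter> W = i} = card W0" using i by simp
    qed
    then obtain c k where c: "card W0 = p ^ c" and ck: "c + k = 3"
      using mult_eq_prime_power[OF p] card_W by metis
    have "c = 3"
    proof (rule ccontr)
      assume "c \<noteq> 3"
      then have c2: "c \<le> 2" using ck by simp
      have "card U0 = p * card (N ` U0)"
      proof (rule card_equal_fibres)
        show "finite U0" using U0 finite_parts finite_subset by blast
        fix i assume "i \<in> N ` U0"
        then obtain u where u: "u \<in> U0" "i = N u" by blast
        \<comment> \<open>Twins share a neighbor, as \<open>d > 0\<close>, and hence lie in one
          component: the class of \<open>u\<close> in \<open>U\<close> is contained in
          \<open>U0\<close>.\<close>
        have "z \<in> U0" if z: "z \<in> U" "N z = N u" for z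
        proof -
          have "N u \<noteq> {}" using degree[of u] degree_pos u U0 V_I by fastforce
          then obtain x where x: "x \<in> N u" by blast
          then have "x \<in> C z" "x \<in> C u" using N_C z by blast+
          then show ?thesis using C_eq[of x z] C_eq[of x u] C_eq[of u w] C_refl[of z] u z by (auto simp: U0_def)
        qed
        then have "{z \<in> U0. N z = i} = {z \<in> U. N z = N u}" using u U0 by auto
        then show "card {z \<in> U0. N z = i} = p" using U_class_card u U0 by auto
      qed
      then have "p * card (N ` U0) = p ^ c" using c WU by simp
      then obtain a n where an: "p = p ^ a" "card (N ` U0) = p ^ n" "a + n = c"
        using mult_eq_prime_power[OF p] by metis
      have "a = 1" using an(1) p1 by (metis power_inject_exp power_one_right)
      have cN: "card (N ` W0) = p ^ c"
        using card_image[OF inj_on_subset[OF inj_nbhd_W W0]] c by simp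
      \<comment> \<open>\<open>W0\<close> has \<open>p ^ c\<close> classes, since \<open>W\<close>
        has no twins, whereas \<open>U0\<close> has \<open>p ^ n\<close> with
        \<open>n + 1 = c\<close>. A duality would make the two numbers equal.\<close>
      have mn: "c \<le> 2 \<and> n \<le> 2 \<or> n \<le> 1" using c2 an(3) by simp
      obtain \<sigma> where "bij_betw \<sigma> (N ` W0) (N ` U0)"
        by (rule twin_class_duality[OF W0 U0 NW NU tW tU p cN an(2) mn])
      then have "p ^ c = p ^ n" using bij_betw_same_card[of \<sigma>] cN an(2) by simp
      then show False using p1 an \<open>a = 1\<close> by simp
    qed
    then have "W0 = W" "U0 = U"
      using card_subset_eq[OF finite_parts(1) W0] card_subset_eq[OF finite_parts(2) U0] c WU card_W card_U
      by simp_all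
    then show "C w = verts \<Gamma>" using C_V V_I w verts_eq by (auto simp: W0_def U0_def)
  qed
  obtain w where w: "w \<in> W" using card_prime_power_pos[OF p card_W] by blast
  have "(x, y) \<in> R\<^sup>*" if "x \<in> verts \<Gamma>" "y \<in> verts \<Gamma>" for x y
  proof -
    have "x \<in> C w" "y \<in> C w" using main[OF w] that by auto
    then show ?thesis using C_eq[of x w] by (simp add: C_def set_eq_iff)
  qed
  then show ?thesis by (simp add: connected_graph_def R_def)
qed

subsection \<open>The quotient graph\<close>

text \<open>Twin classes stand in for the orbits of the kernel; \<open>orbits_U\<close> and
  \<open>orbits_verts\<close> show that they are the same sets.\<close>

abbreviation "cls u \<equiv> {z \<in> U. N z = N u}"
abbreviation "\<W> \<equiv> (\<lambda>w. {w}) ` W"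
abbreviation "\<U> \<equiv> (\<lambda>u. cls u) ` U"
abbreviation "K \<equiv> action_kernel (aut_group \<Gamma>) W"
abbreviation "\<Sigma> \<equiv> quotient_graph \<Gamma> (\<W> \<union> \<U>)"

lemma K_iff: "g \<in> K \<longleftrightarrow> g \<in> Aut \<and> (\<forall>w\<in>W. g w = w)"
proof -
  have "restrict g W = (\<lambda>w\<in>W. w) \<longleftrightarrow> (\<forall>w\<in>W. g w = w)"
    by (auto simp: restrict_def fun_eq_iff)
  then show ?thesis by (auto simp: action_kernel_def kernel_def act_on_def BijGroup_def)
qed

lemma K_nbhd:
  assumes "g \<in> K" "u \<in> U"
  shows "N (g u) = N u"
proof -
  have "N (g u) = g ` N u"
    by (rule nbhd_aut) (use assms V_I in \<open>auto simp: K_iff\<close>)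
  also have "\<dots> = N u" using assms nbhd_U[OF assms(2)] by (force simp: K_iff image_iff)
  finally show ?thesis .
qed

text \<open>The identity on \<open>W\<close> extends such an \<open>f\<close> to an automorphism,
  since no edge notices a move between twins. This is why the kernel is the full product of
  symmetric groups and not merely a subgroup of it.\<close>

lemma twin_permutation_in_K:
  assumes f: "bij_betw f U U" and N: "\<And>u. u \<in> U \<Longrightarrow> N (f u) = N u"
  obtains g where "g \<in> K" "\<And>u. u \<in> U \<Longrightarrow> g u = f u"
proof -
  define h where "h v = (if v \<in> W then v else f v)" for v
  have hU: "h u = f u" if "u \<in> U" for u using that disjoint by (auto simp: h_def)
  have fU: "f u \<in> U" if "u \<in> U" for u using f that bij_betw_apply by metis
  have "graph_iso \<Gamma> \<Gamma> h"
  proof (rule bipartite_graph_isoI[OF bip bip])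
    show "bij_betw h W W" by (auto simp: h_def bij_betw_def inj_on_def)
    show "bij_betw h U U" using f hU by (simp cong: bij_betw_cong)
    fix w u assume wu: "w \<in> W" "u \<in> U"
    have "w \<in> N u \<longleftrightarrow> w \<in> N (f u)" using N[OF wu(2)] by simp
    then show "{w, u} \<in> edges \<Gamma> \<longleftrightarrow> {h w, h u} \<in> edges \<Gamma>"
      using wu mem_nbhd V_I fU hU by (simp add: h_def)
  qed
  from restrict_aut[OF this] have "restrict h (verts \<Gamma>) \<in> K"
    by (simp add: K_iff V_I h_def)
  then show ?thesis using that[of "restrict h (verts \<Gamma>)"] hU V_I by simp
qed

lemma K_orbit_U:
  assumes u: "u \<in> U"
  shows "{g u |g. g \<in> K} = cls u"
proof
  show "{g u |g. g \<in> K} \<subseteq> cls u"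
    using K_nbhd[OF _ u] aut_mem_U u by (auto simp: K_iff)
  show "cls u \<subseteq> {g u |g. g \<in> K}"
  proof
    fix z assume z: "z \<in> cls u"
    \<comment> \<open>Exchanging two twins preserves neighborhoods, so the kernel is transitive on a
      class.\<close>
    let ?f = "Transposition.transpose u z"
    obtain g where "g \<in> K" "\<And>v. v \<in> U \<Longrightarrow> g v = ?f v"
    proof (rule twin_permutation_in_K[of ?f])
      show "bij_betw ?f U U" using u z by (simp add: bij_betw_transpose_iff)
      show "N (?f v) = N v" if "v \<in> U" for v using z by (auto simp: Transposition.transpose_def)
    qed (blast intro: that)
    then show "z \<in> {g u |g. g \<in> K}" using u by force
  qed
qed

lemma K_orbit_W:
  assumes w: "w \<in> W"
  shows "{g w |g. g \<in> K} = {w}"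
proof -
  have "\<one>\<^bsub>aut_group \<Gamma>\<^esub> \<in> K"
    using group.subgroup_self[OF group_aut, of \<Gamma>] V_I monoid.one_closed[OF group.is_monoid[OF group_aut]]
    by (simp add: K_iff one_aut)
  moreover have "g w = w" if "g \<in> K" for g using that w by (simp add: K_iff)
  ultimately show ?thesis by (auto intro: exI[of _ "\<one>\<^bsub>aut_group \<Gamma>\<^esub>"]) metis
qed

lemma orbits_U: "orbits (aut_group \<Gamma>\<lparr>carrier := K\<rparr>) U (act_on U) = \<U>"
proof -
  have "orbit (aut_group \<Gamma>\<lparr>carrier := K\<rparr>) (act_on U) u = cls u" if "u \<in> U" for u
    using K_orbit_U[OF that] that by (simp add: orbit_def act_on_def)
  then show ?thesis by (auto simp: orbits_def)
qed

lemma orbits_verts: "orbits (aut_group \<Gamma>\<lparr>carrier := K\<rparr>) (verts \<Gamma>) (act_on (verts \<Gamma>)) = \<W> \<union> \<U>"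
proof -
  let ?o = "orbit (aut_group \<Gamma>\<lparr>carrier := K\<rparr>) (act_on (verts \<Gamma>))"
  have "?o u = cls u" if "u \<in> U" for u
    using K_orbit_U[OF that] that V_I by (simp add: orbit_def act_on_def)
  moreover have "?o w = {w}" if "w \<in> W" for w
    using K_orbit_W[OF that] that V_I by (simp add: orbit_def act_on_def)
  moreover have "orbits (aut_group \<Gamma>\<lparr>carrier := K\<rparr>) (verts \<Gamma>) (act_on (verts \<Gamma>)) = ?o ` W \<union> ?o ` U"
    by (auto simp: orbits_def verts_eq)
  ultimately show ?thesis by simp
qed

lemma cls_refl: "u \<in> U \<Longrightarrow> u \<in> cls u" by simp

lemma cls_eq_iff: "u \<in> U \<Longrightarrow> cls u = cls v \<longleftrightarrow> N u = N v"
  by auto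

lemma cls_fibre: "u \<in> U \<Longrightarrow> {z \<in> U. cls z = cls u} = cls u"
  using cls_eq_iff by blast

lemma card_\<W>: "card \<W> = p ^ 3"
  using card_W by (simp add: card_image)

lemma card_\<U>: "card \<U> = p ^ 2"
proof -
  have "card U = p * card \<U>"
    by (rule card_equal_fibres[OF finite_parts(2)]) (use cls_fibre U_class_card in auto)
  then show ?thesis using card_U p prime_gt_0_nat[of p] by (simp add: power3_eq_cube power2_eq_square)
qed

lemma \<W>_\<U>_disjoint: "\<W> \<inter> \<U> = {}"
  using disjoint cls_refl by blast

lemma verts_\<Sigma>: "verts \<Sigma> = \<W> \<union> \<U>"
  by (simp add: quotient_graph_def)

lemma edges_\<Sigma>: "edges \<Sigma> = {{{w}, cls u} |w u. w \<in> W \<and> u \<in> U \<and> w \<in> N u}"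
proof
  show "edges \<Sigma> \<subseteq> {{{w}, cls u} |w u. w \<in> W \<and> u \<in> U \<and> w \<in> N u}"
  proof
    fix e assume "e \<in> edges \<Sigma>"
    then obtain B C x y where e: "e = {B, C}" "B \<in> \<W> \<union> \<U>" "C \<in> \<W> \<union> \<U>" "x \<in> B" "y \<in> C" "{x, y} \<in> edges \<Gamma>"
      by (simp only: quotient_graph_def sgraph.simps mem_Collect_eq) blast
    have BC: "(x \<in> W \<and> B = {x}) \<or> (x \<in> U \<and> B = cls x)" "(y \<in> W \<and> C = {y}) \<or> (y \<in> U \<and> C = cls y)"
      using e(2-5) by auto
    then have V: "x \<in> verts \<Gamma>" "y \<in> verts \<Gamma>" using V_I by auto
    have "(x \<in> W \<and> y \<in> U) \<or> (x \<in> U \<and> y \<in> W)"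
      using BC bipartition_no_edge[OF bip] bipartition_no_edge[OF bipartition_sym[OF bip]] e(6) by blast
    then show "e \<in> {{{w}, cls u} |w u. w \<in> W \<and> u \<in> U \<and> w \<in> N u}"
    proof
      assume xy: "x \<in> W \<and> y \<in> U"
      then have "e = {{x}, cls y}" using BC disjoint e(1) by auto
      moreover have "x \<in> N y" using mem_nbhd V e(6) by simp
      ultimately show ?thesis using xy by blast
    next
      assume xy: "x \<in> U \<and> y \<in> W"
      then have "e = {{y}, cls x}" using BC disjoint e(1) by auto
      moreover have "y \<in> N x" using mem_nbhd V e(6) by (simp add: insert_commute)
      ultimately show ?thesis using xy by blast
    qed
  qed
  show "{{{w}, cls u} |w u. w \<in> W \<and> u \<in> U \<and> w \<in> N u} \<subseteq> edges \<Sigma>"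
  proof
    fix e assume "e \<in> {{{w}, cls u} |w u. w \<in> W \<and> u \<in> U \<and> w \<in> N u}"
    then obtain w u where e: "e = {{w}, cls u}" "w \<in> W" "u \<in> U" "w \<in> N u" by blast
    show "e \<in> edges \<Sigma>" unfolding e(1)
    proof (rule quotient_edgeI)
      show "{w} \<noteq> cls u" using \<W>_\<U>_disjoint e by blast
      show "{w, u} \<in> edges \<Gamma>" using e mem_nbhd V_I by simp
    qed (use e in auto)
  qed
qed

text \<open>All members of a class have the same neighborhood, so the choice of \<open>u\<close>
  within its class is immaterial.\<close>

lemma \<Sigma>_edge_iff:
  assumes "w \<in> W" "u \<in> U"
  shows "{{w}, cls u} \<in> edges \<Sigma> \<longleftrightarrow> w \<in> N u"
proof
  assume "{{w}, cls u} \<in> edges \<Sigma>"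
  then obtain w' u' where e: "{{w}, cls u} = {{w'}, cls u'}" "w' \<in> W" "u' \<in> U" "w' \<in> N u'"
    unfolding edges_\<Sigma> by blast
  have "{w} \<noteq> cls u'" using \<W>_\<U>_disjoint assms e by blast
  then have "w = w'" "cls u = cls u'" using e(1) by (auto simp: doubleton_eq_iff)
  then show "w \<in> N u" using e cls_eq_iff assms by simp
qed (use assms edges_\<Sigma> in blast)

lemma bipartition_\<Sigma>: "bipartition \<Sigma> \<W> \<U>"
  unfolding bipartition_def verts_\<Sigma>
proof (intro conjI ballI)
  fix e assume "e \<in> edges \<Sigma>"
  then show "\<exists>w\<in>\<W>. \<exists>u\<in>\<U>. e = {w, u}" unfolding edges_\<Sigma> by blast
qed (use \<W>_\<U>_disjoint in auto)

lemma simple_\<Sigma>: "simple_graph \<Sigma>"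
proof -
  have "e \<subseteq> verts \<Sigma> \<and> card e = 2" if E: "e \<in> edges \<Sigma>" for e
  proof -
    obtain w u where e: "e = {{w}, cls u}" "w \<in> W" "u \<in> U" using E unfolding edges_\<Sigma> by blast
    have "{w} \<noteq> cls u" using \<W>_\<U>_disjoint e by blast
    then show ?thesis using e by (auto simp: verts_\<Sigma>)
  qed
  moreover have "finite (verts \<Sigma>)" using finite_parts by (simp add: verts_\<Sigma>)
  ultimately show ?thesis by (auto simp: simple_graph_def)
qed

lemma connected_\<Sigma>: "connected_graph \<Sigma>"
proof -
  \<comment> \<open>The projection to the quotient; it maps edges to edges, so paths
    descend.\<close>
  define q where "q v = (if v \<in> W then {v} else cls v)" for v
  have qW: "q w = {w}" if "w \<in> W" for w using that by (simp add: q_def)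
  have qU: "q u = cls u" if "u \<in> U" for u using that disjoint by (auto simp: q_def)
  let ?R = "{(a, b). {a, b} \<in> edges \<Gamma>}" and ?S = "{(a, b). {a, b} \<in> edges \<Sigma>}"
  have path: "(q x, q y) \<in> ?S\<^sup>*" if "(x, y) \<in> ?R\<^sup>*" for x y
    using that
  proof (induction rule: rtrancl_induct)
    case (step a b)
    then have "{a, b} \<in> edges \<Gamma>" by simp
    then obtain w u where e: "w \<in> W" "u \<in> U" "{a, b} = {w, u}" by (rule edgeE)
    have "w \<in> N u" using \<open>{a, b} \<in> edges \<Gamma>\<close> e mem_nbhd V_I by simp
    then have "{q w, q u} \<in> edges \<Sigma>" using \<Sigma>_edge_iff e qW qU by simp
    moreover have "{q a, q b} = {q w, q u}" using e(3) by (auto simp: doubleton_eq_iff)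
    ultimately have "(q a, q b) \<in> ?S" by simp
    then show ?case using step(3) by (rule rtrancl_into_rtrancl[rotated])
  qed simp
  have q: "\<exists>v\<in>verts \<Gamma>. B = q v" if "B \<in> \<W> \<union> \<U>" for B
  proof -
    from that consider w where "w \<in> W" "B = {w}" | u where "u \<in> U" "B = cls u" by blast
    then show ?thesis using qW qU V_I by cases (metis, metis)
  qed
  show ?thesis unfolding connected_graph_def verts_\<Sigma>
  proof (intro ballI)
    fix B C assume BC: "B \<in> \<W> \<union> \<U>" "C \<in> \<W> \<union> \<U>"
    obtain x y where xy: "x \<in> verts \<Gamma>" "y \<in> verts \<Gamma>" "B = q x" "C = q y"
      using q[OF BC(1)] q[OF BC(2)] by auto
    then have "(x, y) \<in> ?R\<^sup>*" using connected by (simp add: connected_graph_def)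
    then show "(B, C) \<in> ?S\<^sup>*" using path xy by simp
  qed
qed

lemma aut_cls:
  assumes g: "g \<in> Aut" and u: "u \<in> U"
  shows "g ` cls u = cls (g u)"
proof -
  have "N (g z) = N (g u) \<longleftrightarrow> N z = N u" if "z \<in> U" for z
    using nbhd_aut[OF g] inj_on_image_eq_iff[OF bij_betw_imp_inj_on[OF aut_bij[OF g]] nbhd_subset nbhd_subset]
      V_I that u by simp
  then have "g ` cls u = {z \<in> g ` U. N z = N (g u)}" by blast
  then show ?thesis using aut_U[OF g] by simp
qed

lemma aut_image_\<W>: "g \<in> Aut \<Longrightarrow> B \<in> \<W> \<Longrightarrow> g ` B \<in> \<W>"
  using aut_mem_W by auto

lemma aut_image_\<U>:
  assumes "g \<in> Aut" "B \<in> \<U>"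
  shows "g ` B \<in> \<U>"
proof -
  obtain u where "u \<in> U" "B = cls u" using assms by blast
  then show ?thesis using aut_cls[OF assms(1)] aut_mem_U[OF assms(1)] by simp
qed

text \<open>The homomorphism behind \<open>A Mod K \<cong> aut_group \<Sigma>\<close>: it is onto
  and has kernel \<open>K\<close>.\<close>

definition \<rho> :: "('a \<Rightarrow> 'a) \<Rightarrow> 'a set \<Rightarrow> 'a set" where
  "\<rho> g = (\<lambda>B\<in>\<W> \<union> \<U>. g ` B)"

lemma \<rho>_W: "w \<in> W \<Longrightarrow> \<rho> g {w} = {g w}"
  by (simp add: \<rho>_def)

lemma \<rho>_U: "g \<in> Aut \<Longrightarrow> u \<in> U \<Longrightarrow> \<rho> g (cls u) = cls (g u)"
  using aut_cls[of g u] by (simp add: \<rho>_def)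

lemma block_subset: "B \<in> \<W> \<union> \<U> \<Longrightarrow> B \<subseteq> verts \<Gamma>"
  using verts_eq by auto

lemma image_bij_blocks:
  assumes g: "g \<in> Aut" and P: "P \<subseteq> \<W> \<union> \<U>" "\<And>B. B \<in> P \<Longrightarrow> g ` B \<in> P"
  shows "bij_betw ((`) g) P P"
proof (rule finite_inj_on_endo_bij)
  show "finite P" using P(1) finite_parts by (auto intro: finite_subset)
  show "inj_on ((`) g) P"
    by (rule inj_on_subset[OF inj_on_image_Pow[OF bij_betw_imp_inj_on[OF aut_bij[OF g]]]])
      (use P(1) block_subset in blast)
qed (use P in auto)

lemma \<rho>_aut:
  assumes g: "g \<in> Aut"
  shows "\<rho> g \<in> carrier (aut_group \<Sigma>)"
proof -
  have "graph_iso \<Sigma> \<Sigma> ((`) g)"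
  proof (rule bipartite_graph_isoI[OF bipartition_\<Sigma> bipartition_\<Sigma>])
    show "bij_betw ((`) g) \<W> \<W>" by (rule image_bij_blocks[OF g]) (use aut_image_\<W>[OF g] in auto)
    show "bij_betw ((`) g) \<U> \<U>" by (rule image_bij_blocks[OF g]) (use aut_image_\<U>[OF g] in auto)
    fix B C assume "B \<in> \<W>" "C \<in> \<U>"
    then obtain w u where wu: "w \<in> W" "B = {w}" "u \<in> U" "C = cls u" by blast
    have "g w \<in> N (g u) \<longleftrightarrow> w \<in> N u"
      using mem_nbhd aut_edge[OF g] aut_mem[OF g] V_I wu by simp
    then show "{B, C} \<in> edges \<Sigma> \<longleftrightarrow> {g ` B, g ` C} \<in> edges \<Sigma>"
      using \<Sigma>_edge_iff aut_mem_W[OF g] aut_mem_U[OF g] aut_cls[OF g] wu by simp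
  qed
  from restrict_aut[OF this] show ?thesis by (simp add: \<rho>_def verts_\<Sigma>)
qed

text \<open>For \<open>w\<close> in \<open>W\<close> the set \<open>N w\<close> is a union of twin
  classes, so \<open>g\<close> maps it into itself. Equal degrees give \<open>N (g w) = N w\<close>,
  and \<open>W\<close> has no twins.\<close>

lemma fixes_classes_in_K:
  assumes g: "g \<in> Aut" and fx: "\<And>B. B \<in> \<U> \<Longrightarrow> g ` B = B"
  shows "g \<in> K"
proof -
  have "g w = w" if w: "w \<in> W" for w
  proof (rule inj_onD[OF inj_nbhd_W])
    have *: "g z \<in> N w \<longleftrightarrow> z \<in> N w" if z: "z \<in> U" for z
    proof -
      have "g z \<in> g ` cls z" using z by blast
      then have "g z \<in> cls z" using fx z by simp
      then have "N (g z) = N z" by simp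
      then show ?thesis using nbhd_sym V_I w z aut_mem_U[OF g z] by metis
    qed
    have "N (g w) = g ` N w" using nbhd_aut[OF g] V_I w by simp
    also have "\<dots> \<subseteq> N w" using * nbhd_W[OF w] by blast
    finally have "N (g w) \<subseteq> N w" .
    moreover have "card (N (g w)) = card (N w)" using degree V_I w aut_mem_W[OF g w] by simp
    moreover have "finite (N w)" using finite_subset[OF nbhd_W[OF w] finite_parts(2)] .
    ultimately show "N (g w) = N w" using card_subset_eq by blast
  qed (use aut_mem_W[OF g w] w in auto)
  then show ?thesis using g by (simp add: K_iff)
qed

lemma K_fixes_blocks:
  assumes k: "k \<in> K" and B: "B \<in> \<W> \<union> \<U>"
  shows "k ` B = B"
proof -
  have kA: "k \<in> Aut" using k by (simp add: K_iff)
  from B consider w where "w \<in> W" "B = {w}" | u where "u \<in> U" "B = cls u" by blast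
  then show ?thesis
  proof cases
    case 1
    then show ?thesis using k by (simp add: K_iff)
  next
    case 2
    then show ?thesis using aut_cls[OF kA] K_nbhd[OF k] by simp
  qed
qed

lemma \<rho>_hom: "group_hom (aut_group \<Gamma>) (aut_group \<Sigma>) \<rho>"
proof -
  interpret A: group "aut_group \<Gamma>" by (rule group_aut)
  interpret S: group "aut_group \<Sigma>" by (rule group_aut)
  show ?thesis
  proof unfold_locales
    show "\<rho> \<in> hom (aut_group \<Gamma>) (aut_group \<Sigma>)"
    proof (rule homI)
      fix g h assume gh: "g \<in> Aut" "h \<in> Aut"
      have "\<rho> (g \<otimes>\<^bsub>aut_group \<Gamma>\<^esub> h) = compose (\<W> \<union> \<U>) (\<rho> g) (\<rho> h)"
      proof (rule extensionalityI[of _ "\<W> \<union> \<U>"])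
        fix B assume B: "B \<in> \<W> \<union> \<U>"
        then have "h ` B \<in> \<W> \<union> \<U>" using aut_image_\<W>[OF gh(2)] aut_image_\<U>[OF gh(2)] by blast
        then show "\<rho> (g \<otimes>\<^bsub>aut_group \<Gamma>\<^esub> h) B = compose (\<W> \<union> \<U>) (\<rho> g) (\<rho> h) B"
          using B aut_mult_image[OF gh block_subset[OF B]] by (simp add: compose_eq \<rho>_def)
      qed (simp_all add: \<rho>_def compose_def)
      then show "\<rho> (g \<otimes>\<^bsub>aut_group \<Gamma>\<^esub> h) = \<rho> g \<otimes>\<^bsub>aut_group \<Sigma>\<^esub> \<rho> h"
        using mult_aut[OF \<rho>_aut[OF gh(1)] \<rho>_aut[OF gh(2)]] by (simp add: verts_\<Sigma>)
    qed (rule \<rho>_aut)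
  qed
qed

lemma kernel_\<rho>: "kernel (aut_group \<Gamma>) (aut_group \<Sigma>) \<rho> = K"
proof -
  have "\<rho> g = \<one>\<^bsub>aut_group \<Sigma>\<^esub> \<longleftrightarrow> g \<in> K" if g: "g \<in> Aut" for g
  proof
    assume e: "\<rho> g = \<one>\<^bsub>aut_group \<Sigma>\<^esub>"
    have "g ` B = B" if "B \<in> \<U>" for B
      using fun_cong[OF e, of B] that by (simp add: \<rho>_def one_aut verts_\<Sigma>)
    then show "g \<in> K" using fixes_classes_in_K g by blast
  next
    assume "g \<in> K"
    then show "\<rho> g = \<one>\<^bsub>aut_group \<Sigma>\<^esub>"
      unfolding one_aut verts_\<Sigma> \<rho>_def using K_fixes_blocks by (intro restrict_ext) simp
  qed
  then show ?thesis by (auto simp: kernel_def K_iff)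
qed

text \<open>\<open>N w\<close> is a union of classes of size \<open>p\<close>, so \<open>{w}\<close>
  has \<open>d / p\<close> neighbors in the quotient, against \<open>d\<close> for a class. The
  parts of \<open>\<Sigma>\<close> are thus told apart by degree.\<close>

lemma nbhd_\<Sigma>_W:
  assumes w: "w \<in> W"
  shows "d = p * card (nbhd \<Sigma> {w})"
proof -
  have "nbhd \<Sigma> {w} = (\<lambda>u. cls u) ` N w"
  proof
    show "nbhd \<Sigma> {w} \<subseteq> (\<lambda>u. cls u) ` N w"
    proof
      fix B assume B: "B \<in> nbhd \<Sigma> {w}"
      then have e: "{{w}, B} \<in> edges \<Sigma>" "B \<in> \<W> \<union> \<U>" by (auto simp: in_nbhd_iff[of _ \<Sigma>] verts_\<Sigma>)
      then have "B \<in> \<U>" using bipartition_no_edge[OF bipartition_\<Sigma>, of "{w}" B] w by blast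
      then obtain u where "u \<in> U" "B = cls u" by blast
      then show "B \<in> (\<lambda>u. cls u) ` N w" using e \<Sigma>_edge_iff w nbhd_sym[of w u] V_I by blast
    qed
    show "(\<lambda>u. cls u) ` N w \<subseteq> nbhd \<Sigma> {w}"
    proof
      fix B assume "B \<in> (\<lambda>u. cls u) ` N w"
      then obtain u where u: "u \<in> N w" "B = cls u" by blast
      then have "u \<in> U" using nbhd_W w by blast
      then show "B \<in> nbhd \<Sigma> {w}"
        using u \<Sigma>_edge_iff[OF w] nbhd_sym[of w u] V_I w by (simp add: in_nbhd_iff[of _ \<Sigma>] verts_\<Sigma>)
    qed
  qed
  moreover have "card (N w) = p * card ((\<lambda>u. cls u) ` N w)"
  proof (rule card_equal_fibres)
    show "finite (N w)" using finite_subset[OF nbhd_W[OF w] finite_parts(2)] .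
    fix B assume "B \<in> (\<lambda>u. cls u) ` N w"
    then obtain u where u: "u \<in> N w" "B = cls u" by blast
    then have uU: "u \<in> U" using nbhd_W w by blast
    have "z \<in> N w" if "z \<in> cls u" for z
    proof -
      have "w \<in> N u" using nbhd_sym[of w u] V_I w uU u(1) by blast
      then have "w \<in> N z" using that by simp
      then show ?thesis using nbhd_sym[of w z] V_I w that by blast
    qed
    then have "{z \<in> N w. cls z = B} = cls u"
      using u cls_fibre[OF uU] nbhd_W[OF w] by blast
    then show "card {z \<in> N w. cls z = B} = p" using U_class_card[OF uU] by simp
  qed
  ultimately show ?thesis using degree V_I w by simp
qed

lemma nbhd_\<Sigma>_U:
  assumes u: "u \<in> U"
  shows "card (nbhd \<Sigma> (cls u)) = d"
proof -
  have "nbhd \<Sigma> (cls u) = (\<lambda>w. {w}) ` N u"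
  proof
    show "nbhd \<Sigma> (cls u) \<subseteq> (\<lambda>w. {w}) ` N u"
    proof
      fix B assume B: "B \<in> nbhd \<Sigma> (cls u)"
      then have e: "{B, cls u} \<in> edges \<Sigma>" "B \<in> \<W> \<union> \<U>" by (auto simp: in_nbhd_iff[of _ \<Sigma>] verts_\<Sigma> insert_commute)
      then have "B \<in> \<W>" using bipartition_no_edge[OF bipartition_sym[OF bipartition_\<Sigma>], of B "cls u"] u by blast
      then obtain w where "w \<in> W" "B = {w}" by blast
      then show "B \<in> (\<lambda>w. {w}) ` N u" using e \<Sigma>_edge_iff u by blast
    qed
    show "(\<lambda>w. {w}) ` N u \<subseteq> nbhd \<Sigma> (cls u)"
    proof
      fix B assume "B \<in> (\<lambda>w. {w}) ` N u"
      then obtain w where w: "w \<in> N u" "B = {w}" by blast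
      then have "w \<in> W" using nbhd_U u by blast
      then show "B \<in> nbhd \<Sigma> (cls u)"
        using w \<Sigma>_edge_iff[OF _ u] by (simp add: in_nbhd_iff[of _ \<Sigma>] verts_\<Sigma> insert_commute)
    qed
  qed
  then show ?thesis using degree V_I u by (simp add: card_image)
qed

text \<open>Automorphisms preserve degrees; if \<open>{w}\<close> went to a class, then
  \<open>d = p * d\<close>, impossible for \<open>d > 0\<close>.\<close>

lemma \<Sigma>_aut_\<W>:
  assumes s: "s \<in> carrier (aut_group \<Sigma>)" and w: "w \<in> W"
  shows "s {w} \<in> \<W>"
proof (rule ccontr)
  assume "s {w} \<notin> \<W>"
  have wV: "{w} \<in> verts \<Sigma>" using w by (simp add: verts_\<Sigma>)
  then have "s {w} \<in> \<U>" using aut_mem[OF s wV] \<open>s {w} \<notin> \<W>\<close> by (simp add: verts_\<Sigma>)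
  then have "card (nbhd \<Sigma> (s {w})) = d" using nbhd_\<Sigma>_U by auto
  moreover have "card (nbhd \<Sigma> (s {w})) = card (nbhd \<Sigma> {w})"
    unfolding nbhd_aut[OF s wV]
    by (rule card_image) (rule inj_on_subset[OF bij_betw_imp_inj_on[OF aut_bij[OF s]] nbhd_subset])
  ultimately have "d = p * d" using nbhd_\<Sigma>_W[OF w] by simp
  then show False using degree_pos prime_gt_1_nat[OF p] by simp
qed

lemma \<Sigma>_aut_bij:
  assumes s: "s \<in> carrier (aut_group \<Sigma>)"
  shows "bij_betw s \<W> \<W>" "bij_betw s \<U> \<U>"
proof -
  have inj: "inj_on s (\<W> \<union> \<U>)" using aut_bij[OF s] by (simp add: bij_betw_def verts_\<Sigma>)
  show W: "bij_betw s \<W> \<W>"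
    by (rule finite_inj_on_endo_bij) (use finite_parts \<Sigma>_aut_\<W>[OF s] inj in \<open>auto intro: inj_on_subset\<close>)
  have "s C \<in> \<U>" if C: "C \<in> \<U>" for C
  proof (rule ccontr)
    assume "s C \<notin> \<U>"
    then have "s C \<in> \<W>" using aut_mem[OF s, of C] C by (simp add: verts_\<Sigma>)
    then obtain B where B: "B \<in> \<W>" "s C = s B" using W by (metis bij_betw_def imageE)
    then have "B = C" using inj_onD[OF inj, of B C] C by simp
    then show False using B C \<W>_\<U>_disjoint by blast
  qed
  then show "bij_betw s \<U> \<U>"
    by (intro finite_inj_on_endo_bij) (use finite_parts inj in \<open>auto intro: inj_on_subset\<close>)
qed

text \<open>All classes have size \<open>p\<close>, so an automorphism of \<open>\<Sigma>\<close>
  lifts class by class to \<open>U\<close>; on \<open>W\<close> it is read off the singletons. Any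
  such lift preserves adjacency, which depends on classes only.\<close>

lemma \<rho>_surj: "\<rho> ` Aut = carrier (aut_group \<Sigma>)"
proof
  show "\<rho> ` Aut \<subseteq> carrier (aut_group \<Sigma>)" using \<rho>_aut by blast
  show "carrier (aut_group \<Sigma>) \<subseteq> \<rho> ` Aut"
  proof
    fix s assume s: "s \<in> carrier (aut_group \<Sigma>)"
    obtain \<theta> where \<theta>: "bij_betw \<theta> U U" "\<And>u. u \<in> U \<Longrightarrow> cls (\<theta> u) = s (cls u)"
    proof (rule fibrewise_bijection[OF finite_parts(2,2) \<Sigma>_aut_bij(2)[OF s]])
      fix u assume u: "u \<in> U"
      have "s (cls u) \<in> \<U>" using \<Sigma>_aut_bij(2)[OF s] u by (meson bij_betw_apply imageI)
      then obtain v where "v \<in> U" "s (cls u) = cls v" by blast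
      then show "card {y \<in> U. cls y = cls u} = card {y \<in> U. cls y = s (cls u)}"
        using cls_fibre U_class_card u by simp
    qed (blast intro: that)
    define \<eta> where "\<eta> w = the_elem (s {w})" for w
    have \<eta>: "s {w} = {\<eta> w}" "\<eta> w \<in> W" if w: "w \<in> W" for w
    proof -
      obtain x where "x \<in> W" "s {w} = {x}" using \<Sigma>_aut_\<W>[OF s w] by blast
      then show "s {w} = {\<eta> w}" "\<eta> w \<in> W" by (simp_all add: \<eta>_def)
    qed
    define f where "f v = (if v \<in> W then \<eta> v else \<theta> v)" for v
    have fW: "f w = \<eta> w" if "w \<in> W" for w using that by (simp add: f_def)
    have fU: "f u = \<theta> u" if "u \<in> U" for u using that disjoint by (auto simp: f_def)
    have "graph_iso \<Gamma> \<Gamma> f"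
    proof (rule bipartite_graph_isoI[OF bip bip])
      have "inj_on \<eta> W"
      proof (rule inj_onI)
        fix x y assume xy: "x \<in> W" "y \<in> W" "\<eta> x = \<eta> y"
        then have "s {x} = s {y}" using \<eta> by simp
        then show "x = y" using \<Sigma>_aut_bij(1)[OF s] xy by (auto simp: bij_betw_def dest: inj_onD)
      qed
      then have "bij_betw \<eta> W W" by (rule finite_inj_on_endo_bij[OF finite_parts(1)]) (rule \<eta>)
      then show "bij_betw f W W" using fW by (simp cong: bij_betw_cong)
      show "bij_betw f U U" using \<theta>(1) fU by (simp cong: bij_betw_cong)
      fix w u assume wu: "w \<in> W" "u \<in> U"
      have \<theta>u: "\<theta> u \<in> U" using \<theta>(1) wu bij_betw_apply by metis
      have "{w, u} \<in> edges \<Gamma> \<longleftrightarrow> {{w}, cls u} \<in> edges \<Sigma>" using mem_nbhd \<Sigma>_edge_iff wu V_I by simp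
      also have "\<dots> \<longleftrightarrow> {s {w}, s (cls u)} \<in> edges \<Sigma>"
        using aut_edge[OF s, of "{w}" "cls u"] wu by (simp add: verts_\<Sigma>)
      also have "\<dots> \<longleftrightarrow> {\<eta> w, \<theta> u} \<in> edges \<Gamma>"
        using \<Sigma>_edge_iff[OF \<eta>(2)[OF wu(1)] \<theta>u] \<eta>[OF wu(1)] \<theta>(2)[OF wu(2)] mem_nbhd V_I \<theta>u by simp
      finally show "{w, u} \<in> edges \<Gamma> \<longleftrightarrow> {f w, f u} \<in> edges \<Gamma>" using fW fU wu by simp
    qed
    then have g: "restrict f (verts \<Gamma>) \<in> Aut" by (rule restrict_aut)
    have "\<rho> (restrict f (verts \<Gamma>)) = s"
    proof (rule aut_eqI[OF \<rho>_aut[OF g] s])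
      fix B assume "B \<in> verts \<Sigma>"
      then consider w where "w \<in> W" "B = {w}" | u where "u \<in> U" "B = cls u" by (auto simp: verts_\<Sigma>)
      then show "\<rho> (restrict f (verts \<Gamma>)) B = s B"
      proof cases
        case 1
        then show ?thesis using \<rho>_W \<eta> fW V_I by simp
      next
        case 2
        then show ?thesis using \<rho>_U[OF g] \<theta> fU V_I by simp
      qed
    qed
    then show "s \<in> \<rho> ` Aut" using g by blast
  qed
qed

lemma aut_quotient_iso: "aut_group \<Gamma> Mod K \<cong> aut_group \<Sigma>"
  using group_hom.FactGroup_iso[OF \<rho>_hom \<rho>_surj] by (simp add: kernel_\<rho>)

lemma normal_K: "K \<lhd> aut_group \<Gamma>"
  using group_hom.normal_kernel[OF \<rho>_hom] by (simp add: kernel_\<rho>)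

subsection \<open>The expanded graph and the induced actions\<close>

lemma edge_transitive_\<Sigma>: "edge_transitive \<Sigma>"
  unfolding edge_transitive_def
proof (intro ballI)
  fix e f assume "e \<in> edges \<Sigma>" "f \<in> edges \<Sigma>"
  then obtain w u w' u' where e: "e = {{w}, cls u}" "w \<in> W" "u \<in> U" "w \<in> N u"
    and f: "f = {{w'}, cls u'}" "w' \<in> W" "u' \<in> U" "w' \<in> N u'"
    unfolding edges_\<Sigma> by blast
  have "{w, u} \<in> edges \<Gamma>" "{w', u'} \<in> edges \<Gamma>" using e f mem_nbhd V_I by auto
  then obtain g where g: "g \<in> Aut" "g ` {w, u} = {w', u'}"
    using edge_trans by (meson edge_transitive_def)
  have "g w \<in> W" "g u \<in> U" using aut_mem_W aut_mem_U g e by auto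
  then have gw: "g w = w'" "g u = u'" using g(2) f disjoint by (auto simp: doubleton_eq_iff)
  have "\<rho> g ` e = f"
    unfolding e(1) f(1) using \<rho>_W[OF e(2)] \<rho>_U[OF g(1) e(3)] gw by simp
  then show "\<exists>g\<in>carrier (aut_group \<Sigma>). g ` e = f" using \<rho>_aut[OF g(1)] by blast
qed

lemma expandable_\<Sigma>: "expandable p \<Sigma> \<W> \<U>"
proof -
  have b: "\<rho> g ` \<W> = \<W> \<and> \<rho> g ` \<U> = \<U>" if "g \<in> Aut" for g
    using \<Sigma>_aut_bij[OF \<rho>_aut[OF that]] by (simp add: bij_betw_def)
  have "\<exists>s\<in>carrier (aut_group \<Sigma>). s ` \<W> = \<W> \<and> s ` \<U> = \<U> \<and> s B = C"
    if BC: "B \<in> \<W>" "C \<in> \<W>" for B C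
  proof -
    obtain x y where xy: "x \<in> W" "y \<in> W" "B = {x}" "C = {y}" using BC by blast
    obtain g where g: "g \<in> Aut" "g x = y" using trans_W xy by blast
    have "\<rho> g B = C" using \<rho>_W[OF xy(1)] xy g(2) by simp
    then show ?thesis using b[OF g(1)] by (intro bexI[OF _ \<rho>_aut[OF g(1)]] conjI) (simp_all only:)
  qed
  moreover have "\<exists>s\<in>carrier (aut_group \<Sigma>). s ` \<W> = \<W> \<and> s ` \<U> = \<U> \<and> s B = C"
    if BC: "B \<in> \<U>" "C \<in> \<U>" for B C
  proof -
    obtain x y where xy: "x \<in> U" "y \<in> U" "B = cls x" "C = cls y" using BC by blast
    obtain g where g: "g \<in> Aut" "g x = y" using trans_U xy by blast
    have "\<rho> g B = C" using \<rho>_U[OF g(1) xy(1)] xy g(2) by simp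
    then show ?thesis using b[OF g(1)] by (intro bexI[OF _ \<rho>_aut[OF g(1)]] conjI) (simp_all only:)
  qed
  ultimately show ?thesis
    unfolding expandable_def
    using simple_\<Sigma> connected_\<Sigma> bipartition_\<Sigma> card_\<W> card_\<U> edge_transitive_\<Sigma>
    by (intro conjI ballI)
qed

lemma expanded_from_\<Sigma>: "expanded_from p \<Gamma> W \<Sigma> \<W> \<U>"
proof -
  have p0: "p > 0" using p by (rule prime_gt_0_nat)
  have fst: "fst ` (\<U> \<times> {0..<p}) = \<U>" using p0 by (auto simp: image_iff)
  \<comment> \<open>With the identity on classes as index map, \<open>fibrewise_bijection\<close>
    numbers the \<open>p\<close> members of each class by \<open>{0..<p}\<close>.\<close>
  have "bij_betw (\<lambda>B. B) \<U> (fst ` (\<U> \<times> {0..<p}))" unfolding fst by (simp add: bij_betw_def)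
  then obtain \<theta> where \<theta>: "bij_betw \<theta> U (\<U> \<times> {0..<p})" "\<And>u. u \<in> U \<Longrightarrow> fst (\<theta> u) = cls u"
  proof (rule fibrewise_bijection[rotated 2])
    fix u assume u: "u \<in> U"
    have "{y \<in> \<U> \<times> {0..<p}. fst y = cls u} = {cls u} \<times> {0..<p}"
      by (rule fst_fibre) (use u in blast)
    then show "card {y \<in> U. cls y = cls u} = card {y \<in> \<U> \<times> {0..<p}. fst y = cls u}"
      using cls_fibre[OF u] U_class_card[OF u] by (simp add: card_cartesian_product)
  qed (use finite_parts in \<open>auto intro: that\<close>)
  define f where "f v = (if v \<in> W then Inl {v} else Inr (\<theta> v))" for v
  have fW: "f w = Inl {w}" if "w \<in> W" for w using that by (simp add: f_def)
  have fU: "f u = Inr (\<theta> u)" if "u \<in> U" for u using that disjoint by (auto simp: f_def)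
  have \<theta>': "\<exists>i<p. \<theta> u = (cls u, i)" if u: "u \<in> U" for u
  proof -
    have "\<theta> u \<in> \<U> \<times> {0..<p}" using \<theta>(1) u by (rule bij_betw_apply)
    then show ?thesis using \<theta>(2)[OF u] by (cases "\<theta> u") auto
  qed
  have "graph_iso \<Gamma> (expanded_graph p \<Sigma> \<W> \<U>) f"
  proof (rule bipartite_graph_isoI[OF bip bipartition_expanded_graph])
    show "bij_betw f W (Inl ` \<W>)"
      using fW by (auto simp: bij_betw_def inj_on_def image_image)
    have "bij_betw (Inr \<circ> \<theta>) U (Inr ` (\<U> \<times> {0..<p}) :: ('a set + 'a set \<times> nat) set)"
      by (rule bij_betw_trans[OF \<theta>(1)]) (simp add: bij_betw_def)
    then show "bij_betw f U (Inr ` (\<U> \<times> {0..<p}))"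
      using fU by (simp cong: bij_betw_cong add: comp_def)
    fix w u assume wu: "w \<in> W" "u \<in> U"
    obtain i where i: "i < p" "\<theta> u = (cls u, i)" using \<theta>' wu by blast
    have "{f w, f u} \<in> edges (expanded_graph p \<Sigma> \<W> \<U>) \<longleftrightarrow> {{w}, cls u} \<in> edges \<Sigma>"
      unfolding fW[OF wu(1)] fU[OF wu(2)] i(2) by (rule expanded_edge_iff) (use wu i in auto)
    then show "{w, u} \<in> edges \<Gamma> \<longleftrightarrow> {f w, f u} \<in> edges (expanded_graph p \<Sigma> \<W> \<U>)"
      using \<Sigma>_edge_iff wu mem_nbhd V_I by simp
  qed
  moreover have "f ` B = Inr ` ({B} \<times> {0..<p})" if B: "B \<in> \<U>" for B
  proof -
    have "\<theta> ` B = {B} \<times> {0..<p}"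
    proof
      obtain u where u: "u \<in> U" "B = cls u" using B by blast
      show "\<theta> ` B \<subseteq> {B} \<times> {0..<p}"
      proof
        fix x assume "x \<in> \<theta> ` B"
        then obtain z where z: "z \<in> B" "x = \<theta> z" by blast
        then have "z \<in> U" "cls z = B" using u cls_eq_iff by auto
        then show "x \<in> {B} \<times> {0..<p}" using \<theta>' z by force
      qed
      show "{B} \<times> {0..<p} \<subseteq> \<theta> ` B"
      proof
        fix x assume x: "x \<in> {B} \<times> {0..<p}"
        then have "x \<in> \<theta> ` U" using \<theta>(1) B by (auto simp: bij_betw_def)
        then obtain z where z: "z \<in> U" "x = \<theta> z" by blast
        then have "cls z = B" using x \<theta>(2)[OF z(1)] by auto
        then show "x \<in> \<theta> ` B" using z cls_refl by blast
      qed
    qed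
    moreover have "B \<subseteq> U" using B by auto
    then have "f ` B = Inr ` \<theta> ` B" unfolding image_image using fU by (intro image_cong) auto
    ultimately show ?thesis by simp
  qed
  ultimately show ?thesis
    unfolding expanded_from_def using expandable_\<Sigma> fW by blast
qed

section \<open>The kernel as a direct product of symmetric groups\<close>

lemma K_iso: "aut_group \<Gamma>\<lparr>carrier := K\<rparr> \<cong> product_group {..<p ^ 2} (\<lambda>_. sym_group p)"
proof -
  \<comment> \<open>\<open>?I\<close> numbers the classes and \<open>?J\<close> the positions in a
    class; \<open>?J\<close> starts at 1 because \<open>sym_group p\<close> permutes
    \<open>{1..p}\<close>.\<close>
  let ?I = "{..<p ^ 2}" and ?J = "{1..p}"
  let ?T = "?I \<times> ?J"
  have p0: "p > 0" using p by (rule prime_gt_0_nat)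
  have "card \<U> = card ?I" using card_\<U> by simp
  then obtain \<sigma> where \<sigma>: "bij_betw \<sigma> \<U> ?I"
    using finite_same_card_bij[of \<U> ?I] finite_parts by auto
  have fst: "fst ` ?T = ?I" using p0 by (force simp: image_iff)
  obtain c where c: "bij_betw c U ?T" "\<And>u. u \<in> U \<Longrightarrow> fst (c u) = \<sigma> (cls u)"
  proof (rule fibrewise_bijection[OF finite_parts(2)])
    show "bij_betw \<sigma> \<U> (fst ` ?T)" using \<sigma> fst by simp
    fix u assume u: "u \<in> U"
    have "\<sigma> (cls u) \<in> ?I" using \<sigma> u by (meson bij_betw_apply imageI)
    then have "{y \<in> ?T. fst y = \<sigma> (cls u)} = {\<sigma> (cls u)} \<times> ?J" by auto
    then show "card {y \<in> U. cls y = cls u} = card {y \<in> ?T. fst y = \<sigma> (cls u)}"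
      using cls_fibre[OF u] U_class_card[OF u] by (simp add: card_cartesian_product)
  qed (auto intro: that)
  have cls_fst: "fst (c u) = fst (c v) \<longleftrightarrow> N u = N v" if "u \<in> U" "v \<in> U" for u v
  proof -
    have "\<sigma> (cls u) = \<sigma> (cls v) \<longleftrightarrow> cls u = cls v"
      by (rule inj_on_eq_iff[OF bij_betw_imp_inj_on[OF \<sigma>]]) (use that in blast)+
    then show ?thesis using c(2) that cls_eq_iff by simp
  qed
  define c' where "c' = inv_into U c"
  have c'c: "c' (c u) = u" if "u \<in> U" for u
    using c(1) that by (simp add: c'_def bij_betw_inv_into_left)
  have cc': "c (c' x) = x" if "x \<in> ?T" for x
    using c(1) that by (simp add: c'_def bij_betw_inv_into_right)
  have c'U: "c' x \<in> U" if "x \<in> ?T" for x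
    using bij_betw_inv_into[OF c(1)] that unfolding c'_def by (rule bij_betw_apply)
  have cT: "c u \<in> ?T" if "u \<in> U" for u using c(1) that by (rule bij_betw_apply)
  have KA: "g \<in> Aut" if "g \<in> K" for g using that by (simp add: K_iff)
  have KU: "g u \<in> U" if "g \<in> K" "u \<in> U" for g u using aut_mem_U[OF KA] that by blast
  \<comment> \<open>\<open>\<Phi> g i\<close> is the permutation of positions that \<open>g\<close>
    induces in class \<open>i\<close>. It is the identity off \<open>?J\<close>, as
    \<open>permutes\<close> demands.\<close>
  define \<Phi> where "\<Phi> g = (\<lambda>i\<in>?I. \<lambda>n. if n \<in> ?J then snd (c (g (c' (i, n)))) else n)" for g
  \<comment> \<open>Elements of the kernel preserve neighborhoods of vertices of \<open>U\<close>,
    hence classes, hence the first coordinate.\<close>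
  have key: "c (g (c' (i, n))) = (i, \<Phi> g i n)" if g: "g \<in> K" and i: "i \<in> ?I" "n \<in> ?J" for g i n
  proof -
    have x: "(i, n) \<in> ?T" using i by simp
    have "fst (c (g (c' (i, n)))) = i"
      using cls_fst[OF KU[OF g c'U[OF x]] c'U[OF x]] K_nbhd[OF g c'U[OF x]] cc'[OF x] by simp
    then show ?thesis using i by (simp add: \<Phi>_def prod_eq_iff)
  qed
  have \<Phi>J: "\<Phi> g i n \<in> ?J" if "g \<in> K" "i \<in> ?I" "n \<in> ?J" for g i n
  proof -
    have "c (g (c' (i, n))) \<in> ?T" using cT KU c'U that by simp
    then show ?thesis using key[OF that] by simp
  qed
  have perm: "\<Phi> g i permutes ?J" if g: "g \<in> K" and i: "i \<in> ?I" for g i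
  proof (rule bij_imp_permutes)
    show "bij_betw (\<Phi> g i) ?J ?J"
    proof (rule finite_inj_on_endo_bij)
      show "inj_on (\<Phi> g i) ?J"
      proof (rule inj_onI)
        fix m n assume mn: "m \<in> ?J" "n \<in> ?J" "\<Phi> g i m = \<Phi> g i n"
        then have "c (g (c' (i, m))) = c (g (c' (i, n)))" using key[OF g i] by simp
        then have "g (c' (i, m)) = g (c' (i, n))" using c'c KU[OF g] c'U mn i by (metis SigmaI)
        then have "c' (i, m) = c' (i, n)" using aut_eq_iff[OF KA[OF g]] V_I c'U mn i by simp
        then have "(i, m) = (i, n)" using cc' mn i by (metis SigmaI)
        then show "m = n" by simp
      qed
    qed (use \<Phi>J[OF g i] in auto)
    show "\<Phi> g i n = n" if "n \<notin> ?J" for n using that i by (simp add: \<Phi>_def del: atLeastAtMost_iff)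
  qed
  have closed: "\<Phi> g \<in> carrier (product_group ?I (\<lambda>_. sym_group p))"
    if "g \<in> carrier (aut_group \<Gamma>\<lparr>carrier := K\<rparr>)" for g
    using perm that by (auto simp: sym_group_carrier PiE_def) (simp add: \<Phi>_def)
  have "\<Phi> \<in> iso (aut_group \<Gamma>\<lparr>carrier := K\<rparr>) (product_group ?I (\<lambda>_. sym_group p))"
  proof (rule isoI)
    show "\<Phi> \<in> hom (aut_group \<Gamma>\<lparr>carrier := K\<rparr>) (product_group ?I (\<lambda>_. sym_group p))"
    proof (rule homI)
      show "\<Phi> g \<in> carrier (product_group ?I (\<lambda>_. sym_group p))"
        if "g \<in> carrier (aut_group \<Gamma>\<lparr>carrier := K\<rparr>)" for g
        by (rule closed[OF that])
      fix g h assume "g \<in> carrier (aut_group \<Gamma>\<lparr>carrier := K\<rparr>)" "h \<in> carrier (aut_group \<Gamma>\<lparr>carrier := K\<rparr>)"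
      then have g: "g \<in> K" and h: "h \<in> K" by auto
      have "\<Phi> (g \<otimes>\<^bsub>aut_group \<Gamma>\<^esub> h) = (\<lambda>i\<in>?I. \<Phi> g i \<circ> \<Phi> h i)"
      proof (rule extensionalityI[of _ ?I])
        fix i assume i: "i \<in> ?I"
        have "\<Phi> (g \<otimes>\<^bsub>aut_group \<Gamma>\<^esub> h) i n = \<Phi> g i (\<Phi> h i n)" for n
        proof (cases "n \<in> ?J")
          case True
          then have x: "(i, n) \<in> ?T" using i by simp
          have "\<Phi> (g \<otimes>\<^bsub>aut_group \<Gamma>\<^esub> h) i n = snd (c ((g \<otimes>\<^bsub>aut_group \<Gamma>\<^esub> h) (c' (i, n))))"
            using i True by (simp add: \<Phi>_def)
          also have "(g \<otimes>\<^bsub>aut_group \<Gamma>\<^esub> h) (c' (i, n)) = g (h (c' (i, n)))"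
            using mult_aut[OF KA[OF g] KA[OF h]] V_I c'U[OF x] by (simp add: compose_eq)
          also have "h (c' (i, n)) = c' (i, \<Phi> h i n)"
            using key[OF h i True] c'c[OF KU[OF h c'U[OF x]]] by simp
          also have "snd (c (g (c' (i, \<Phi> h i n)))) = \<Phi> g i (\<Phi> h i n)"
            using key[OF g i \<Phi>J[OF h i True]] by simp
          finally show ?thesis .
        next
          case False
          then show ?thesis using i by (simp add: \<Phi>_def del: atLeastAtMost_iff)
        qed
        then show "\<Phi> (g \<otimes>\<^bsub>aut_group \<Gamma>\<^esub> h) i = (\<lambda>i\<in>?I. \<Phi> g i \<circ> \<Phi> h i) i"
          using i by (simp add: fun_eq_iff)
      qed (simp_all add: \<Phi>_def)
      then show "\<Phi> (g \<otimes>\<^bsub>aut_group \<Gamma>\<lparr>carrier := K\<rparr>\<^esub> h) = \<Phi> g \<otimes>\<^bsub>product_group ?I (\<lambda>_. sym_group p)\<^esub> \<Phi> h"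
        by (simp add: sym_group_mult)
    qed
    show "bij_betw \<Phi> (carrier (aut_group \<Gamma>\<lparr>carrier := K\<rparr>)) (carrier (product_group ?I (\<lambda>_. sym_group p)))"
    proof (rule bij_betwI')
      fix g h assume "g \<in> carrier (aut_group \<Gamma>\<lparr>carrier := K\<rparr>)" "h \<in> carrier (aut_group \<Gamma>\<lparr>carrier := K\<rparr>)"
      then have g: "g \<in> K" and h: "h \<in> K" by auto
      show "\<Phi> g = \<Phi> h \<longleftrightarrow> g = h"
      proof
        assume e: "\<Phi> g = \<Phi> h"
        show "g = h"
        proof (rule aut_eqI[OF KA[OF g] KA[OF h]])
          fix v assume "v \<in> verts \<Gamma>"
          then consider "v \<in> W" | "v \<in> U" using verts_eq by blast
          then show "g v = h v"
          proof cases
            case 1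
            then show ?thesis using g h by (simp add: K_iff)
          next
            case 2
            obtain i n where x: "c v = (i, n)" "i \<in> ?I" "n \<in> ?J" using cT[OF 2] by blast
            have "c (g v) = c (h v)"
              using key[OF g x(2,3)] key[OF h x(2,3)] e c'c[OF 2] x(1) by simp
            then show ?thesis using c'c KU g h 2 by metis
          qed
        qed
      qed simp
    next
      show "\<Phi> g \<in> carrier (product_group ?I (\<lambda>_. sym_group p))"
        if "g \<in> carrier (aut_group \<Gamma>\<lparr>carrier := K\<rparr>)" for g
        by (rule closed[OF that])
    next
      fix \<pi> assume "\<pi> \<in> carrier (product_group ?I (\<lambda>_. sym_group p))"
      then have \<pi>: "\<pi> \<in> extensional ?I" "\<And>i. i \<in> ?I \<Longrightarrow> \<pi> i permutes ?J"
        by (auto simp: sym_group_carrier PiE_def)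
      \<comment> \<open>The preimage of \<open>\<pi>\<close>: keep the class and apply the
        permutation \<open>\<pi>\<close> assigns to it to the position.\<close>
      define f where "f u = c' (fst (c u), \<pi> (fst (c u)) (snd (c u)))" for u
      have fT: "(fst (c u), \<pi> (fst (c u)) (snd (c u))) \<in> ?T" if u: "u \<in> U" for u
      proof -
        have "fst (c u) \<in> ?I" "snd (c u) \<in> ?J" using cT[OF u] by (simp_all only: mem_Times_iff)
        then show ?thesis using permutes_in_image[OF \<pi>(2)] by blast
      qed
      have cf: "c (f u) = (fst (c u), \<pi> (fst (c u)) (snd (c u)))" if u: "u \<in> U" for u
        using cc'[OF fT[OF u]] by (simp add: f_def)
      have fU: "f u \<in> U" if u: "u \<in> U" for u using c'U[OF fT[OF u]] by (simp add: f_def)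
      have bf: "bij_betw f U U"
      proof (rule finite_inj_on_endo_bij[OF finite_parts(2) _ fU])
        show "inj_on f U"
        proof (rule inj_onI)
          fix u v assume uv: "u \<in> U" "v \<in> U" "f u = f v"
          then have "fst (c u) = fst (c v)" "\<pi> (fst (c u)) (snd (c u)) = \<pi> (fst (c u)) (snd (c v))"
            using cf[OF uv(1)] cf[OF uv(2)] by auto
          moreover have "inj (\<pi> (fst (c u)))"
            using \<pi>(2) cT[OF uv(1)] permutes_inj by (auto simp: mem_Times_iff)
          ultimately have "c u = c v" by (auto simp: prod_eq_iff dest: injD)
          then show "u = v" using c'c uv by metis
        qed
      qed
      have Nf: "N (f u) = N u" if u: "u \<in> U" for u
        using cls_fst[OF fU[OF u] u] cf[OF u] by simp
      obtain g where g: "g \<in> K" "\<And>u. u \<in> U \<Longrightarrow> g u = f u"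
        using twin_permutation_in_K[OF bf Nf] by blast
      have "\<Phi> g = \<pi>"
      proof (rule extensionalityI[of _ ?I])
        fix i assume i: "i \<in> ?I"
        have "\<Phi> g i n = \<pi> i n" for n
        proof (cases "n \<in> ?J")
          case True
          then have x: "(i, n) \<in> ?T" using i by simp
          have "(i, \<Phi> g i n) = c (f (c' (i, n)))" using key[OF g(1) i True] g(2)[OF c'U[OF x]] by simp
          then show ?thesis using cf[OF c'U[OF x]] cc'[OF x] by simp
        next
          case False
          then show ?thesis using i permutes_not_in[OF \<pi>(2)[OF i]] by (simp add: \<Phi>_def del: atLeastAtMost_iff)
        qed
        then show "\<Phi> g i = \<pi> i" by blast
      qed (use \<pi> in \<open>simp_all add: \<Phi>_def\<close>)
      then show "\<exists>g\<in>carrier (aut_group \<Gamma>\<lparr>carrier := K\<rparr>). \<pi> = \<Phi> g" using g(1) by auto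
    qed
  qed
  then show ?thesis by (auto simp: is_iso_def)
qed

text \<open>\<open>K\<close> fixes every block, so all members of the coset have the same image of
  \<open>B\<close> and the union in \<open>coset_act\<close> collapses to it.\<close>

lemma coset_act_coset:
  assumes g: "g \<in> Aut" and P: "P \<subseteq> \<W> \<union> \<U>"
  shows "coset_act P (K #>\<^bsub>aut_group \<Gamma>\<^esub> g) = (\<lambda>B\<in>P. g ` B)"
  unfolding coset_act_def
proof (rule restrict_ext)
  fix B assume "B \<in> P"
  then have B: "B \<in> \<W> \<union> \<U>" using P by blast
  then have gB: "g ` B \<in> \<W> \<union> \<U>" using aut_image_\<W>[OF g] aut_image_\<U>[OF g] by blast
  have im: "(k \<otimes>\<^bsub>aut_group \<Gamma>\<^esub> g) ` B = g ` B" if k: "k \<in> K" for k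
  proof -
    have "k \<in> Aut" using k by (simp add: K_iff)
    then show ?thesis using aut_mult_image[OF _ g block_subset[OF B]] K_fixes_blocks[OF k gB] by simp
  qed
  have "\<one>\<^bsub>aut_group \<Gamma>\<^esub> \<in> K"
    using subgroup.one_closed[OF normal_imp_subgroup[OF normal_K]] .
  then have "K \<noteq> {}" by blast
  moreover have "(\<Union>h\<in>K #>\<^bsub>aut_group \<Gamma>\<^esub> g. h ` B) = (\<Union>k\<in>K. (k \<otimes>\<^bsub>aut_group \<Gamma>\<^esub> g) ` B)"
    by (auto simp: r_coset_def)
  ultimately show "(\<Union>h\<in>K #>\<^bsub>aut_group \<Gamma>\<^esub> g. h ` B) = g ` B" using im by simp
qed

text \<open>If the cosets of \<open>g\<close> and \<open>h\<close> act alike on the classes, then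
  \<open>g\<close> times the inverse of \<open>h\<close> fixes each class and lies in
  \<open>K\<close>. A general \<open>P\<close> covers both \<open>\<U>\<close> and
  \<open>\<W> \<union> \<U>\<close>.\<close>

lemma coset_act_faithful:
  assumes P: "P \<subseteq> \<W> \<union> \<U>" "\<U> \<subseteq> P" and closed: "\<And>g B. g \<in> Aut \<Longrightarrow> B \<in> P \<Longrightarrow> g ` B \<in> P"
  shows "faithful_action (aut_group \<Gamma> Mod K) P (coset_act P)"
proof -
  interpret A: group "aut_group \<Gamma>" by (rule group_aut)
  interpret K: normal K "aut_group \<Gamma>" by (rule normal_K)
  interpret Q: group "aut_group \<Gamma> Mod K" by (rule K.factorgroup_is_group)
  interpret B: group "BijGroup P" by (rule group_BijGroup)
  have coset: "\<exists>g\<in>Aut. C = K #>\<^bsub>aut_group \<Gamma>\<^esub> g" if "C \<in> carrier (aut_group \<Gamma> Mod K)" for C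
    using that by (auto simp: FactGroup_def RCOSETS_def)
  have act: "coset_act P (K #>\<^bsub>aut_group \<Gamma>\<^esub> g) \<in> Bij P" if g: "g \<in> Aut" for g
  proof -
    have "bij_betw ((`) g) P P" by (rule image_bij_blocks[OF g P(1)]) (rule closed[OF g])
    then show ?thesis by (simp add: coset_act_coset[OF g P(1)] Bij_def cong: bij_betw_cong)
  qed
  show ?thesis
  proof unfold_locales
    show "coset_act P \<in> hom (aut_group \<Gamma> Mod K) (BijGroup P)"
    proof (rule homI)
      show "coset_act P C \<in> carrier (BijGroup P)" if "C \<in> carrier (aut_group \<Gamma> Mod K)" for C
        using coset[OF that] act by auto
      fix C D assume "C \<in> carrier (aut_group \<Gamma> Mod K)" "D \<in> carrier (aut_group \<Gamma> Mod K)"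
      then obtain g h where g: "g \<in> Aut" "C = K #>\<^bsub>aut_group \<Gamma>\<^esub> g" and h: "h \<in> Aut" "D = K #>\<^bsub>aut_group \<Gamma>\<^esub> h"
        using coset by metis
      have "C \<otimes>\<^bsub>aut_group \<Gamma> Mod K\<^esub> D = K #>\<^bsub>aut_group \<Gamma>\<^esub> (g \<otimes>\<^bsub>aut_group \<Gamma>\<^esub> h)"
        using K.rcos_sum[OF g(1) h(1)] g h by (simp add: FactGroup_def)
      then have "coset_act P (C \<otimes>\<^bsub>aut_group \<Gamma> Mod K\<^esub> D) = (\<lambda>B\<in>P. (g \<otimes>\<^bsub>aut_group \<Gamma>\<^esub> h) ` B)"
        using coset_act_coset[OF _ P(1), of "g \<otimes>\<^bsub>aut_group \<Gamma>\<^esub> h"] g h by simp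
      also have "\<dots> = compose P (coset_act P C) (coset_act P D)"
      proof (rule extensionalityI[of _ P])
        fix B assume B: "B \<in> P"
        have "(g \<otimes>\<^bsub>aut_group \<Gamma>\<^esub> h) ` B = g ` h ` B"
          by (rule aut_mult_image[OF g(1) h(1) block_subset]) (rule subsetD[OF P(1) B])
        then show "(\<lambda>B\<in>P. (g \<otimes>\<^bsub>aut_group \<Gamma>\<^esub> h) ` B) B = compose P (coset_act P C) (coset_act P D) B"
          using B closed[OF h(1) B] g h coset_act_coset[OF _ P(1)] by (simp add: compose_eq)
      qed (simp_all add: compose_def)
      finally show "coset_act P (C \<otimes>\<^bsub>aut_group \<Gamma> Mod K\<^esub> D) = coset_act P C \<otimes>\<^bsub>BijGroup P\<^esub> coset_act P D"
        using act g h by (simp add: mult_BijGroup)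
    qed
    show "inj_on (coset_act P) (carrier (aut_group \<Gamma> Mod K))"
    proof (rule inj_onI)
      fix C D assume "C \<in> carrier (aut_group \<Gamma> Mod K)" "D \<in> carrier (aut_group \<Gamma> Mod K)"
        and e: "coset_act P C = coset_act P D"
      then obtain g h where g: "g \<in> Aut" "C = K #>\<^bsub>aut_group \<Gamma>\<^esub> g" and h: "h \<in> Aut" "D = K #>\<^bsub>aut_group \<Gamma>\<^esub> h"
        using coset by metis
      let ?h = "inv\<^bsub>aut_group \<Gamma>\<^esub> h"
      have hA: "?h \<in> Aut" using h by simp
      have "(g \<otimes>\<^bsub>aut_group \<Gamma>\<^esub> ?h) ` B = B" if B: "B \<in> \<U>" for B
      proof -
        have hB: "?h ` B \<in> P" using aut_image_\<U>[OF hA B] P(2) by blast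
        have "(g \<otimes>\<^bsub>aut_group \<Gamma>\<^esub> ?h) ` B = g ` ?h ` B"
          by (rule aut_mult_image[OF g(1) hA block_subset]) (rule UnI2[OF B])
        also have "\<dots> = h ` ?h ` B"
          using fun_cong[OF e, of "?h ` B"] hB coset_act_coset[OF _ P(1)] g h by simp
        also have "\<dots> = (h \<otimes>\<^bsub>aut_group \<Gamma>\<^esub> ?h) ` B"
          by (rule aut_mult_image[OF h(1) hA block_subset, symmetric]) (rule UnI2[OF B])
        also have "\<dots> = B"
        proof -
          have "(\<lambda>v\<in>verts \<Gamma>. v) ` B = (\<lambda>v. v) ` B"
            using block_subset[OF UnI2[OF B]] by (intro image_cong) auto
          then show ?thesis unfolding A.r_inv[OF h(1)] one_aut by simp
        qed
        finally show ?thesis .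
      qed
      then have k: "g \<otimes>\<^bsub>aut_group \<Gamma>\<^esub> ?h \<in> K" using g hA by (intro fixes_classes_in_K) simp_all
      have "g = (g \<otimes>\<^bsub>aut_group \<Gamma>\<^esub> ?h) \<otimes>\<^bsub>aut_group \<Gamma>\<^esub> h" using g h by (simp add: A.m_assoc)
      then have "g \<in> K #>\<^bsub>aut_group \<Gamma>\<^esub> h" using k unfolding r_coset_def by blast
      then show "C = D" unfolding g(2) h(2) using A.repr_independence[OF _ h(1) K.subgroup_axioms] by metis
    qed
  qed
qed

text \<open>Automorphisms that agree on \<open>U\<close> send a vertex of \<open>W\<close> to
  vertices with the same neighborhood, and \<open>W\<close> has no twins.\<close>

lemma faithful_on_U: "faithful_action (aut_group \<Gamma>) U (act_on U)"
proof -
  interpret A: group "aut_group \<Gamma>" by (rule group_aut)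
  interpret B: group "BijGroup U" by (rule group_BijGroup)
  have act: "act_on U g \<in> Bij U" if g: "g \<in> Aut" for g
  proof -
    have "inj_on g U" using bij_betw_imp_inj_on[OF aut_bij[OF g]] V_I by (auto intro: inj_on_subset)
    then have "bij_betw g U U" using aut_U[OF g] by (simp add: bij_betw_def)
    then show ?thesis by (simp add: act_on_def Bij_def cong: bij_betw_cong)
  qed
  show ?thesis
  proof unfold_locales
    show "act_on U \<in> hom (aut_group \<Gamma>) (BijGroup U)"
    proof (rule homI)
      show "act_on U g \<in> carrier (BijGroup U)" if "g \<in> Aut" for g using act that by simp
      fix g h assume gh: "g \<in> Aut" "h \<in> Aut"
      have "act_on U (g \<otimes>\<^bsub>aut_group \<Gamma>\<^esub> h) = compose U (act_on U g) (act_on U h)"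
        unfolding mult_aut[OF gh] act_on_def
        using aut_mem_U[OF gh(2)] V_I by (auto simp: compose_def restrict_def fun_eq_iff)
      then show "act_on U (g \<otimes>\<^bsub>aut_group \<Gamma>\<^esub> h) = act_on U g \<otimes>\<^bsub>BijGroup U\<^esub> act_on U h"
        using act gh by (simp add: mult_BijGroup)
    qed
    show "inj_on (act_on U) Aut"
    proof (rule inj_onI)
      fix g h assume g: "g \<in> Aut" and h: "h \<in> Aut" and e: "act_on U g = act_on U h"
      have eU: "g u = h u" if "u \<in> U" for u
        using fun_cong[OF e, of u] that by (simp add: act_on_def)
      show "g = h"
      proof (rule aut_eqI[OF g h])
        fix v assume "v \<in> verts \<Gamma>"
        then consider "v \<in> W" | "v \<in> U" using verts_eq by blast
        then show "g v = h v"
        proof cases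
          case 1
          have "N (g v) = g ` N v" using nbhd_aut[OF g] V_I 1 by simp
          also have "\<dots> = h ` N v" using eU nbhd_W[OF 1] by (intro image_cong) auto
          also have "\<dots> = N (h v)" using nbhd_aut[OF h] V_I 1 by simp
          finally show ?thesis using inj_onD[OF inj_nbhd_W] aut_mem_W[OF g 1] aut_mem_W[OF h 1] by blast
        qed (rule eU)
      qed
    qed
  qed
qed

end

section \<open>From the hypotheses on the graph to a pair of twins\<close>

theorem theorem1p3:
  fixes p :: nat and \<Gamma> :: "'a sgraph" and W U :: "'a set"
    and A :: "('a \<Rightarrow> 'a) monoid" and K :: "('a \<Rightarrow> 'a) set"
    and \<W> \<U> :: "'a set set" and \<Sigma> :: "'a set sgraph"
  assumes "Factorial_Ring.prime p" and "odd p"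
    and "semisymmetric \<Gamma>" and "card (verts \<Gamma>) = 2 * p ^ 3" and "bipartition \<Gamma> W U"
    and "A = aut_group \<Gamma>"
    and "group_action A W (act_on W)" and "\<not> faithful_action A W (act_on W)"
    and "K = action_kernel A W"
    and "\<W> = (\<lambda>w. {w}) ` W"
    and "\<U> = orbits (A\<lparr>carrier := K\<rparr>) U (act_on U)"
    and "\<Sigma> = quotient_graph \<Gamma> (orbits (A\<lparr>carrier := K\<rparr>) (verts \<Gamma>) (act_on (verts \<Gamma>)))"
  shows "((\<forall>B\<in>\<U>. card B = p) \<and>
          A\<lparr>carrier := K\<rparr> \<cong> product_group {..<p ^ 2} (\<lambda>_. sym_group p) \<and>
          expanded_from p \<Gamma> W \<Sigma> \<W> \<U>) \<and>
         (faithful_action (A Mod K) \<U> (coset_act \<U>) \<and>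
          faithful_action (A Mod K) (\<W> \<union> \<U>) (coset_act (\<W> \<union> \<U>)) \<and>
          A Mod K \<cong> aut_group \<Sigma>) \<and>
         (faithful_action A U (act_on U) \<and>
          (\<forall>x\<in>W. \<forall>y\<in>W. x \<noteq> y \<longrightarrow> nbhd \<Gamma> x \<noteq> nbhd \<Gamma> y))"
proof -
  have ss: "simple_graph \<Gamma>" "regular_graph \<Gamma>" "edge_transitive \<Gamma>" "\<not> vertex_transitive \<Gamma>"
    using assms(3) by (auto simp: semisymmetric_def)
  interpret bipartite_graph \<Gamma> W U by unfold_locales (use ss assms(5) in auto)
  interpret W: group_action "aut_group \<Gamma>" W "act_on W" using assms(6,7) by simp
  have WV: "W \<subseteq> verts \<Gamma>" and UV: "U \<subseteq> verts \<Gamma>" using verts_eq by auto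
  \<comment> \<open>That \<open>act_on W\<close> is an action means that each restriction is a
    bijection of \<open>W\<close>, so no automorphism exchanges the parts.\<close>
  have aut_W: "g ` W = W" if "g \<in> Aut" for g
    using W.surj_prop[OF that] by (simp add: act_on_def)
  \<comment> \<open>In a graph without edges every transposition is an automorphism, so it would be
    vertex-transitive.\<close>
  have "edges \<Gamma> \<noteq> {}"
  proof
    assume "edges \<Gamma> = {}"
    then have "\<exists>g\<in>Aut. g x = y" if xy: "x \<in> verts \<Gamma>" "y \<in> verts \<Gamma>" for x y
    proof -
      have "restrict (Transposition.transpose x y) (verts \<Gamma>) \<in> Aut"
        by (rule restrict_aut) (simp add: graph_iso_def xy bij_betw_transpose_iff \<open>edges \<Gamma> = {}\<close>)
      then show ?thesis using xy by (intro bexI) simp_all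
    qed
    then have "vertex_transitive \<Gamma>" by (simp add: vertex_transitive_def)
    then show False using ss by simp
  qed
  then obtain w0 u0 where wu0: "w0 \<in> W" "u0 \<in> U" "{w0, u0} \<in> edges \<Gamma>" using edgeE by blast
  obtain d where d: "\<And>v. v \<in> verts \<Gamma> \<Longrightarrow> card (N v) = d" using ss(2) by (auto simp: regular_graph_def)
  have fin: "finite (verts \<Gamma>)" using ss(1) by (simp add: simple_graph_def)
  have "u0 \<in> N w0" using wu0 UV by (auto simp: nbhd_def)
  then have d0: "d > 0"
    using d[of w0] wu0 WV finite_subset[OF nbhd_subset fin] by (metis card_gt_0_iff empty_iff subsetD)
  have nonempty: "N v \<noteq> {}" if "v \<in> verts \<Gamma>" for v using d[OF that] d0 by auto
  \<comment> \<open>Edge-transitivity moves unordered edges, but as \<open>W\<close> is preserved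
    the ends correspond. Since every vertex lies on an edge, transitivity on each part
    follows.\<close>
  have moves: "\<exists>g\<in>Aut. g w = w' \<and> g u = u'"
    if e: "w \<in> W" "u \<in> U" "{w, u} \<in> edges \<Gamma>" "w' \<in> W" "u' \<in> U" "{w', u'} \<in> edges \<Gamma>" for w u w' u'
  proof -
    obtain g where g: "g \<in> Aut" "g ` {w, u} = {w', u'}" using ss(3) e by (meson edge_transitive_def)
    have "g w \<in> W" using aut_W[OF g(1)] e by blast
    then have "g w = w'" using g(2) e disjoint by auto
    moreover have "g u \<noteq> g w" using aut_eq_iff[OF g(1)] e WV UV disjoint by blast
    ultimately have "g u = u'" using g(2) by auto
    then show ?thesis using \<open>g w = w'\<close> g(1) by blast
  qed
  have tW: "\<exists>g\<in>Aut. g x = y" if xy: "x \<in> W" "y \<in> W" for x y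
  proof -
    obtain u u' where "u \<in> N x" "u' \<in> N y" using nonempty xy WV by blast
    then have "u \<in> U" "u' \<in> U" "{x, u} \<in> edges \<Gamma>" "{y, u'} \<in> edges \<Gamma>"
      using nbhd_W xy by (blast, blast, simp_all add: nbhd_def)
    then show ?thesis using moves xy by blast
  qed
  have tU: "\<exists>g\<in>Aut. g x = y" if xy: "x \<in> U" "y \<in> U" for x y
  proof -
    obtain w w' where "w \<in> N x" "w' \<in> N y" using nonempty xy UV by blast
    then have "w \<in> W" "w' \<in> W" "{w, x} \<in> edges \<Gamma>" "{w', y} \<in> edges \<Gamma>"
      using nbhd_U xy by (blast, blast, simp_all add: nbhd_def insert_commute)
    then show ?thesis using moves xy by blast
  qed
  have "card W = card U"
    by (rule regular_parts[OF order_refl order_refl nbhd_W nbhd_U d d0])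
  moreover have "card (verts \<Gamma>) = card W + card U"
    using card_Un_disjoint[OF finite_parts disjoint] verts_eq by simp
  ultimately have cards: "card W = p ^ 3" "card U = p ^ 3" using assms(4) by auto
  have "\<not> inj_on (act_on W) Aut"
    using assms(6,8) W.group_action_axioms by (auto simp: faithful_action_def faithful_action_axioms_def)
  then obtain g h where gh: "g \<in> Aut" "h \<in> Aut" "act_on W g = act_on W h" "g \<noteq> h"
    by (auto simp: inj_on_def)
  have eW: "g w = h w" if "w \<in> W" for w using fun_cong[OF gh(3), of w] that by (simp add: act_on_def)
  then obtain u where u: "u \<in> U" "g u \<noteq> h u"
    using aut_eqI[OF gh(1,2)] gh(4) verts_eq by blast
  \<comment> \<open>\<open>g\<close> and \<open>h\<close> agree on \<open>N u\<close>, a subset of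
    \<open>W\<close>, so the distinct vertices \<open>g u\<close> and \<open>h u\<close> are
    twins.\<close>
  have "N (g u) = N (h u)"
  proof -
    have "g ` N u = h ` N u" using eW nbhd_U[OF u(1)] by (intro image_cong) auto
    then show ?thesis using nbhd_aut gh u UV by (metis subsetD)
  qed
  moreover have "g u \<in> U" "h u \<in> U"
  proof -
    have "k u \<in> U" if k: "k \<in> Aut" for k
    proof -
      have "k u \<notin> W"
      proof
        assume "k u \<in> W"
        then obtain w where "w \<in> W" "k u = k w" using aut_W[OF k] by (metis imageE)
        then show False using aut_eq_iff[OF k] u UV WV disjoint by blast
      qed
      then show ?thesis using aut_mem[OF k, of u] u UV verts_eq by blast
    qed
    then show "g u \<in> U" "h u \<in> U" using gh by auto
  qed
  ultimately have "\<exists>x\<in>U. \<exists>y\<in>U. x \<noteq> y \<and> N x = N y" using u(2) by blast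
  then interpret T: twinned_graph \<Gamma> W U p d
    by unfold_locales (use assms(1) aut_W cards tW tU ss(3) d d0 in auto)
  have K: "K = action_kernel (aut_group \<Gamma>) W" using assms(6,9) by simp
  have \<U>: "\<U> = (\<lambda>u. {z \<in> U. N z = N u}) ` U" using assms(6,11) K T.orbits_U by simp
  have \<Sigma>: "\<Sigma> = quotient_graph \<Gamma> (\<W> \<union> \<U>)"
    unfolding assms(12) \<U> assms(10) assms(6) K T.orbits_verts ..
  have 1: "\<forall>B\<in>\<U>. card B = p" using T.U_class_card by (auto simp: \<U>)
  have 2: "faithful_action (A Mod K) \<U> (coset_act \<U>)"
    unfolding \<U> assms(6) K by (rule T.coset_act_faithful[OF Un_upper2 order_refl T.aut_image_\<U>])
  have 3: "faithful_action (A Mod K) (\<W> \<union> \<U>) (coset_act (\<W> \<union> \<U>))"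
    unfolding \<U> assms(6,10) K
    by (rule T.coset_act_faithful[OF order_refl Un_upper2])
      (elim UnE; intro UnI1 UnI2 T.aut_image_\<W> T.aut_image_\<U>; assumption)
  have 4: "\<forall>x\<in>W. \<forall>y\<in>W. x \<noteq> y \<longrightarrow> N x \<noteq> N y"
    using T.inj_nbhd_W by (auto simp: inj_on_def)
  have 5: "A\<lparr>carrier := K\<rparr> \<cong> product_group {..<p ^ 2} (\<lambda>_. sym_group p)"
    unfolding assms(6) K by (rule T.K_iso)
  have 6: "expanded_from p \<Gamma> W \<Sigma> \<W> \<U>"
    unfolding \<Sigma> \<U> assms(10) by (rule T.expanded_from_\<Sigma>)
  have 7: "A Mod K \<cong> aut_group \<Sigma>"
    unfolding \<Sigma> \<U> assms(6,10) K by (rule T.aut_quotient_iso)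
  have 8: "faithful_action A U (act_on U)"
    unfolding assms(6) by (rule T.faithful_on_U)
  show ?thesis by (intro conjI 1 2 3 4 5 6 7 8)
qed

end
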